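(* Let $q$ be a prime power, let $n\ge 2$, and let $\overline{H}$ satisfy $\mathrm{PSL}_n(q)\le\overline{H}\le\mathrm{P\Gamma L}_n(q)$. Let $e:=|\overline{H}:\overline{H}\cap\mathrm{PGL}_n(q)|$, and suppose that $e>1$ (so that $q\ge 4$ and $\overline{H}\not\le\mathrm{PGL}_n(q)$). Let $\Omega_1$ be the set of $1$-dimensional subspaces of $\mathbb{F}_q^n$. (i) If $n=2$ and $q\ge 8$, then $4+\omega(e)\ge\mathrm{RC}(\overline{H},\Omega_1)\ge 4$, except that $\mathrm{RC}(\mathrm{P\Sigma L}_2(9),\Omega_1)=3$. (ii) If $n\ge 3$, then $$2n-1+\omega(e)\ \ge\ \mathrm{RC}(\overline{H},\Omega_1)\ \ge\ \begin{cases} n+2 & \text{always},\\ n+3 & \text{if } \mathrm{PGL}_n(q)<\overline{H},\\ 2n-2 & \text{if } \overline{H}\le\mathrm{P\Sigma L}_n(q)\ne\mathrm{P\Gamma L}_n(q).\end{cases}$$ (Each of the lower bounds holds whenever its condition is satisfied.)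
   Context: Relational complexity: let a group $H$ act on a set $\Omega$ (on the right, $x\mapsto x^h$). For $X=(x_1,\ldots,x_k),\,Y=(y_1,\ldots,y_k)\in\Omega^k$ and $r\le k$, say that $X$ and $Y$ are $r$-equivalent under $H$ if for every $r$-subset $\{i_1,\ldots,i_r\}\subseteq\{1,\ldots,k\}$ there exists $h\in H$ with $(x_{i_1}^h,\ldots,x_{i_r}^h)=(y_{i_1},\ldots,y_{i_r})$. The relational complexity $\mathrm{RC}(H,\Omega)$ is the smallest $r\ge 1$ such that, for all $k\ge r$ and all $X,Y\in\Omega^k$, $r$-equivalence of $X$ and $Y$ under $H$ implies $Y\in X^H$. For a positive integer $k$, $\omega(k)$ is the number of distinct prime divisors of $k$, with $\omega(1)=0$. $\mathrm{\Gamma L}_n(q)=\mathrm{GL}_n(q)\rtimes\langle\phi\rangle$ and $\mathrm{\Sigma L}_n(q)=\mathrm{SL}_n(q)\rtimes\langle\phi\rangle$, where $q=p^f$ with $p$ prime and $\phi$ generates $\mathrm{Aut}(\mathbb{F}_q)$, acting on matrices by raising each entry to its $p$-th power (and on vectors coordinatewise). $\mathrm{P\Gamma L}_n(q)$ and $\mathrm{P\Sigma L}_n(q)$ are the images of these groups modulo scalars, acting naturally on $\Omega_1$. *)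

theory Defs
  imports
    "HOL-Analysis.Analysis"
    "HOL-Algebra.Coset"
    "HOL-Computational_Algebra.Primes"
begin

section \<open>Relational complexity\<close>

text \<open>
  An action is given by the set \<open>H\<close> of group elements and a function
  \<open>act :: 'g \<Rightarrow> 'a \<Rightarrow> 'a\<close>; tuples are lists. Only the orbits of \<open>H\<close> on tuples matter, so it is
  irrelevant whether the action is a left or a right one.
\<close>

definition r_equivalent ::
    "'g set \<Rightarrow> ('g \<Rightarrow> 'a \<Rightarrow> 'a) \<Rightarrow> nat \<Rightarrow> 'a list \<Rightarrow> 'a list \<Rightarrow> bool" where
  "r_equivalent H act r X Y \<longleftrightarrow>
     (\<forall>I \<subseteq> {..<length X}. card I = r \<longrightarrow> (\<exists>h\<in>H. \<forall>i\<in>I. act h (X ! i) = Y ! i))"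

definition rel_complexity :: "'g set \<Rightarrow> ('g \<Rightarrow> 'a \<Rightarrow> 'a) \<Rightarrow> 'a set \<Rightarrow> nat" where
  "rel_complexity H act \<Omega> =
     (LEAST r. r \<ge> 1 \<and>
        (\<forall>k\<ge>r. \<forall>X Y. length X = k \<and> length Y = k \<and> set X \<subseteq> \<Omega> \<and> set Y \<subseteq> \<Omega> \<and>
           r_equivalent H act r X Y \<longrightarrow> (\<exists>h\<in>H. Y = map (act h) X)))"

definition omega :: "nat \<Rightarrow> nat" where
  "omega k = card {p. prime p \<and> p dvd k}"


section \<open>Semilinear groups over a finite field\<close>

definition frob :: "'q::finite_field \<Rightarrow> 'q" where
  "frob x = x ^ CHAR('q)"

text \<open>
  The cyclic group generated by the Frobenius automorphism, i.e.\ the automorphism group of the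
  field. The automorphism has finite order, so its nonnegative powers suffice.
\<close>

definition frob_powers :: "('q::finite_field \<Rightarrow> 'q) set" where
  "frob_powers = range (\<lambda>i. frob ^^ i)"

definition GL :: "('q::finite_field ^ 'n ^ 'n) set" where
  "GL = {A. invertible A}"

definition SL :: "('q::finite_field ^ 'n ^ 'n) set" where
  "SL = {A. det A = 1}"

text \<open>
  The semidirect product of \<open>GL\<close> with the group of field automorphisms. The pair \<open>(A, \<sigma>)\<close> stands
  for the semilinear map \<open>v \<mapsto> A (\<sigma> v)\<close> on column vectors, which determines the multiplication.
\<close>

definition GammaL :: "(('q::finite_field ^ 'n ^ 'n) \<times> ('q \<Rightarrow> 'q)) monoid" where
  "GammaL = \<lparr>carrier = GL \<times> frob_powers,
             mult = (\<lambda>(A, \<sigma>) (B, \<tau>). (A ** map_matrix \<sigma> B, \<sigma> \<circ> \<tau>)),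
             one = (mat 1, id)\<rparr>"

definition semilinear_map ::
    "('q::finite_field ^ 'n ^ 'n) \<times> ('q \<Rightarrow> 'q) \<Rightarrow> 'q ^ 'n \<Rightarrow> 'q ^ 'n" where
  "semilinear_map = (\<lambda>(A, \<sigma>) v. A *v (\<chi> i. \<sigma> (v $ i)))"


section \<open>Projective groups\<close>

definition scalars :: "(('q::finite_field ^ 'n ^ 'n) \<times> ('q \<Rightarrow> 'q)) set" where
  "scalars = {(mat c, id) | c. c \<noteq> 0}"

definition PGammaL :: "(('q::finite_field ^ 'n ^ 'n) \<times> ('q \<Rightarrow> 'q)) set monoid" where
  "PGammaL = GammaL Mod scalars"

definition mod_scalars ::
    "(('q::finite_field ^ 'n ^ 'n) \<times> ('q \<Rightarrow> 'q)) set \<Rightarrow>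
     (('q ^ 'n ^ 'n) \<times> ('q \<Rightarrow> 'q)) set set" where
  "mod_scalars S = (\<lambda>g. scalars #>\<^bsub>GammaL\<^esub> g) ` S"

definition PGL :: "(('q::finite_field ^ 'n ^ 'n) \<times> ('q \<Rightarrow> 'q)) set set" where
  "PGL = mod_scalars (GL \<times> {id})"

definition PSL :: "(('q::finite_field ^ 'n ^ 'n) \<times> ('q \<Rightarrow> 'q)) set set" where
  "PSL = mod_scalars (SL \<times> {id})"

definition PSigmaL :: "(('q::finite_field ^ 'n ^ 'n) \<times> ('q \<Rightarrow> 'q)) set set" where
  "PSigmaL = mod_scalars (SL \<times> frob_powers)"

definition points :: "('q::finite_field ^ 'n) set set" where
  "points = {L. vec.subspace L \<and> vec.dim L = 1}"

text \<open>
  All elements of a coset of the scalars map a given subspace to the same subspace, so for a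
  coset \<open>C\<close> in \<open>PGammaL\<close> the union below is just the image of \<open>L\<close> under any element of \<open>C\<close>.
\<close>

definition proj_act ::
    "(('q::finite_field ^ 'n ^ 'n) \<times> ('q \<Rightarrow> 'q)) set \<Rightarrow> ('q ^ 'n) set \<Rightarrow> ('q ^ 'n) set" where
  "proj_act C L = (\<Union>g\<in>C. semilinear_map g ` L)"

definition index_in :: "('g, 'b) monoid_scheme \<Rightarrow> 'g set \<Rightarrow> 'g set \<Rightarrow> nat" where
  "index_in G H K = card (rcosets\<^bsub>G\<lparr>carrier := H\<rparr>\<^esub> K)"

end

theory Submission
  imports Defs "HOL-Algebra.Multiplicative_Group" "HOL-Algebra.Sylow"
begin

text \<open>
  Everything is phrased for the set \<open>R\<close> of semilinear maps representing \<open>H\<close>, acting on nonzero vectors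
  up to scalars.

  Upper bound. Any family of points contains a subfamily of at most \<open>max (2n - 2) (n + 1)\<close> points
  with the same pointwise stabiliser in \<open>PGL\<close>. Modulo the linear part, the stabilisers obtained by adding one
  more point are subgroups of a cyclic group of order \<open>e\<close>, so \<open>omega e\<close> further points cut out the
  stabiliser of the whole family in \<open>H\<close>. If every set consisting of these points and one more can be
  moved correctly, a single element moves the whole family correctly.

  Lower bounds. A tuple and its image under a map outside \<open>H\<close>, or two tuples with conjugate cross
  ratios, are locally equivalent if omitting points gives enough freedom to correct the determinant
  or the field automorphism. The configurations are: two flats with coupled cross ratios
  (\<open>n + 3\<close>, or \<open>n + 2\<close> inside a hyperplane), the vectors \<open>e\<^sub>i\<close> and \<open>e\<^sub>i + e\<^sub>z\<close>
  (\<open>2n - 2\<close>), five points in a plane for \<open>n = 3\<close> and four points on a line for \<open>n = 2\<close>.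
  Over the field with 9 elements the norm form to the prime field shows that \<open>PSigmaL\<close> is an
  exception.
\<close>

section \<open>Field automorphisms\<close>

text \<open>What shapes the proof is that \<open>H\<close> is only known to contain PSL. By
  \<open>R_same_det\<close>, membership of a semilinear map in the preimage of \<open>H\<close>
  depends only on its field automorphism and on its determinant modulo n-th powers. If PGL lies in
  \<open>H\<close>, determinants are free and the two flats may fill the space; otherwise one
  coordinate is spent on the determinant, which costs one point. For n = 3 a hyperplane is a line,
  too small for two flats, so the action of Frobenius modulo cubes decides which configuration is
  used. For n = 2 squares replace cubes: automorphisms preserve square classes, and a pigeonhole
  argument finds non-conjugate coordinates with the same square classes. In odd characteristic it
  needs 4 f + 2 < p^f, which for f \<ge> 2 fails exactly for 9. In the upper bound the maximum with
  n + 1 matters only for n = 2, where three points of a line are needed.\<close>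

lemma frob_funpow: "(frob ^^ k) (x :: 'q::finite_field) = x ^ (CHAR('q) ^ k)"
  by (induction k) (simp_all add: frob_def flip: power_mult, simp add: mult.commute)

lemma frob_powersE:
  assumes "\<sigma> \<in> (frob_powers :: ('q::finite_field \<Rightarrow> 'q) set)"
  obtains k where "\<sigma> = frob ^^ k" "\<And>x. \<sigma> x = x ^ (CHAR('q) ^ k)"
  using assms frob_funpow unfolding frob_powers_def by blast

lemma frob_powers_id [simp]: "id \<in> frob_powers"
  unfolding frob_powers_def by (metis funpow_0 eq_id_iff rangeI)

lemma frob_funpow_in [simp]: "frob ^^ k \<in> frob_powers"
  unfolding frob_powers_def by blast

lemma frob_in_frob_powers [simp]: "frob \<in> frob_powers"
  using frob_funpow_in [of 1] by simp

lemma frob_powers_comp: "\<sigma> \<in> frob_powers \<Longrightarrow> \<tau> \<in> frob_powers \<Longrightarrow> \<sigma> \<circ> \<tau> \<in> frob_powers"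
  unfolding frob_powers_def by (auto simp: funpow_add [symmetric])

context
  fixes \<sigma> :: "'q::finite_field \<Rightarrow> 'q"
  assumes \<sigma>: "\<sigma> \<in> frob_powers"
begin

lemma aut_mult [simp]: "\<sigma> (x * y) = \<sigma> x * \<sigma> y"
  using \<sigma> by (elim frob_powersE) (simp add: power_mult_distrib)

lemma aut_add [simp]: "\<sigma> (x + y) = \<sigma> x + \<sigma> y"
proof -
  obtain k where k: "\<And>x. \<sigma> x = x ^ (CHAR('q) ^ k)" using \<sigma> by (elim frob_powersE) blast
  have "(x + y) ^ (CHAR('q) ^ j) = x ^ (CHAR('q) ^ j) + y ^ (CHAR('q) ^ j)" for j
    by (rule freshmans_dream') auto
  then show ?thesis by (simp add: k)
qed

lemma aut_1 [simp]: "\<sigma> 1 = 1"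
  using \<sigma> by (elim frob_powersE) simp

lemma aut_0 [simp]: "\<sigma> 0 = 0"
  using \<sigma> by (elim frob_powersE) simp

lemma aut_minus [simp]: "\<sigma> (- x) = - \<sigma> x"
  using aut_add [of x "- x"] by (simp del: aut_add add: eq_neg_iff_add_eq_0 add.commute)

lemma aut_diff [simp]: "\<sigma> (x - y) = \<sigma> x - \<sigma> y"
  using aut_add [of x "- y"] by (simp del: aut_add)

lemma aut_power [simp]: "\<sigma> (x ^ k) = \<sigma> x ^ k"
  by (induction k) simp_all

lemma aut_eq_0_iff [simp]: "\<sigma> x = 0 \<longleftrightarrow> x = 0"
  using \<sigma> by (elim frob_powersE) simp

lemma aut_eq_iff [simp]: "\<sigma> x = \<sigma> y \<longleftrightarrow> x = y"
  using aut_eq_0_iff [of "x - y"] by (simp del: aut_eq_0_iff)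

lemma aut_divide [simp]: "\<sigma> (x / y) = \<sigma> x / \<sigma> y"
  by (cases "y = 0") (simp_all add: eq_divide_eq del: aut_mult flip: aut_mult)

lemma aut_sum [simp]: "\<sigma> (sum f A) = (\<Sum>i\<in>A. \<sigma> (f i))"
  by (induction A rule: infinite_finite_induct) simp_all

lemma aut_prod: "\<sigma> (prod f A) = (\<Prod>i\<in>A. \<sigma> (f i))"
  by (induction A rule: infinite_finite_induct) simp_all

lemma map_matrix_mult: "map_matrix \<sigma> (A ** B) = map_matrix \<sigma> A ** map_matrix \<sigma> B"
  by (simp add: vec_eq_iff matrix_matrix_mult_def)

lemma map_matrix_mat [simp]: "map_matrix \<sigma> (mat c) = mat (\<sigma> c)"
  by (simp add: vec_eq_iff mat_def)

lemma aut_of_int [simp]: "\<sigma> (of_int k) = of_int k"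
  by (induction k rule: int_induct [where k = 0]) simp_all

lemma det_map_matrix: "det (map_matrix \<sigma> A) = \<sigma> (det A)"
  by (simp add: det_def aut_prod)

lemma invertible_map_matrix: "invertible (A :: 'q^'n^'n) \<Longrightarrow> invertible (map_matrix \<sigma> A)"
  by (simp add: invertible_det_nz det_map_matrix)

end

section \<open>Cyclicity of the multiplicative group, and the order of the field\<close>

lemma finite_field_generator:
  obtains \<gamma> :: "'q::finite_field" where "\<gamma> \<noteq> 0" "\<And>x. x \<noteq> 0 \<Longrightarrow> \<exists>k. x = \<gamma> ^ k"
proof -
  \<comment> \<open>The field operations are repackaged as a HOL-Algebra ring, for which cyclicity
    of the multiplicative group is available.\<close>
  define F :: "'q ring" where
    "F = \<lparr>carrier = UNIV, monoid.mult = (*), one = 1, zero = 0, add = (+)\<rparr>"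
  have F: "field F"
  proof (rule cring.cring_fieldI2)
    show "cring F"
    proof (intro cringI abelian_groupI comm_monoidI)
      fix x :: 'q assume "x \<in> carrier F"
      show "\<exists>y\<in>carrier F. y \<oplus>\<^bsub>F\<^esub> x = \<zero>\<^bsub>F\<^esub>"
        by (rule bexI [of _ "- x"]) (simp_all add: F_def)
    qed (auto simp: F_def algebra_simps)
    show "\<exists>b\<in>carrier F. a \<otimes>\<^bsub>F\<^esub> b = \<one>\<^bsub>F\<^esub>" if "a \<in> carrier F" "a \<noteq> \<zero>\<^bsub>F\<^esub>" for a
      using that by (intro bexI [of _ "inverse a"]) (auto simp: F_def)
  qed (simp_all add: F_def)
  have pow: "x [^]\<^bsub>F\<^esub> (k::nat) = x ^ k" for x k
    by (induction k) (simp_all add: nat_pow_def F_def mult.commute)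
  obtain a where "a \<in> carrier (mult_of F)" "carrier (mult_of F) = {a [^]\<^bsub>F\<^esub> i | i::nat. i \<in> UNIV}"
    using field.finite_field_mult_group_has_gen [OF F] by (auto simp: F_def)
  then have "a \<noteq> 0" "UNIV - {0} = {a ^ i | i. True}"
    by (auto simp: pow) (auto simp: F_def)
  then show thesis by (intro that [of a]) blast+
qed

lemma aut_eq_id_if_fixes_generator:
  assumes "\<sigma> \<in> frob_powers" "\<And>x::'q::finite_field. x \<noteq> 0 \<Longrightarrow> \<exists>k. x = \<gamma> ^ k" "\<sigma> \<gamma> = \<gamma>"
  shows "\<sigma> = id"
proof
  show "\<sigma> x = id x" for x
  proof (cases "x = 0")
    case False
    then obtain k where "x = \<gamma> ^ k" using assms(2) by blast
    then show ?thesis using assms(1,3) by simp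
  qed (use assms in simp)
qed

text \<open>Sylow's theorem for the additive group: a prime r dividing the order yields a nontrivial
  subgroup of order r^a, so some x \<noteq> 0 satisfies r^a x = 0 and the characteristic divides
  r^a. Hence the characteristic is the only prime divisor of the order.\<close>

lemma card_finite_field:
  obtains f where "CARD('q::finite_field) = CHAR('q) ^ f" "f > 0"
proof -
  let ?p = "CHAR('q)" and ?q = "CARD('q)"
  define G :: "'q monoid" where "G = \<lparr>carrier = UNIV, monoid.mult = (+), one = 0\<rparr>"
  have G: "group G"
  proof (rule groupI)
    fix x :: 'q assume "x \<in> carrier G"
    show "\<exists>y\<in>carrier G. y \<otimes>\<^bsub>G\<^esub> x = \<one>\<^bsub>G\<^esub>"
      by (rule bexI [of _ "- x"]) (simp_all add: G_def)
  qed (auto simp: G_def algebra_simps)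
  have pow: "x [^]\<^bsub>G\<lparr>carrier := H\<rparr>\<^esub> (k::nat) = of_nat k * x" for x k H
    by (induction k) (simp_all add: nat_pow_def G_def algebra_simps)
  have q0: "?q > 1" using finite_UNIV_card_ge_0 card_mono [of UNIV "{0::'q, 1}"] by force
  have "prime_factors ?q \<subseteq> {?p}"
  proof
    fix r assume r: "r \<in> prime_factors ?q"
    then have rp: "prime r" "r dvd ?q" by auto
    define a where "a = multiplicity r ?q"
    have a: "a > 0" unfolding a_def using rp q0
      by (metis gr0I not_less_zero prime_multiplicity_gt_zero_iff
          prime_prime_factors r zero_less_one less_trans prime_factors_multiplicity mem_Collect_eq)
    obtain m where "?q = r ^ a * m" unfolding a_def using multiplicity_dvd by (metis dvdE)
    then have "\<exists>H. subgroup H G \<and> card H = r ^ a"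
      using rp G by (intro sylow_thm [of r G a m]) (auto simp: G_def order_def)
    then obtain H where H: "subgroup H G" "card H = r ^ a" by blast
    have "card H > 1" using H(2) rp a by (metis One_nat_def one_less_power prime_gt_1_nat)
    then have "\<not> H \<subseteq> {0}" using card_mono [of "{0::'q}" H] by auto
    then obtain x where x: "x \<in> H" "x \<noteq> 0" by blast
    interpret K: group "G\<lparr>carrier := H\<rparr>" using H(1) G group.subgroup_imp_group by blast
    have "x [^]\<^bsub>G\<lparr>carrier := H\<rparr>\<^esub> order (G\<lparr>carrier := H\<rparr>) = \<one>\<^bsub>G\<^esub>"
      using K.pow_order_eq_1 x by simp
    then have "of_nat (r ^ a) * x = 0"
      by (simp add: pow H order_def) (simp add: G_def)
    then have "?p dvd r ^ a" using x by (metis mult_eq_0_iff of_nat_eq_0_iff_char_dvd)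
    then show "r \<in> {?p}" using rp
      by (metis CHAR_prime prime_dvd_power primes_dvd_imp_eq singletonI)
  qed
  moreover obtain r where "prime r" "r dvd ?q" using prime_factor_nat [of ?q] q0 by auto
  then have "r \<in> prime_factors ?q" using q0 by (intro prime_factorsI) auto
  ultimately have "prime_factors ?q = {?p}" by blast
  then have "?q = ?p ^ multiplicity ?p ?q"
    using q0 prime_factorization_nat [of ?q] by simp
  with q0 show thesis
    by (intro that [of "multiplicity ?p ?q"]) (auto intro!: gr0I)
qed

lemma frob_funpow_eq_id:
  assumes "CARD('q::finite_field) = CHAR('q) ^ f"
  shows "(frob ^^ (f * t) :: 'q \<Rightarrow> 'q) = id"
  by (simp add: fun_eq_iff frob_funpow power_mult flip: assms)
    (simp add: finite_field_power_card_power_eq_same)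

lemma one_neq_minus_one:
  assumes "CHAR('q::finite_field) \<noteq> 2"
  shows "(1 :: 'q) \<noteq> - 1"
proof
  assume "(1 :: 'q) = - 1"
  then have "of_nat 2 = (0 :: 'q)" by (metis add.right_inverse of_nat_numeral one_add_one)
  then have "CHAR('q) dvd 2" by (simp only: of_nat_eq_0_iff_char_dvd)
  then show False using assms CHAR_prime primes_dvd_imp_eq two_is_prime_nat by blast
qed

section \<open>Semilinear maps and the action on points\<close>

definition aut_vec :: "('q \<Rightarrow> 'q) \<Rightarrow> 'q ^ 'n \<Rightarrow> 'q::finite_field ^ 'n" where
  "aut_vec \<sigma> v = (\<chi> i. \<sigma> (v $ i))"

lemma aut_vec_nth [simp]: "aut_vec \<sigma> v $ i = \<sigma> (v $ i)"
  by (simp add: aut_vec_def)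

lemma aut_vec_id [simp]: "aut_vec id v = v"
  by (simp add: vec_eq_iff)

lemma semilinear_map_eq: "semilinear_map (A, \<sigma>) v = A *v aut_vec \<sigma> v"
  by (simp add: semilinear_map_def aut_vec_def)

lemma aut_vec_comp [simp]: "aut_vec (\<sigma> \<circ> \<tau>) v = aut_vec \<sigma> (aut_vec \<tau> v)"
  by (simp add: vec_eq_iff)

context
  fixes \<sigma> :: "'q::finite_field \<Rightarrow> 'q"
  assumes \<sigma>: "\<sigma> \<in> frob_powers"
begin

lemma aut_vec_scale [simp]: "aut_vec \<sigma> (c *s v) = \<sigma> c *s aut_vec \<sigma> v"
  using \<sigma> by (simp add: vec_eq_iff)

lemma aut_vec_add [simp]: "aut_vec \<sigma> (v + w) = aut_vec \<sigma> v + aut_vec \<sigma> w"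
  using \<sigma> by (simp add: vec_eq_iff)

lemma aut_vec_diff [simp]: "aut_vec \<sigma> (v - w) = aut_vec \<sigma> v - aut_vec \<sigma> w"
  using \<sigma> by (simp add: vec_eq_iff)

lemma aut_vec_axis [simp]: "aut_vec \<sigma> (axis i c) = axis i (\<sigma> c)"
  using \<sigma> by (simp add: vec_eq_iff axis_def)

lemma aut_vec_mult: "aut_vec \<sigma> (A *v v) = map_matrix \<sigma> A *v aut_vec \<sigma> v"
  using \<sigma> by (simp add: vec_eq_iff matrix_vector_mult_def)

lemma semilinear_map_scale: "semilinear_map (A, \<sigma>) (c *s v) = \<sigma> c *s semilinear_map (A, \<sigma>) v"
  using \<sigma> by (simp add: semilinear_map_eq vec.scale vector_scalar_commute)

lemma semilinear_map_mult:
  "semilinear_map (A ** map_matrix \<sigma> B, \<sigma> \<circ> \<tau>) v = semilinear_map (A, \<sigma>) (semilinear_map (B, \<tau>) v)"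
  by (simp add: semilinear_map_eq aut_vec_mult matrix_vector_mul_assoc)

end

lemma mat_mult_vec [simp]: "mat c *v v = c *s (v :: 'q::comm_semiring_1 ^ 'n)"
  by (simp add: vec_eq_iff matrix_vector_mult_def mat_def if_distrib if_distribR cong: if_cong)

lemma mat_mult_nth: "(mat c ** A) $ i $ j = (c :: 'q::comm_semiring_1) * A $ i $ j"
  by (simp add: matrix_matrix_mult_def mat_def if_distrib if_distribR cong: if_cong)

lemma mult_mat_nth: "(A ** mat c) $ i $ j = (c :: 'q::comm_semiring_1) * A $ i $ j"
  by (simp add: matrix_matrix_mult_def mat_def if_distrib if_distribR mult.commute cong: if_cong)

lemma mat_mult_commute: "mat (c :: 'q::comm_semiring_1) ** A = A ** mat c"
  by (simp only: vec_eq_iff mat_mult_nth mult_mat_nth) simp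

lemma det_mat: "det (mat c :: 'q::comm_ring_1 ^ 'n ^ 'n) = c ^ CARD('n)"
  by (subst det_diagonal) (simp_all add: mat_def)

lemma invertible_mult_vec_eq_0_iff:
  "invertible A \<Longrightarrow> A *v v = 0 \<longleftrightarrow> v = (0 :: 'q::field ^ 'n)"
  using matrix_left_invertible_ker [of A] by (force simp: invertible_def)

lemma semilinear_map_eq_0_iff:
  "invertible A \<Longrightarrow> \<sigma> \<in> frob_powers \<Longrightarrow> semilinear_map (A, \<sigma>) v = 0 \<longleftrightarrow> v = 0"
  by (simp add: semilinear_map_eq invertible_mult_vec_eq_0_iff) (simp add: vec_eq_iff)

text \<open>Frobenius has order dividing f, so the inverse of \<open>frob ^^ k\<close> is again a
  nonnegative power, with exponent f k - k.\<close>

lemma frob_powers_inverse: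
  assumes "\<sigma> \<in> (frob_powers :: ('q::finite_field \<Rightarrow> 'q) set)"
  obtains \<tau> where "\<tau> \<in> frob_powers" "\<tau> \<circ> \<sigma> = id" "\<sigma> \<circ> \<tau> = id"
proof -
  obtain f where f: "CARD('q) = CHAR('q) ^ f" "f > 0" by (rule card_finite_field)
  obtain k where k: "\<sigma> = frob ^^ k" using assms by (rule frob_powersE)
  have *: "(frob ^^ (f * k) :: 'q \<Rightarrow> 'q) = id" using f(1) by (rule frob_funpow_eq_id)
  have "k \<le> f * k" using f(2) by simp
  then show thesis
    by (intro that [of "frob ^^ (f * k - k)"]) (simp_all add: k * flip: funpow_add)
qed

lemma map_matrix_id [simp]: "map_matrix id A = A"
  by (simp add: vec_eq_iff)

lemma group_GammaL: "group (GammaL :: (('q::finite_field ^ 'n ^ 'n) \<times> ('q \<Rightarrow> 'q)) monoid)"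
proof (rule groupI)
  fix g h k :: "('q ^ 'n ^ 'n) \<times> ('q \<Rightarrow> 'q)"
  assume g: "g \<in> carrier GammaL" and h: "h \<in> carrier GammaL" and k: "k \<in> carrier GammaL"
  show "g \<otimes>\<^bsub>GammaL\<^esub> h \<in> carrier GammaL"
    using g h by (auto simp: GammaL_def GL_def frob_powers_comp invertible_mult invertible_map_matrix)
  show "g \<otimes>\<^bsub>GammaL\<^esub> h \<otimes>\<^bsub>GammaL\<^esub> k = g \<otimes>\<^bsub>GammaL\<^esub> (h \<otimes>\<^bsub>GammaL\<^esub> k)"
  proof -
    have "map_matrix (\<sigma> \<circ> \<tau>) A = map_matrix \<sigma> (map_matrix \<tau> A)"
      for \<sigma> \<tau> :: "'q \<Rightarrow> 'q" and A :: "'q ^ 'n ^ 'n" by (simp add: vec_eq_iff)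
    then show ?thesis
      using g h k by (auto simp: GammaL_def map_matrix_mult matrix_mul_assoc)
  qed
next
  show "\<one>\<^bsub>GammaL\<^esub> \<in> carrier (GammaL :: (('q::finite_field ^ 'n ^ 'n) \<times> ('q \<Rightarrow> 'q)) monoid)"
    by (auto simp: GammaL_def GL_def invertible_def)
next
  fix g :: "('q ^ 'n ^ 'n) \<times> ('q \<Rightarrow> 'q)" assume g: "g \<in> carrier GammaL"
  then show "\<one>\<^bsub>GammaL\<^esub> \<otimes>\<^bsub>GammaL\<^esub> g = g" by (auto simp: GammaL_def vec_eq_iff)
  obtain A \<sigma> where A: "g = (A, \<sigma>)" "invertible A" "\<sigma> \<in> frob_powers"
    using g by (auto simp: GammaL_def GL_def)
  obtain \<tau> where \<tau>: "\<tau> \<in> frob_powers" "\<tau> \<circ> \<sigma> = id" using frob_powers_inverse A(3) by blast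
  obtain B where B: "invertible B" "B ** map_matrix \<tau> A = mat 1"
    using invertible_map_matrix [OF \<tau>(1) A(2)] unfolding invertible_def by metis
  show "\<exists>h\<in>carrier GammaL. h \<otimes>\<^bsub>GammaL\<^esub> g = \<one>\<^bsub>GammaL\<^esub>"
    using A B \<tau> by (intro bexI [of _ "(B, \<tau>)"]) (auto simp: GammaL_def GL_def)
qed

lemma scalars_normal: "(scalars :: (('q::finite_field ^ 'n ^ 'n) \<times> ('q \<Rightarrow> 'q)) set) \<lhd> GammaL"
proof -
  interpret group "GammaL :: (('q ^ 'n ^ 'n) \<times> ('q \<Rightarrow> 'q)) monoid" by (rule group_GammaL)
  have inv: "invertible (mat c :: 'q^'n^'n)" if "c \<noteq> 0" for c
    using that by (simp add: invertible_det_nz det_mat)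
  have mult: "(mat c, id) \<otimes>\<^bsub>GammaL\<^esub> (mat d, id) = (mat (c * d) :: 'q^'n^'n, id)" for c d
    by (auto simp: GammaL_def vec_eq_iff mat_mult_nth) (simp add: mat_def)
  have sub: "scalars \<subseteq> carrier (GammaL :: (('q ^ 'n ^ 'n) \<times> ('q \<Rightarrow> 'q)) monoid)"
    using inv by (auto simp: scalars_def GammaL_def GL_def)
  have "subgroup scalars (GammaL :: (('q ^ 'n ^ 'n) \<times> ('q \<Rightarrow> 'q)) monoid)"
  proof
    show "scalars \<subseteq> carrier (GammaL :: (('q ^ 'n ^ 'n) \<times> ('q \<Rightarrow> 'q)) monoid)" by (rule sub)
  next
    fix x y :: "('q ^ 'n ^ 'n) \<times> ('q \<Rightarrow> 'q)" assume "x \<in> scalars" "y \<in> scalars"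
    then show "x \<otimes>\<^bsub>GammaL\<^esub> y \<in> scalars"
      unfolding scalars_def using mult by fastforce
  next
    show "\<one>\<^bsub>GammaL\<^esub> \<in> (scalars :: (('q ^ 'n ^ 'n) \<times> ('q \<Rightarrow> 'q)) set)"
      by (auto simp: GammaL_def scalars_def intro!: exI [of _ 1])
  next
    fix x :: "('q ^ 'n ^ 'n) \<times> ('q \<Rightarrow> 'q)" assume x: "x \<in> scalars"
    then obtain c where c: "c \<noteq> 0" "x = (mat c, id)" by (auto simp: scalars_def)
    then have "(mat (1 / c), id) \<otimes>\<^bsub>GammaL\<^esub> x = \<one>\<^bsub>GammaL\<^esub>"
      using c(1) by (simp only: c(2) mult) (simp add: GammaL_def)
    moreover have "(mat (1 / c), id) \<in> (scalars :: (('q ^ 'n ^ 'n) \<times> ('q \<Rightarrow> 'q)) set)"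
      using c by (auto simp: scalars_def)
    ultimately show "inv\<^bsub>GammaL\<^esub> x \<in> scalars"
      using inv_equality [of "(mat (1 / c), id)" x] x subsetD [OF sub] by simp
  qed
  moreover have "g \<otimes>\<^bsub>GammaL\<^esub> s \<otimes>\<^bsub>GammaL\<^esub> inv\<^bsub>GammaL\<^esub> g \<in> scalars"
    if g: "g \<in> carrier GammaL" and s: "s \<in> scalars" for g s :: "('q ^ 'n ^ 'n) \<times> ('q \<Rightarrow> 'q)"
  proof -
    obtain c where c: "c \<noteq> 0" "s = (mat c, id)" using s by (auto simp: scalars_def)
    obtain A \<sigma> where A: "g = (A, \<sigma>)" "invertible A" "\<sigma> \<in> frob_powers"
      using g by (auto simp: GammaL_def GL_def)
    have s': "(mat (\<sigma> c), id) \<in> (scalars :: (('q ^ 'n ^ 'n) \<times> ('q \<Rightarrow> 'q)) set)"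
      using A c by (auto simp: scalars_def)
    \<comment> \<open>Moving a scalar c past \<open>(A, \<sigma>)\<close> turns it into \<sigma> c;
      scalars are normal without being central.\<close>
    have "g \<otimes>\<^bsub>GammaL\<^esub> s = (mat (\<sigma> c), id) \<otimes>\<^bsub>GammaL\<^esub> g"
      using A c mat_mult_commute [of "\<sigma> c" A] by (simp add: GammaL_def map_matrix_id)
    then have "g \<otimes>\<^bsub>GammaL\<^esub> s \<otimes>\<^bsub>GammaL\<^esub> inv\<^bsub>GammaL\<^esub> g = (mat (\<sigma> c), id)"
      using g subsetD [OF sub s'] m_assoc [of "(mat (\<sigma> c), id)" g "inv\<^bsub>GammaL\<^esub> g"] by simp
    then show ?thesis using s' by simp
  qed
  ultimately show ?thesis by (auto simp: normal_inv_iff)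
qed

lemma scalars_coset_eq:
  "scalars #>\<^bsub>GammaL\<^esub> (A, \<sigma>) = {(mat c ** A, \<sigma>) | c. c \<noteq> 0}"
proof -
  have "scalars #>\<^bsub>GammaL\<^esub> (A, \<sigma>) = (\<lambda>g. g \<otimes>\<^bsub>GammaL\<^esub> (A, \<sigma>)) ` (\<lambda>c. (mat c, id)) ` {c. c \<noteq> 0}"
    by (auto simp: r_coset_def scalars_def)
  then show ?thesis by (simp only: image_image) (auto simp: GammaL_def)
qed

text \<open>Equality of projective points, read on representing vectors; the factor \<open>c\<close>
  absorbs the choice of representatives.\<close>

definition sends ::
    "('q::finite_field ^ 'n ^ 'n) \<times> ('q \<Rightarrow> 'q) \<Rightarrow> 'q ^ 'n \<Rightarrow> 'q ^ 'n \<Rightarrow> bool" where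
  "sends g x y \<longleftrightarrow> (\<exists>c. c \<noteq> 0 \<and> semilinear_map g x = c *s y)"

lemma span_singleton_eq_iff:
  assumes "x \<noteq> 0" "y \<noteq> (0 :: 'q::field ^ 'n)"
  shows "vec.span {x} = vec.span {y} \<longleftrightarrow> (\<exists>c. c \<noteq> 0 \<and> x = c *s y)"
proof
  assume "vec.span {x} = vec.span {y}"
  then have "x \<in> vec.span {y}" using vec.span_base [of x "{x}"] by simp
  then obtain c where "x = c *s y" by (auto simp: vec.span_singleton)
  then show "\<exists>c. c \<noteq> 0 \<and> x = c *s y" using assms by (intro exI [of _ c]) auto
next
  assume "\<exists>c. c \<noteq> 0 \<and> x = c *s y"
  then obtain c where c: "c \<noteq> 0" "x = c *s y" by blast
  have "k *s y = (k / c) *s x" "k *s x = (k * c) *s y" for k using c by simp_all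
  then show "vec.span {x} = vec.span {y}"
    unfolding vec.span_singleton by blast
qed

lemma points_eq: "points = {vec.span {x} | x :: 'q::finite_field ^ 'n. x \<noteq> 0}"
proof (intro equalityI subsetI)
  fix L :: "('q ^ 'n) set" assume "L \<in> points"
  then have L: "vec.subspace L" "vec.dim L = 1" by (auto simp: points_def)
  obtain B where B: "B \<subseteq> L" "vec.independent B" "L \<subseteq> vec.span B" "card B = 1"
    using vec.basis_exists [of L] L by metis
  obtain x where x: "B = {x}" using B by (auto simp: card_1_singleton_iff)
  have "L = vec.span {x}" using B L x by (metis vec.span_minimal subset_antisym)
  moreover have "x \<noteq> 0" using B x vec.dependent_zero by blast
  ultimately show "L \<in> {vec.span {x} | x. x \<noteq> 0}" by blast
next
  fix L :: "('q ^ 'n) set" assume "L \<in> {vec.span {x} | x. x \<noteq> 0}"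
  then show "L \<in> points" by (auto simp: points_def)
qed

lemma proj_act_coset:
  assumes "invertible A" "\<sigma> \<in> frob_powers"
  shows "proj_act (scalars #>\<^bsub>GammaL\<^esub> (A, \<sigma>)) (vec.span {x}) = vec.span {semilinear_map (A, \<sigma>) x}"
proof -
  have 1: "semilinear_map (mat c ** A, \<sigma>) (k *s x) = (c * \<sigma> k) *s semilinear_map (A, \<sigma>) x" for c k
    using assms(2)
    by (simp add: semilinear_map_eq matrix_vector_mul_assoc [symmetric] vector_scalar_commute [symmetric])
  \<comment> \<open>Surjectivity of \<sigma> makes the image of a line the full line and not just a
    subset of it.\<close>
  obtain \<tau> where \<tau>: "\<sigma> \<circ> \<tau> = id" using frob_powers_inverse [OF assms(2)] by blast
  show ?thesis
  proof (intro equalityI subsetI)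
    fix y assume "y \<in> proj_act (scalars #>\<^bsub>GammaL\<^esub> (A, \<sigma>)) (vec.span {x})"
    then show "y \<in> vec.span {semilinear_map (A, \<sigma>) x}"
      using 1 by (auto simp: proj_act_def scalars_coset_eq vec.span_singleton)
  next
    fix y assume "y \<in> vec.span {semilinear_map (A, \<sigma>) x}"
    then obtain k where k: "y = k *s semilinear_map (A, \<sigma>) x" by (auto simp: vec.span_singleton)
    have "\<sigma> (\<tau> k) = k" using \<tau> by (simp add: fun_eq_iff)
    then have "y = semilinear_map (mat 1 ** A, \<sigma>) (\<tau> k *s x)" using 1 [of 1 "\<tau> k"] k by simp
    then show "y \<in> proj_act (scalars #>\<^bsub>GammaL\<^esub> (A, \<sigma>)) (vec.span {x})"
      unfolding proj_act_def scalars_coset_eq vec.span_singleton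
      by (intro UN_I [of "(mat 1 ** A, \<sigma>)"] CollectI exI [of _ 1] conjI image_eqI [of _ _ "\<tau> k *s x"] rangeI) auto
  qed
qed

lemma proj_act_eq_iff_sends:
  assumes "g \<in> carrier GammaL" "x \<noteq> 0" "y \<noteq> 0"
  shows "proj_act (scalars #>\<^bsub>GammaL\<^esub> g) (vec.span {x}) = vec.span {y} \<longleftrightarrow> sends g x y"
proof -
  obtain A \<sigma> where g: "g = (A, \<sigma>)" "invertible A" "\<sigma> \<in> frob_powers"
    using assms(1) by (auto simp: GammaL_def GL_def)
  then show ?thesis using assms
    by (simp add: proj_act_coset sends_def span_singleton_eq_iff semilinear_map_eq_0_iff)
qed

text \<open>The preimage of \<open>H\<close> modulo scalars, so that statements about cosets become
  statements about matrices.\<close>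

definition reps ::
    "(('q::finite_field ^ 'n ^ 'n) \<times> ('q \<Rightarrow> 'q)) set set \<Rightarrow> (('q ^ 'n ^ 'n) \<times> ('q \<Rightarrow> 'q)) set" where
  "reps H = {g \<in> carrier GammaL. scalars #>\<^bsub>GammaL\<^esub> g \<in> H}"

definition determines_orbits ::
    "(('q::finite_field ^ 'n ^ 'n) \<times> ('q \<Rightarrow> 'q)) set \<Rightarrow> nat \<Rightarrow> bool" where
  "determines_orbits R r \<longleftrightarrow> (\<forall>k\<ge>r. \<forall>x y.
     (\<forall>i<k. x i \<noteq> 0 \<and> y i \<noteq> 0) \<and>
     (\<forall>I\<subseteq>{..<k}. card I = r \<longrightarrow> (\<exists>g\<in>R. \<forall>i\<in>I. sends g (x i) (y i))) \<longrightarrow>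
     (\<exists>g\<in>R. \<forall>i<k. sends g (x i) (y i)))"

text \<open>Choosing a spanning vector for every point and a representative for every coset shows
  that the two conditions agree for each \<open>r\<close> separately, hence so do the least such
  \<open>r\<close>.\<close>

lemma rel_complexity_eq:
  fixes H :: "(('q::finite_field ^ 'n ^ 'n) \<times> ('q \<Rightarrow> 'q)) set set"
  assumes "H \<subseteq> carrier PGammaL"
  shows "rel_complexity H proj_act points = (LEAST r. r \<ge> 1 \<and> determines_orbits (reps H) r)"
proof -
  have ex: "(\<exists>h\<in>H. \<forall>i\<in>I. proj_act h (vec.span {x i}) = vec.span {y i}) \<longleftrightarrow>
      (\<exists>g\<in>reps H. \<forall>i\<in>I. sends g (x i) (y i))" (is "?L \<longleftrightarrow> ?R")
    if "\<And>i. i \<in> I \<Longrightarrow> x i \<noteq> 0 \<and> y i \<noteq> 0" for I :: "nat set" and x y :: "nat \<Rightarrow> 'q ^ 'n"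
  proof
    assume ?L
    then obtain h where h: "h \<in> H" "\<forall>i\<in>I. proj_act h (vec.span {x i}) = vec.span {y i}" by blast
    then obtain g where g: "g \<in> carrier GammaL" "h = scalars #>\<^bsub>GammaL\<^esub> g"
      using assms by (auto simp: PGammaL_def carrier_FactGroup)
    then show ?R using h that
      by (intro bexI [of _ g]) (auto simp: reps_def proj_act_eq_iff_sends)
  next
    assume ?R
    then obtain g where "g \<in> reps H" "\<forall>i\<in>I. sends g (x i) (y i)" by blast
    then show ?L using that
      by (intro bexI [of _ "scalars #>\<^bsub>GammaL\<^esub> g"]) (auto simp: reps_def proj_act_eq_iff_sends)
  qed
  have eq: "(\<forall>k\<ge>r. \<forall>X Y. length X = k \<and> length Y = k \<and> set X \<subseteq> points \<and> set Y \<subseteq> points \<and>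
           r_equivalent H proj_act r X Y \<longrightarrow> (\<exists>h\<in>H. Y = map (proj_act h) X)) \<longleftrightarrow>
        determines_orbits (reps H) r" (is "?L \<longleftrightarrow> ?R") for r
  proof
    assume L: ?L
    show ?R unfolding determines_orbits_def
    proof (intro allI impI, elim conjE)
      fix k and x y :: "nat \<Rightarrow> 'q ^ 'n"
      assume k: "k \<ge> r" and nz: "\<forall>i<k. x i \<noteq> 0 \<and> y i \<noteq> 0"
        and eq: "\<forall>I\<subseteq>{..<k}. card I = r \<longrightarrow> (\<exists>g\<in>reps H. \<forall>i\<in>I. sends g (x i) (y i))"
      define X where "X = map (\<lambda>i. vec.span {x i}) [0..<k]"
      define Y where "Y = map (\<lambda>i. vec.span {y i}) [0..<k]"
      have "r_equivalent H proj_act r X Y"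
        unfolding r_equivalent_def
      proof (intro allI impI)
        fix I assume I: "I \<subseteq> {..<length X}" "card I = r"
        then have I': "I \<subseteq> {..<k}" by (simp add: X_def)
        have "\<exists>h\<in>H. \<forall>i\<in>I. proj_act h (vec.span {x i}) = vec.span {y i}"
          using I' I(2) nz eq by (subst ex) auto
        moreover have "X ! i = vec.span {x i} \<and> Y ! i = vec.span {y i}" if "i \<in> I" for i
          using that I' by (auto simp: X_def Y_def)
        ultimately show "\<exists>h\<in>H. \<forall>i\<in>I. proj_act h (X ! i) = Y ! i" by metis
      qed
      moreover have "set X \<subseteq> points" "set Y \<subseteq> points" "length X = k" "length Y = k"
        using nz by (auto simp: X_def Y_def points_eq)
      ultimately obtain h where h: "h \<in> H" "Y = map (proj_act h) X" using L k by blast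
      then have "\<exists>h\<in>H. \<forall>i\<in>{..<k}. proj_act h (vec.span {x i}) = vec.span {y i}"
        by (intro bexI [of _ h]) (auto simp: X_def Y_def)
      then show "\<exists>g\<in>reps H. \<forall>i<k. sends g (x i) (y i)"
        using nz by (subst (asm) ex) auto
    qed
  next
    assume R: ?R
    show ?L
    proof (intro allI impI, elim conjE)
      fix k and X Y :: "('q ^ 'n) set list"
      assume k: "k \<ge> r" "length X = k" "length Y = k" and XY: "set X \<subseteq> points" "set Y \<subseteq> points"
        and eq: "r_equivalent H proj_act r X Y"
      have "\<forall>i\<in>{..<k}. \<exists>x. x \<noteq> 0 \<and> X ! i = vec.span {x}" "\<forall>i\<in>{..<k}. \<exists>y. y \<noteq> 0 \<and> Y ! i = vec.span {y}"
        using XY k nth_mem [of _ X] nth_mem [of _ Y] unfolding points_eq by fastforce+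
      then obtain x y where x: "\<forall>i\<in>{..<k}. x i \<noteq> 0 \<and> X ! i = vec.span {x i}"
        and y: "\<forall>i\<in>{..<k}. y i \<noteq> 0 \<and> Y ! i = vec.span {y i}" by metis
      have "\<exists>g\<in>reps H. \<forall>i\<in>I. sends g (x i) (y i)" if I: "I \<subseteq> {..<k}" "card I = r" for I
      proof -
        obtain h where "h \<in> H" "\<forall>i\<in>I. proj_act h (X ! i) = Y ! i"
          using eq I k unfolding r_equivalent_def by blast
        then have "\<exists>h\<in>H. \<forall>i\<in>I. proj_act h (vec.span {x i}) = vec.span {y i}"
          using x y I(1) by (metis subsetD)
        then show ?thesis using x y I(1) by (subst (asm) ex) auto
      qed
      then have "\<exists>g\<in>reps H. \<forall>i<k. sends g (x i) (y i)"
        using R k(1) x y unfolding determines_orbits_def by simp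
      then have "\<exists>h\<in>H. \<forall>i\<in>{..<k}. proj_act h (vec.span {x i}) = vec.span {y i}"
        using x y by (subst ex) auto
      then show "\<exists>h\<in>H. Y = map (proj_act h) X"
        using x y k by (auto simp: list_eq_iff_nth_eq intro!: rev_bexI)
    qed
  qed
  show ?thesis unfolding rel_complexity_def eq ..
qed

section \<open>Groups of semilinear maps containing SL and the scalars\<close>

locale semilinear_group =
  fixes R :: "(('q::finite_field ^ 'n ^ 'n) \<times> ('q \<Rightarrow> 'q)) set"
  assumes R_carrier: "(A, \<sigma>) \<in> R \<Longrightarrow> invertible A \<and> \<sigma> \<in> frob_powers"
    and R_mult: "(A, \<sigma>) \<in> R \<Longrightarrow> (B, \<tau>) \<in> R \<Longrightarrow> (A ** map_matrix \<sigma> B, \<sigma> \<circ> \<tau>) \<in> R"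
    and R_inverse: "(A, \<sigma>) \<in> R \<Longrightarrow> \<exists>B \<tau>. (B, \<tau>) \<in> R \<and> B ** map_matrix \<tau> A = mat 1 \<and> \<tau> \<circ> \<sigma> = id"
    and R_SL: "det A = 1 \<Longrightarrow> (A, id) \<in> R"
    and R_scalar: "c \<noteq> 0 \<Longrightarrow> (mat c, id) \<in> R"

lemma mem_scalars_coset: "(A, \<sigma>) \<in> scalars #>\<^bsub>GammaL\<^esub> (A, \<sigma>)"
  unfolding scalars_coset_eq by (intro CollectI exI [of _ 1]) simp

lemma semilinear_group_reps:
  fixes H :: "(('q::finite_field ^ 'n ^ 'n) \<times> ('q \<Rightarrow> 'q)) set set"
  assumes H: "subgroup H PGammaL" and PSL: "PSL \<subseteq> H"
  shows "semilinear_group (reps H)"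
proof -
  interpret G: group "GammaL :: (('q ^ 'n ^ 'n) \<times> ('q \<Rightarrow> 'q)) monoid" by (rule group_GammaL)
  interpret N: normal "scalars :: (('q ^ 'n ^ 'n) \<times> ('q \<Rightarrow> 'q)) set" GammaL by (rule scalars_normal)
  interpret H: subgroup H PGammaL by (rule H)
  have mem_iff: "(A, \<sigma>) \<in> reps H \<longleftrightarrow>
      invertible A \<and> \<sigma> \<in> frob_powers \<and> scalars #>\<^bsub>GammaL\<^esub> (A, \<sigma>) \<in> H"
    for A :: "'q ^ 'n ^ 'n" and \<sigma>
    by (auto simp: reps_def GammaL_def GL_def)
  show ?thesis
  proof
    show "invertible A \<and> \<sigma> \<in> frob_powers" if "(A, \<sigma>) \<in> reps H" for A \<sigma>
      using that by (simp add: mem_iff)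
  next
    fix A \<sigma> B \<tau> assume A: "(A, \<sigma>) \<in> reps H" and B: "(B, \<tau>) \<in> reps H"
    then have "scalars #>\<^bsub>GammaL\<^esub> ((A, \<sigma>) \<otimes>\<^bsub>GammaL\<^esub> (B, \<tau>)) =
        (scalars #>\<^bsub>GammaL\<^esub> (A, \<sigma>)) \<otimes>\<^bsub>PGammaL\<^esub> (scalars #>\<^bsub>GammaL\<^esub> (B, \<tau>))"
      by (simp add: PGammaL_def N.rcos_sum reps_def)
    also have "\<dots> \<in> H" using A B by (simp add: reps_def)
    finally have "(A, \<sigma>) \<otimes>\<^bsub>GammaL\<^esub> (B, \<tau>) \<in> reps H" using A B by (simp add: reps_def)
    then show "(A ** map_matrix \<sigma> B, \<sigma> \<circ> \<tau>) \<in> reps H" by (simp add: GammaL_def)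
  next
    fix A \<sigma> assume A: "(A, \<sigma>) \<in> reps H"
    let ?g = "inv\<^bsub>GammaL\<^esub> (A, \<sigma>)"
    have g: "?g \<in> carrier GammaL" using A by (simp add: reps_def)
    have "scalars #>\<^bsub>GammaL\<^esub> ?g = inv\<^bsub>PGammaL\<^esub> (scalars #>\<^bsub>GammaL\<^esub> (A, \<sigma>))"
      using A unfolding PGammaL_def
      by (subst N.inv_FactGroup) (auto simp: reps_def carrier_FactGroup N.rcos_inv)
    also have "\<dots> \<in> H" using A by (simp add: reps_def)
    finally have "?g \<in> reps H" using g by (simp add: reps_def)
    moreover have "?g \<otimes>\<^bsub>GammaL\<^esub> (A, \<sigma>) = \<one>\<^bsub>GammaL\<^esub>" using A by (simp add: reps_def)
    ultimately show "\<exists>B \<tau>. (B, \<tau>) \<in> reps H \<and> B ** map_matrix \<tau> A = mat 1 \<and> \<tau> \<circ> \<sigma> = id"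
      by (cases ?g) (auto simp: GammaL_def)
  next
    fix A :: "'q ^ 'n ^ 'n" assume "det A = 1"
    then show "(A, id) \<in> reps H" using PSL
      by (auto simp: mem_iff invertible_det_nz PSL_def mod_scalars_def SL_def)
  next
    fix c :: 'q assume c: "c \<noteq> 0"
    then have "(mat c, id) \<in> (scalars :: (('q ^ 'n ^ 'n) \<times> ('q \<Rightarrow> 'q)) set)" by (auto simp: scalars_def)
    then have "scalars #>\<^bsub>GammaL\<^esub> (mat c :: 'q ^ 'n ^ 'n, id) = \<one>\<^bsub>PGammaL\<^esub>"
      using G.coset_join2 [OF subsetD [OF N.subset] N.subgroup_axioms] by (simp add: PGammaL_def)
    then show "(mat c, id) \<in> reps H"
      using c by (simp add: mem_iff invertible_det_nz det_mat)
  qed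
qed

context semilinear_group
begin

lemma R_one: "(mat 1, id) \<in> R"
  by (rule R_scalar) simp

lemma R_nth_power_det:
  assumes "det A = c ^ CARD('n)" "c \<noteq> 0"
  shows "(A, id) \<in> R"
proof -
  have "(mat (1 / c) ** A, id) \<in> R"
    using assms by (intro R_SL) (simp add: det_mul det_mat power_divide)
  then have "(mat c ** map_matrix id (mat (1 / c) ** A), id \<circ> id) \<in> R"
    using R_mult R_scalar assms(2) by blast
  moreover have "mat c ** (mat (1 / c) ** A) = A"
    using assms(2) by (simp add: vec_eq_iff mat_mult_nth)
  ultimately show ?thesis by simp
qed

text \<open>B A^(-1) has determinant c^n, hence is a scalar times an element of SL. This is the test
  by which explicit semilinear maps are placed in \<open>R\<close>.\<close>

lemma R_same_det:
  assumes A: "(A, \<sigma>) \<in> R" and "det B = c ^ CARD('n) * det A" "c \<noteq> 0"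
  shows "(B, \<sigma>) \<in> R"
proof -
  obtain A' where A': "A' ** A = mat 1" using R_carrier [OF A] by (auto simp: invertible_def)
  then have "det A * det A' = 1" by (metis det_mul det_I mult.commute)
  then have "det (B ** A') = c ^ CARD('n)"
    using assms(2) by (simp add: det_mul mult.assoc)
  then have "(B ** A', id) \<in> R" using R_nth_power_det assms(3) by blast
  then have "(B ** A' ** A, \<sigma>) \<in> R" using R_mult [OF _ A] by fastforce
  then show ?thesis using A' by (simp flip: matrix_mul_assoc)
qed

lemma sends_mult:
  assumes "(A, \<sigma>) \<in> R" "sends (A, \<sigma>) y z" "sends (B, \<tau>) x y"
  shows "sends (A ** map_matrix \<sigma> B, \<sigma> \<circ> \<tau>) x z"
proof -
  have \<sigma>: "\<sigma> \<in> frob_powers" using R_carrier assms(1) by blast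
  obtain c d where cd: "c \<noteq> 0" "d \<noteq> 0" "semilinear_map (A, \<sigma>) y = c *s z"
    "semilinear_map (B, \<tau>) x = d *s y" using assms unfolding sends_def by blast
  then show ?thesis unfolding sends_def using \<sigma>
    by (intro exI [of _ "\<sigma> d * c"]) (simp add: semilinear_map_mult semilinear_map_scale)
qed

lemma sends_inverse:
  assumes "(B, \<tau>) \<in> R" "B ** map_matrix \<tau> A = mat 1" "\<tau> \<circ> \<sigma> = id" "sends (A, \<sigma>) x y"
  shows "sends (B, \<tau>) y x"
proof -
  have \<tau>: "\<tau> \<in> frob_powers" using R_carrier assms(1) by blast
  obtain c where c: "c \<noteq> 0" "semilinear_map (A, \<sigma>) x = c *s y"
    using assms unfolding sends_def by blast
  have "semilinear_map (B, \<tau>) (c *s y) = x"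
    using semilinear_map_mult [OF \<tau>, of B A \<sigma> x] assms c by (simp add: semilinear_map_eq)
  then have "\<tau> c *s semilinear_map (B, \<tau>) y = x" by (simp add: semilinear_map_scale \<tau>)
  then have "semilinear_map (B, \<tau>) y = (1 / \<tau> c) *s x" using c(1) \<tau> by (auto simp: vec.scale_scale)
  then show ?thesis unfolding sends_def using c(1) \<tau> by (intro exI [of _ "1 / \<tau> c"]) simp
qed

text \<open>\<open>k\<close> is \<open>g\<close> followed by the inverse of \<open>h\<close>. It
  turns the question whether two elements move points in the same way into one about fixed
  points.\<close>

lemma sends_quotient:
  assumes "g \<in> R" "h \<in> R"
  obtains k where "k \<in> R"
    "\<And>x y. sends g x y \<Longrightarrow> sends h x y \<Longrightarrow> sends k x x"
    "\<And>x y. sends k x x \<Longrightarrow> sends h x y \<Longrightarrow> sends g x y"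
proof -
  obtain A \<sigma> B \<tau> where g: "g = (A, \<sigma>)" and h: "h = (B, \<tau>)" by (metis surj_pair)
  obtain B' \<tau>' where B': "(B', \<tau>') \<in> R" "B' ** map_matrix \<tau>' B = mat 1" "\<tau>' \<circ> \<tau> = id"
    using R_inverse assms h by blast
  obtain B'' \<tau>'' where B'': "(B'', \<tau>'') \<in> R" "B'' ** map_matrix \<tau>'' B' = mat 1" "\<tau>'' \<circ> \<tau>' = id"
    using R_inverse B'(1) by blast
  have \<tau>': "\<tau>' \<in> frob_powers" "\<tau>'' \<in> frob_powers" using R_carrier B' B'' by blast+
  have 1: "semilinear_map (B'', \<tau>'') (semilinear_map (B', \<tau>') v) = v" for v
    using semilinear_map_mult [OF \<tau>'(2), of B'' B' \<tau>' v] B'' by (simp add: semilinear_map_eq)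
  have 2: "semilinear_map (B', \<tau>') (semilinear_map (B, \<tau>) v) = v" for v
    using semilinear_map_mult [OF \<tau>'(1), of B' B \<tau> v] B' by (simp add: semilinear_map_eq)
  have h_eq: "semilinear_map (B'', \<tau>'') v = semilinear_map (B, \<tau>) v" for v
    using 1 [of "semilinear_map (B, \<tau>) v"] by (simp add: 2)
  let ?k = "(B' ** map_matrix \<tau>' A, \<tau>' \<circ> \<sigma>)"
  show thesis
  proof
    show "?k \<in> R" using R_mult [OF B'(1)] assms(1) g by simp
    show "sends ?k x x" if "sends g x y" "sends h x y" for x y
      using that sends_mult [OF B'(1) sends_inverse [OF B', of x y]] g h by blast
    show "sends g x y" if k: "sends ?k x x" and h': "sends h x y" for x y
    proof -
      obtain c where c: "c \<noteq> 0" "semilinear_map ?k x = c *s x" using k unfolding sends_def by blast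
      obtain d where d: "d \<noteq> 0" "semilinear_map h x = d *s y" using h' unfolding sends_def by blast
      have "semilinear_map g x = semilinear_map (B'', \<tau>'') (semilinear_map ?k x)"
        by (simp only: semilinear_map_mult [OF \<tau>'(1)] 1 g)
      also have "\<dots> = (\<tau>'' c * d) *s y"
        unfolding c(2) semilinear_map_scale [OF \<tau>'(2)] h_eq using d h by simp
      finally show ?thesis using c d \<tau>' unfolding sends_def by (intro exI [of _ "\<tau>'' c * d"]) simp
    qed
  qed
qed

text \<open>Multiplying by the inverse of the second element cancels the common automorphism.
  Stabiliser questions thereby reduce to linear maps.\<close>

lemma linear_quotient:
  assumes A: "(A, \<sigma>) \<in> R" and B: "(B, \<sigma>) \<in> R"
  obtains C where "(C, id) \<in> R" "C ** B = A"
proof -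
  obtain B' \<tau> where B': "(B', \<tau>) \<in> R" "B' ** map_matrix \<tau> B = mat 1" "\<tau> \<circ> \<sigma> = id"
    using R_inverse B by blast
  have \<sigma>: "\<sigma> \<in> frob_powers" "\<tau> \<in> frob_powers" using R_carrier B B' by blast+
  have \<sigma>\<tau>: "\<sigma> \<circ> \<tau> = id"
    using B'(3) \<sigma> by (metis frob_powers_inverse comp_assoc comp_id id_comp)
  have "map_matrix \<sigma> (map_matrix \<tau> B) = B" using \<sigma>\<tau> by (simp add: vec_eq_iff fun_eq_iff)
  then have "map_matrix \<sigma> B' ** B = mat 1"
    using arg_cong [OF B'(2), of "map_matrix \<sigma>"] \<sigma> by (simp add: map_matrix_mult)
  then have "A ** map_matrix \<sigma> B' ** B = A" by (simp flip: matrix_mul_assoc)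
  moreover have "(A ** map_matrix \<sigma> B', id) \<in> R" using R_mult [OF A B'(1)] \<sigma>\<tau> by simp
  ultimately show thesis using that by blast
qed

end

text \<open>By \<open>linear_quotient\<close>, a coset of \<open>H \<inter> PGL\<close> consists of
  all elements of \<open>H\<close> with a given field automorphism, so counting cosets means
  counting automorphisms.\<close>

lemma index_in_eq_card:
  fixes H :: "(('q::finite_field ^ 'n ^ 'n) \<times> ('q \<Rightarrow> 'q)) set set"
  assumes H: "subgroup H PGammaL" and PSL: "PSL \<subseteq> H"
  shows "index_in PGammaL H (H \<inter> PGL) = card (snd ` reps H)"
proof -
  interpret G: group "GammaL :: (('q ^ 'n ^ 'n) \<times> ('q \<Rightarrow> 'q)) monoid" by (rule group_GammaL)
  interpret N: normal "scalars :: (('q ^ 'n ^ 'n) \<times> ('q \<Rightarrow> 'q)) set" GammaL by (rule scalars_normal)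
  interpret H: subgroup H PGammaL by (rule H)
  interpret semilinear_group "reps H" using H PSL by (rule semilinear_group_reps)
  let ?c = "\<lambda>g :: ('q ^ 'n ^ 'n) \<times> ('q \<Rightarrow> 'q). scalars #>\<^bsub>GammaL\<^esub> g"
  define F where "F \<sigma> = ?c ` {g \<in> reps H. snd g = \<sigma>}" for \<sigma>
  have H_eq: "H = ?c ` reps H"
    using H.subset by (auto simp: reps_def PGammaL_def carrier_FactGroup)
  have carr: "g \<in> carrier GammaL" if "g \<in> reps H" for g using that by (simp add: reps_def)
  have K_eq: "H \<inter> PGL = ?c ` {g \<in> reps H. snd g = id}"
  proof (intro equalityI subsetI)
    fix k assume k: "k \<in> H \<inter> PGL"
    then obtain A where A: "A \<in> GL" "k = ?c (A, id)" by (auto simp: PGL_def mod_scalars_def)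
    then have "(A, id) \<in> reps H" using k by (auto simp: reps_def GammaL_def)
    then show "k \<in> ?c ` {g \<in> reps H. snd g = id}" using A by force
  next
    fix k assume "k \<in> ?c ` {g \<in> reps H. snd g = id}"
    then obtain A where A: "(A, id) \<in> reps H" "k = ?c (A, id)" by auto
    then show "k \<in> H \<inter> PGL"
      using R_carrier [OF A(1)] by (auto simp: reps_def PGL_def mod_scalars_def GL_def)
  qed
  have coset: "(H \<inter> PGL) #>\<^bsub>PGammaL\<^esub> ?c (A, \<sigma>) = F \<sigma>" if g: "(A, \<sigma>) \<in> reps H" for A \<sigma>
  proof -
    have "(H \<inter> PGL) #>\<^bsub>PGammaL\<^esub> ?c (A, \<sigma>) =
        (\<lambda>k. ?c k \<otimes>\<^bsub>PGammaL\<^esub> ?c (A, \<sigma>)) ` {g \<in> reps H. snd g = id}"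
      unfolding K_eq r_coset_def by auto
    also have "\<dots> = (\<lambda>k. ?c (k \<otimes>\<^bsub>GammaL\<^esub> (A, \<sigma>))) ` {g \<in> reps H. snd g = id}"
      using carr g by (intro image_cong) (auto simp: PGammaL_def N.rcos_sum)
    also have "\<dots> = ?c ` (\<lambda>k. k \<otimes>\<^bsub>GammaL\<^esub> (A, \<sigma>)) ` {g \<in> reps H. snd g = id}"
      by (simp only: image_image)
    also have "(\<lambda>k. k \<otimes>\<^bsub>GammaL\<^esub> (A, \<sigma>)) ` {g \<in> reps H. snd g = id} = {g \<in> reps H. snd g = \<sigma>}"
    proof (intro equalityI subsetI)
      fix h assume "h \<in> (\<lambda>k. k \<otimes>\<^bsub>GammaL\<^esub> (A, \<sigma>)) ` {g \<in> reps H. snd g = id}"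
      then obtain B where B: "(B, id) \<in> reps H" "h = (B ** A, \<sigma>)" by (auto simp: GammaL_def)
      then show "h \<in> {g \<in> reps H. snd g = \<sigma>}" using R_mult [OF B(1) g] by simp
    next
      fix h assume "h \<in> {g \<in> reps H. snd g = \<sigma>}"
      then obtain B where B: "(B, \<sigma>) \<in> reps H" "h = (B, \<sigma>)" by (cases h) auto
      then obtain C where "(C, id) \<in> reps H" "C ** A = B" using linear_quotient g by blast
      then show "h \<in> (\<lambda>k. k \<otimes>\<^bsub>GammaL\<^esub> (A, \<sigma>)) ` {g \<in> reps H. snd g = id}"
        using B by (intro image_eqI [of _ _ "(C, id)"]) (auto simp: GammaL_def)
    qed
    finally show ?thesis by (simp add: F_def)
  qed
  have "rcosets\<^bsub>PGammaL\<lparr>carrier := H\<rparr>\<^esub> (H \<inter> PGL) = (\<lambda>h. (H \<inter> PGL) #>\<^bsub>PGammaL\<^esub> h) ` H"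
    by (auto simp: RCOSETS_def)
  also have "\<dots> = (\<lambda>g. (H \<inter> PGL) #>\<^bsub>PGammaL\<^esub> ?c g) ` reps H"
    by (subst (2) H_eq) (simp only: image_image)
  also have "\<dots> = F ` snd ` reps H"
    unfolding image_image by (intro image_cong refl) (auto simp: coset)
  finally have index: "index_in PGammaL H (H \<inter> PGL) = card (F ` snd ` reps H)"
    by (simp add: index_in_def)
  have "inj_on F (snd ` reps H)"
  proof (rule inj_onI)
    fix \<sigma> \<tau> assume "\<sigma> \<in> snd ` reps H" "F \<sigma> = F \<tau>"
    then obtain A where A: "(A, \<sigma>) \<in> reps H" by auto
    then have "?c (A, \<sigma>) \<in> F \<sigma>" unfolding F_def by (intro imageI) simp
    then have "?c (A, \<sigma>) \<in> F \<tau>" by (simp only: \<open>F \<sigma> = F \<tau>\<close>)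
    then obtain B where "?c (A, \<sigma>) = ?c (B, \<tau>)" by (auto simp: F_def)
    then have "(A, \<sigma>) \<in> ?c (B, \<tau>)" using mem_scalars_coset by metis
    then show "\<sigma> = \<tau>" by (auto simp: scalars_coset_eq)
  qed
  then show ?thesis unfolding index by (rule card_image)
qed

section \<open>What the conditions on \<open>H\<close> say about determinants\<close>

lemma reps_if_PGL_subset:
  fixes A :: "'q::finite_field ^ 'n ^ 'n"
  shows "PGL \<subseteq> H \<Longrightarrow> invertible A \<Longrightarrow> (A, id) \<in> reps H"
  by (auto simp: reps_def PGL_def mod_scalars_def GammaL_def GL_def)

lemma det_reps_if_subset_PSigmaL:
  fixes A :: "'q::finite_field ^ 'n ^ 'n"
  assumes "H \<subseteq> PSigmaL" "(A, \<sigma>) \<in> reps H"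
  shows "\<exists>c. c \<noteq> 0 \<and> det A = c ^ CARD('n)"
proof -
  have "scalars #>\<^bsub>GammaL\<^esub> (A, \<sigma>) \<in> PSigmaL" using assms by (auto simp: reps_def)
  then obtain B \<tau> where B: "det B = 1" "scalars #>\<^bsub>GammaL\<^esub> (A, \<sigma>) = scalars #>\<^bsub>GammaL\<^esub> (B, \<tau>)"
    by (auto simp: PSigmaL_def mod_scalars_def SL_def)
  then have "(A, \<sigma>) \<in> scalars #>\<^bsub>GammaL\<^esub> (B, \<tau>)" using mem_scalars_coset by metis
  then obtain c where "c \<noteq> 0" "A = mat c ** B" by (auto simp: scalars_coset_eq)
  then show ?thesis using B by (intro exI [of _ c]) (simp add: det_mul det_mat)
qed

text \<open>Dividing \<open>A\<close> by \<open>c\<close> keeps its coset modulo scalars and makes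
  the determinant 1.\<close>

lemma coset_in_PSigmaL:
  fixes A :: "'q::finite_field ^ 'n ^ 'n"
  assumes "det A = c ^ CARD('n)" "c \<noteq> 0" "\<sigma> \<in> frob_powers"
  shows "scalars #>\<^bsub>GammaL\<^esub> (A, \<sigma>) \<in> PSigmaL"
proof -
  let ?B = "mat (1 / c) ** A"
  have 1: "mat d ** A = mat (d * c) ** ?B" "mat d ** ?B = mat (d / c) ** A" for d
    using assms(2) by (simp_all add: vec_eq_iff mat_mult_nth)
  have "scalars #>\<^bsub>GammaL\<^esub> (A, \<sigma>) = scalars #>\<^bsub>GammaL\<^esub> (?B, \<sigma>)"
  proof (intro equalityI subsetI)
    fix g assume "g \<in> scalars #>\<^bsub>GammaL\<^esub> (A, \<sigma>)"
    then obtain d where "d \<noteq> 0" "g = (mat d ** A, \<sigma>)" unfolding scalars_coset_eq by blast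
    then show "g \<in> scalars #>\<^bsub>GammaL\<^esub> (?B, \<sigma>)" unfolding scalars_coset_eq 1(1) [of d] using assms(2)
      by (intro CollectI exI [of _ "d * c"]) simp
  next
    fix g assume "g \<in> scalars #>\<^bsub>GammaL\<^esub> (?B, \<sigma>)"
    then obtain d where "d \<noteq> 0" "g = (mat d ** ?B, \<sigma>)" unfolding scalars_coset_eq by blast
    then show "g \<in> scalars #>\<^bsub>GammaL\<^esub> (A, \<sigma>)" unfolding scalars_coset_eq 1(2) [of d] using assms(2)
      by (intro CollectI exI [of _ "d / c"]) simp
  qed
  moreover have "det ?B = 1" using assms by (simp add: det_mul det_mat power_divide)
  ultimately show ?thesis using assms(3)
    unfolding PSigmaL_def mod_scalars_def SL_def by blast
qed

lemma nonpower_if_PSigmaL_neq: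
  assumes "PSigmaL \<noteq> carrier (PGammaL :: (('q::finite_field ^ 'n ^ 'n) \<times> ('q \<Rightarrow> 'q)) set monoid)"
  obtains \<mu> :: "'q::finite_field" where "\<mu> \<noteq> 0" "\<forall>c. \<mu> \<noteq> c ^ CARD('n)"
proof -
  have carr: "carrier PGammaL = (\<lambda>g. scalars #>\<^bsub>GammaL\<^esub> g) `
      ({A :: 'q ^ 'n ^ 'n. invertible A} \<times> frob_powers)"
    by (simp add: PGammaL_def carrier_FactGroup) (simp add: GammaL_def GL_def)
  have "PSigmaL \<subseteq> carrier (PGammaL :: (('q ^ 'n ^ 'n) \<times> ('q \<Rightarrow> 'q)) set monoid)"
    unfolding carr PSigmaL_def mod_scalars_def SL_def
    by (intro image_mono) (auto simp: invertible_det_nz)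
  then obtain A :: "'q ^ 'n ^ 'n" and \<sigma> where A: "invertible A" "\<sigma> \<in> frob_powers"
    "scalars #>\<^bsub>GammaL\<^esub> (A, \<sigma>) \<notin> PSigmaL"
    using assms unfolding carr by fastforce
  then have "det A \<noteq> c ^ CARD('n)" if "c \<noteq> 0" for c using coset_in_PSigmaL that by blast
  moreover have "det A \<noteq> 0" using A by (simp add: invertible_det_nz)
  ultimately show thesis using that [of "det A"] by (metis power_0_left zero_less_card_finite less_irrefl)
qed

section \<open>Tuples of points with the same linear stabiliser\<close>

definition eigen :: "'q::field ^ 'n ^ 'n \<Rightarrow> 'q ^ 'n \<Rightarrow> bool" where
  "eigen A v \<longleftrightarrow> (\<exists>c. A *v v = c *s v)"

text \<open>If A is diagonal with entries a in some basis, a vector with coordinates v is an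
  eigenvector exactly when a is constant on the support of v. Collecting these a in a subspace lets
  dimensions count the conditions.\<close>

definition constant_on_support :: "'q::field ^ 'n \<Rightarrow> ('q ^ 'n) set" where
  "constant_on_support v = {a. \<forall>i j. v $ i \<noteq> 0 \<longrightarrow> v $ j \<noteq> 0 \<longrightarrow> a $ i = a $ j}"

lemma subspace_constant_on_support: "vec.subspace (constant_on_support v)"
proof (rule vec.subspaceI)
  fix a b c assume a: "a \<in> constant_on_support v"
  have eq: "a $ i = a $ j" if "a \<in> constant_on_support v" "v $ i \<noteq> 0" "v $ j \<noteq> 0" for a i j
    using that unfolding constant_on_support_def by blast
  have "(c *s a) $ i = (c *s a) $ j" if ij: "v $ i \<noteq> 0" "v $ j \<noteq> 0" for i j
    by (simp add: eq [OF a ij])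
  then show "c *s a \<in> constant_on_support v" unfolding constant_on_support_def by blast
  assume b: "b \<in> constant_on_support v"
  have "(a + b) $ i = (a + b) $ j" if ij: "v $ i \<noteq> 0" "v $ j \<noteq> 0" for i j
    by (simp add: eq [OF a ij] eq [OF b ij])
  then show "a + b \<in> constant_on_support v" unfolding constant_on_support_def by blast
qed (simp add: constant_on_support_def)

text \<open>An element is added only while it still shrinks the intersection, so each addition uses
  up at least one dimension.\<close>

lemma Inter_subspaces_greedy:
  fixes E :: "'b \<Rightarrow> ('q::field ^ 'n) set"
  assumes E: "\<And>t. vec.subspace (E t)" and V: "finite V" "T0 \<subseteq> V"
  shows "\<exists>T. T0 \<subseteq> T \<and> T \<subseteq> V \<and> (\<Inter>t\<in>T. E t) = (\<Inter>t\<in>V. E t) \<and>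
    card T + vec.dim (\<Inter>t\<in>V. E t) \<le> card T0 + vec.dim (\<Inter>t\<in>T0. E t)"
  using V(2)
proof (induction "card V - card T0" arbitrary: T0 rule: less_induct)
  case less
  show ?case
  proof (cases "(\<Inter>t\<in>T0. E t) = (\<Inter>t\<in>V. E t)")
    case True
    then show ?thesis using less.prems by (intro exI [of _ T0]) auto
  next
    case False
    then obtain v where v: "v \<in> V" "\<not> (\<Inter>t\<in>T0. E t) \<subseteq> E v" using less.prems by blast
    then have "v \<notin> T0" by blast
    have fin: "finite T0" using V(1) less.prems finite_subset by blast
    have "card (insert v T0) \<le> card V" using v less.prems V(1) by (intro card_mono) auto
    then have "card V - card (insert v T0) < card V - card T0" using fin \<open>v \<notin> T0\<close> by simp
    then obtain T where T: "insert v T0 \<subseteq> T" "T \<subseteq> V" "(\<Inter>t\<in>T. E t) = (\<Inter>t\<in>V. E t)"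
      "card T + vec.dim (\<Inter>t\<in>V. E t) \<le> card (insert v T0) + vec.dim (\<Inter>t\<in>insert v T0. E t)"
      using less.hyps [of "insert v T0"] less.prems v(1) by auto
    have sub: "vec.subspace (\<Inter>t\<in>T. E t)" for T by (intro vec.subspace_Inter) (use E in auto)
    have "(\<Inter>t\<in>insert v T0. E t) \<subset> (\<Inter>t\<in>T0. E t)" using v by blast
    then have "vec.dim (\<Inter>t\<in>insert v T0. E t) < vec.dim (\<Inter>t\<in>T0. E t)"
      by (intro vec.dim_psubset) (simp only: vec.span_eq_iff [THEN iffD2, OF sub])
    then show ?thesis using T fin \<open>v \<notin> T0\<close> by (intro exI [of _ T]) auto
  qed
qed

text \<open>Three support indices impose two independent equations; the space \<open>?U\<close> of
  one of them lies strictly in between.\<close>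

lemma dim_constant_on_support:
  fixes v :: "'q::field ^ 'n"
  assumes "v $ i \<noteq> 0" "v $ j \<noteq> 0" "v $ k \<noteq> 0" "i \<noteq> j" "i \<noteq> k" "j \<noteq> k"
  shows "vec.dim (constant_on_support v) + 2 \<le> CARD('n)"
proof -
  let ?W = "constant_on_support v" and ?U = "{a :: 'q ^ 'n. a $ i = a $ j}"
  have U: "vec.subspace ?U" by (auto simp: vec.subspace_def)
  have "?W \<subseteq> ?U" using assms by (auto simp: constant_on_support_def)
  moreover have "axis k 1 \<in> ?U" "axis k 1 \<notin> ?W"
    using assms by (auto simp: constant_on_support_def axis_def)
  ultimately have "?W \<subset> ?U" by blast
  then have 1: "vec.dim ?W < vec.dim ?U"
    using U subspace_constant_on_support [of v]
    by (intro vec.dim_psubset) (simp only: vec.span_eq_iff [THEN iffD2])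
  have "axis i 1 \<notin> ?U" using assms by (auto simp: axis_def)
  then have "?U \<subset> UNIV" by blast
  then have "vec.dim ?U < vec.dim (UNIV :: ('q ^ 'n) set)"
    using U by (intro vec.dim_psubset) (simp only: vec.span_eq_iff [THEN iffD2] vec.subspace_UNIV)
  then show ?thesis using 1 by (simp add: card_cart_basis)
qed

lemma matrix_vector_mult_axis: "A *v axis k c = c *s column k (A :: 'q::field ^ 'n ^ 'n)"
proof -
  have "(\<Sum>j\<in>UNIV. A $ i $ j * axis k c $ j) = (\<Sum>j\<in>UNIV. if j = k then A $ i $ k * c else 0)" for i
    by (rule sum.cong) (auto simp: axis_def)
  then show ?thesis by (simp add: vec_eq_iff matrix_vector_mult_def column_def mult.commute)
qed

lemma matrix_vector_mult_sum: "A *v (\<Sum>j\<in>S. f j) = (\<Sum>j\<in>S. (A :: 'q::field ^ 'n ^ 'n) *v f j)"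
  by (induction S rule: infinite_finite_induct) (simp_all add: matrix_vector_right_distrib)

text \<open>Only the basis vectors indexed by \<open>J\<close> are known to be eigenvectors of
  \<open>A\<close>. Since \<open>v\<close> has no coordinates outside \<open>J\<close>,
  \<open>A\<close> acts on it like the diagonal matrix with entries \<open>a\<close>.\<close>

lemma eigen_iff_constant_on_support:
  fixes P Q :: "'q::field ^ 'n ^ 'n"
  assumes PQ: "P ** Q = mat 1" "Q ** P = mat 1"
    and a: "\<And>j. j \<in> J \<Longrightarrow> A *v column j P = a $ j *s column j P"
    and supp: "\<And>j. j \<notin> J \<Longrightarrow> (Q *v v) $ j = 0" and "v \<noteq> 0"
  shows "eigen A v \<longleftrightarrow> a \<in> constant_on_support (Q *v v)"
proof -
  let ?c = "Q *v v"
  have v: "v = P *v ?c" using PQ by (simp add: matrix_vector_mul_assoc)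
  have inj: "inj ((*v) P)"
    using PQ(2) by (intro inj_on_inverseI [of _ "(*v) Q"]) (simp add: matrix_vector_mul_assoc)
  have c0: "?c \<noteq> 0" using v \<open>v \<noteq> 0\<close> by auto
  have "A *v v = A *v (\<Sum>j\<in>UNIV. ?c $ j *s column j P)"
    by (subst (1) v) (simp add: matrix_mult_sum)
  also have "\<dots> = (\<Sum>j\<in>UNIV. ?c $ j *s (A *v column j P))"
    by (simp add: matrix_vector_mult_sum vector_scalar_commute)
  also have "\<dots> = (\<Sum>j\<in>UNIV. (a $ j * ?c $ j) *s column j P)"
  proof (intro sum.cong refl)
    show "?c $ j *s (A *v column j P) = (a $ j * ?c $ j) *s column j P" for j
    proof (cases "j \<in> J")
      case True
      then show ?thesis by (simp add: a [OF True] mult.commute)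
    next
      case False
      then show ?thesis by (simp add: supp [OF False])
    qed
  qed
  also have "\<dots> = P *v (\<chi> j. a $ j * ?c $ j)" by (simp add: matrix_mult_sum)
  finally have Av: "A *v v = P *v (\<chi> j. a $ j * ?c $ j)" .
  have "A *v v = k *s v \<longleftrightarrow> (\<forall>j. a $ j * ?c $ j = k * ?c $ j)" for k
  proof -
    have "P *v (k *s ?c) = k *s v" using v by (simp only: vector_scalar_commute)
    then have "A *v v = k *s v \<longleftrightarrow> P *v (\<chi> j. a $ j * ?c $ j) = P *v (k *s ?c)"
      by (simp only: Av)
    also have "\<dots> \<longleftrightarrow> (\<chi> j. a $ j * ?c $ j) = k *s ?c"
      using inj by (rule inj_eq)
    finally show ?thesis by (simp add: vec_eq_iff)
  qed
  then have "eigen A v \<longleftrightarrow> (\<exists>k. \<forall>j. ?c $ j \<noteq> 0 \<longrightarrow> a $ j = k)"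
    by (auto simp: eigen_def)
  also have "\<dots> \<longleftrightarrow> a \<in> constant_on_support ?c"
    unfolding constant_on_support_def using c0 by (auto simp: vec_eq_iff)
  finally show ?thesis .
qed

text \<open>Fixing the basis points indexed by \<open>J\<close> makes \<open>A\<close> diagonal on
  the span of \<open>V\<close>. Whether an element of \<open>V\<close> is an eigenvector then
  depends on the entries alone, and \<open>T\<close> already imposes every condition on
  them.\<close>

lemma fixing_set_from_basis:
  fixes P Q :: "'q::field ^ 'n ^ 'n" and V :: "('q ^ 'n) set"
  assumes PQ: "P ** Q = mat 1" "Q ** P = mat 1"
    and J: "\<And>j. j \<in> J \<Longrightarrow> column j P \<in> V"
    and supp: "\<And>v j. v \<in> V \<Longrightarrow> j \<notin> J \<Longrightarrow> (Q *v v) $ j = 0" and "0 \<notin> V"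
    and T: "T \<subseteq> V" "finite T"
      "(\<Inter>v\<in>T. constant_on_support (Q *v v)) = (\<Inter>v\<in>V. constant_on_support (Q *v v))"
  shows "\<exists>S\<subseteq>V. card S \<le> card J + card T \<and> (\<forall>A. (\<forall>v\<in>S. eigen A v) \<longrightarrow> (\<forall>v\<in>V. eigen A v))"
proof (intro exI [of _ "(\<lambda>j. column j P) ` J \<union> T"] conjI allI impI ballI)
  show "(\<lambda>j. column j P) ` J \<union> T \<subseteq> V" using J T by blast
  show "card ((\<lambda>j. column j P) ` J \<union> T) \<le> card J + card T"
    using card_Un_le [of "(\<lambda>j. column j P) ` J" T] card_image_le [of J "\<lambda>j. column j P"] by simp
next
  fix A v assume A: "\<forall>v\<in>(\<lambda>j. column j P) ` J \<union> T. eigen A v" and v: "v \<in> V"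
  have "\<exists>c. j \<in> J \<longrightarrow> A *v column j P = c *s column j P" for j using A by (auto simp: eigen_def)
  then obtain c where c: "\<And>j. j \<in> J \<Longrightarrow> A *v column j P = c j *s column j P" by metis
  let ?a = "\<chi> j. c j"
  have iff: "eigen A w \<longleftrightarrow> ?a \<in> constant_on_support (Q *v w)" if "w \<in> V" for w
    using that c supp \<open>0 \<notin> V\<close> by (intro eigen_iff_constant_on_support [OF PQ, of J]) auto
  have "?a \<in> (\<Inter>v\<in>T. constant_on_support (Q *v v))" using A T(1) iff by auto
  then show "eigen A v" using T(3) iff v by auto
qed

text \<open>A maximal independent subset of \<open>V\<close> is extended to a basis, the columns of
  \<open>P\<close>; \<open>Q\<close> reads off coordinates, and \<open>J\<close> marks the vectors
  taken from \<open>V\<close>.\<close>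

lemma exists_adapted_basis:
  fixes V :: "('q::field ^ 'n) set"
  obtains P Q :: "'q ^ 'n ^ 'n" and J where "P ** Q = mat 1" "Q ** P = mat 1"
    "\<And>j. j \<in> J \<Longrightarrow> column j P \<in> V" "\<And>v j. v \<in> V \<Longrightarrow> j \<notin> J \<Longrightarrow> (Q *v v) $ j = 0"
proof -
  obtain B where B: "B \<subseteq> V" "vec.independent B" "V \<subseteq> vec.span B"
    using vec.maximal_independent_subset by blast
  obtain C where C: "B \<subseteq> C" "vec.independent C" "UNIV \<subseteq> vec.span C"
    using vec.maximal_independent_subset_extend [of B UNIV] B by auto
  have "card C = CARD('n)"
    using vec.basis_card_eq_dim [of C UNIV] C by (simp add: card_cart_basis)
  moreover have "finite C" using C vec.finiteI_independent by blast
  ultimately obtain h where h: "bij_betw h (UNIV :: 'n set) C"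
    using finite_same_card_bij [of "UNIV :: 'n set" C] by auto
  define P where "P = (\<chi> i j. h j $ i)"
  have col: "column j P = h j" for j by (simp add: P_def column_def vec_eq_iff)
  have "vec.span (columns P) = UNIV"
  proof -
    have "columns P = C" using h by (auto simp: columns_def col bij_betw_def)
    then show ?thesis using C by auto
  qed
  then obtain Q where PQ: "P ** Q = mat 1" using matrix_right_invertible_span_columns by blast
  then have QP: "Q ** P = mat 1" using matrix_left_right_inverse by blast
  define J where "J = {j. h j \<in> B}"
  show thesis
  proof (rule that [OF PQ QP, of J])
    show "column j P \<in> V" if "j \<in> J" for j using that B by (auto simp: J_def col)
  next
    fix v j assume v: "v \<in> V" and j: "j \<notin> J"
    have "v \<in> vec.span B" using v B by blast
    then have "\<forall>j. j \<notin> J \<longrightarrow> (Q *v v) $ j = 0"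
    proof (induction rule: vec.span_induct_alt)
      case base
      then show ?case by simp
    next
      case (step c x y)
      obtain i where i: "x = h i" using h C step by (auto simp: bij_betw_def)
      have "Q *v x = axis i 1"
        using arg_cong [OF QP, of "column i"] col [of i] i
        by (auto simp: vec_eq_iff column_def matrix_matrix_mult_def matrix_vector_mult_def mat_def axis_def P_def)
      moreover have "i \<in> J" using step i by (simp add: J_def)
      ultimately show ?case using step by (auto simp: matrix_vector_right_distrib vector_scalar_commute axis_def)
    qed
    then show "(Q *v v) $ j = 0" using j by blast
  qed
qed

lemma det_replace_column:
  "det ((\<chi> i j. if j = k then x $ i else mat 1 $ i $ j) :: 'q::field ^ 'n ^ 'n) = x $ k"
  using cramer_lemma [of k "mat 1" x, unfolded matrix_vector_mul_lid det_I] by simp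

lemma replace_column_mult:
  fixes x z :: "'q::field ^ 'n"
  shows "((\<chi> i j. if j = k then x $ i else mat 1 $ i $ j) *v z) $ r =
    (if r = k then 0 else z $ r) + x $ r * z $ k"
proof -
  have "((\<chi> i j. if j = k then x $ i else mat 1 $ i $ j) *v z) $ r =
      (\<Sum>c\<in>UNIV. (if c = k then x $ r * z $ k else 0) +
        (if c = r then (if r = k then 0 else z $ r) else 0))"
    unfolding matrix_vector_mult_def vec_lambda_beta by (rule sum.cong) (auto simp: mat_def)
  then show ?thesis by (simp add: sum.distrib)
qed

text \<open>
  A basis of \<open>n\<close> points needs at most \<open>n - 1\<close> further points, each linking two blocks of the
  partition of the basis into eigenspaces. If every one of them lies on a line through two basis
  points, then exchanging a basis point produces a point with three nonzero coordinates, which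
  links three blocks at once.
\<close>

lemma exists_small_fixing_set:
  fixes V :: "('q::field ^ 'n) set"
  assumes V: "finite V" "0 \<notin> V" and n: "CARD('n) \<ge> 2"
  shows "\<exists>S\<subseteq>V. card S \<le> max (2 * CARD('n) - 2) (CARD('n) + 1) \<and>
    (\<forall>A. (\<forall>v\<in>S. eigen A v) \<longrightarrow> (\<forall>v\<in>V. eigen A v))"
proof -
  let ?n = "CARD('n)"
  let ?C = "\<lambda>(Q :: 'q ^ 'n ^ 'n) v. constant_on_support (Q *v v)"
  let ?one = "(\<chi> i. 1) :: 'q ^ 'n"
  \<comment> \<open>Scalar matrices fix every point, so the intersection never drops below dimension
    1.\<close>
  have one: "?one \<in> (\<Inter>v\<in>V. ?C Q v)" for Q by (auto simp: constant_on_support_def)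
  have one_indep: "vec.independent {?one}" by (auto simp: vec_eq_iff)
  have dim1: "vec.dim (\<Inter>v\<in>V. ?C Q v) \<ge> 1" for Q
    using one one_indep vec.independent_card_le_dim [of "{?one}" "\<Inter>v\<in>V. ?C Q v"] by auto
  have dimU: "vec.dim (UNIV :: ('q ^ 'n) set) = ?n" by (simp add: card_cart_basis)
  have greedy: "\<exists>T. T0 \<subseteq> T \<and> T \<subseteq> V \<and> (\<Inter>v\<in>T. ?C Q v) = (\<Inter>v\<in>V. ?C Q v) \<and>
      card T + vec.dim (\<Inter>v\<in>V. ?C Q v) \<le> card T0 + vec.dim (\<Inter>v\<in>T0. ?C Q v)"
    if "T0 \<subseteq> V" for T0 Q
    using that V(1) subspace_constant_on_support by (intro Inter_subspaces_greedy) auto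
  \<comment> \<open>Starting with \<open>w\<close> loses two dimensions for one point: n basis
    points and at most 1 + (n - 2) - 1 others make 2 n - 2.\<close>
  have large: ?thesis
    if PQ: "P ** Q = mat 1" "Q ** P = mat 1" and P: "\<And>j. column j P \<in> V"
      and w: "w \<in> V" "(Q *v w) $ i \<noteq> 0" "(Q *v w) $ j \<noteq> 0" "(Q *v w) $ k \<noteq> 0"
        "i \<noteq> j" "i \<noteq> k" "j \<noteq> k"
    for P Q :: "'q ^ 'n ^ 'n" and w i j k
  proof -
    obtain T where T: "T \<subseteq> V" "(\<Inter>v\<in>T. ?C Q v) = (\<Inter>v\<in>V. ?C Q v)"
      "card T + vec.dim (\<Inter>v\<in>V. ?C Q v) \<le> 1 + vec.dim (?C Q w)"
      using greedy [of "{w}" Q] w(1) by auto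
    have "card T \<le> ?n - 2" using T(3) dim1 [of Q] dim_constant_on_support [OF w(2-)] by linarith
    then have "?n + card T \<le> max (2 * ?n - 2) (?n + 1)" using n by linarith
    moreover have "\<exists>S\<subseteq>V. card S \<le> ?n + card T \<and> (\<forall>A. (\<forall>v\<in>S. eigen A v) \<longrightarrow> (\<forall>v\<in>V. eigen A v))"
      using P V T finite_subset [OF T(1) V(1)]
      by (intro fixing_set_from_basis [OF PQ, of UNIV V T]) auto
    ultimately show ?thesis by (meson order_trans)
  qed
  obtain P Q :: "'q ^ 'n ^ 'n" and J where PQ: "P ** Q = mat 1" "Q ** P = mat 1"
    and J: "\<And>j. j \<in> J \<Longrightarrow> column j P \<in> V" "\<And>v j. v \<in> V \<Longrightarrow> j \<notin> J \<Longrightarrow> (Q *v v) $ j = 0"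
    using exists_adapted_basis [of V] by metis
  obtain T where T: "T \<subseteq> V" "(\<Inter>v\<in>T. ?C Q v) = (\<Inter>v\<in>V. ?C Q v)"
    "card T + vec.dim (\<Inter>v\<in>V. ?C Q v) \<le> ?n"
    using greedy [of "{}" Q] dimU by auto
  have fin_T: "finite T" using T(1) V(1) finite_subset by blast
  have *: "\<exists>S\<subseteq>V. card S \<le> card J + card T \<and> (\<forall>A. (\<forall>v\<in>S. eigen A v) \<longrightarrow> (\<forall>v\<in>V. eigen A v))"
    by (intro fixing_set_from_basis [OF PQ, of J V T]) (use J V T fin_T in auto)
  \<comment> \<open>The crude count n + (n - 1) is one too large only if n \<ge> 3, the whole basis
    lies in \<open>V\<close> and the final intersection is one-dimensional; a smaller
    \<open>J\<close> or a larger intersection saves the missing one.\<close>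
  consider "card J + card T \<le> max (2 * ?n - 2) (?n + 1)"
    | "J = UNIV" "?n \<ge> 3" "vec.dim (\<Inter>v\<in>V. ?C Q v) \<le> 1"
  proof (cases "card J < ?n \<or> ?n < 3 \<or> vec.dim (\<Inter>v\<in>V. ?C Q v) > 1")
    case True
    have "card J \<le> ?n" by (simp add: card_mono)
    then have "card J + card T \<le> max (2 * ?n - 2) (?n + 1)"
      using True T(3) dim1 [of Q] n by linarith
    then show ?thesis using that by blast
  next
    case False
    then have "J = UNIV" using card_seteq [of UNIV J] by auto
    then show ?thesis using False that by auto
  qed
  then show ?thesis
  proof cases
    case 1
    then show ?thesis using * by (meson order_trans)
  next
    case 2
    have P: "column j P \<in> V" for j using J(1) 2(1) by simp
    have W: "(\<Inter>v\<in>V. ?C Q v) \<subseteq> vec.span {?one}"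
      using 2(3) one one_indep by (intro vec.card_ge_dim_independent) auto
    have W': "a $ i = a $ j" if "a \<in> (\<Inter>v\<in>V. ?C Q v)" for a i j
      using subsetD [OF W that] by (auto simp: vec.span_singleton)
    show ?thesis
    proof (cases "\<exists>v\<in>V. \<exists>i j k. (Q *v v) $ i \<noteq> 0 \<and> (Q *v v) $ j \<noteq> 0 \<and> (Q *v v) $ k \<noteq> 0 \<and>
        i \<noteq> j \<and> i \<noteq> k \<and> j \<noteq> k")
      case True
      then show ?thesis using large [OF PQ P] by blast
    next
      case False
      have "\<exists>i j :: 'n. i \<noteq> j" using n by (metis (full_types) UNIV_eq_I card_1_singleton_iff
            One_nat_def Suc_n_not_le_n numeral_2_eq_2 singletonI)
      then obtain i0 j0 :: 'n where "i0 \<noteq> j0" by blast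
      then have "axis i0 1 \<notin> (\<Inter>v\<in>V. ?C Q v)" using W' [of "axis i0 1" i0 j0] by (auto simp: axis_def)
      then obtain x i j where x: "x \<in> V" "(Q *v x) $ i \<noteq> 0" "(Q *v x) $ j \<noteq> 0" "i \<noteq> j"
        by (auto simp: constant_on_support_def)
      have "card {i, j} < ?n" using x 2(2) by simp
      then obtain k where k: "k \<notin> {i, j}" by (metis UNIV_eq_I less_irrefl)
      \<comment> \<open>Supports now have at most two elements. The indicator of the support of
        \<open>x\<close> is not constant, so some \<open>y\<close> excludes it: the support of
        \<open>y\<close> meets that of \<open>x\<close> in a single index \<open>l\<close> and has
        another index \<open>m\<close> outside.\<close>
      let ?a = "axis i 1 + axis j 1 :: 'q ^ 'n"
      have "?a $ i \<noteq> ?a $ k" using k x by (auto simp: axis_def)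
      then have "?a \<notin> (\<Inter>v\<in>V. ?C Q v)" using W' by blast
      then obtain y l m where y: "y \<in> V" "(Q *v y) $ l \<noteq> 0" "(Q *v y) $ m \<noteq> 0" "l \<in> {i, j}" "m \<notin> {i, j}"
        unfolding constant_on_support_def by (auto simp: axis_def split: if_splits)
      then obtain i' where i': "i' \<noteq> l" "i' \<noteq> m" "l \<noteq> m" "(Q *v x) $ i' \<noteq> 0" "(Q *v x) $ l \<noteq> 0"
        using x by (metis insertE insertI1 singletonD insertI2)
      have Qy: "(Q *v y) $ i' = 0" using False y i' by metis
      have Qx: "(Q *v x) $ m = 0" using False x i' by metis
      \<comment> \<open>The basis vector \<open>l\<close> is exchanged for \<open>x\<close>.
        Expressing the old vector by the new ones gives \<open>y\<close> a coordinate at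
        \<open>i'\<close>, while those at \<open>l\<close> and \<open>m\<close> stay nonzero, so
        \<open>large\<close> applies.\<close>
      define M where "M = ((\<chi> r c. if c = l then (Q *v x) $ r else mat 1 $ r $ c) :: 'q ^ 'n ^ 'n)"
      have "det M \<noteq> 0" unfolding M_def det_replace_column by (rule i')
      then obtain M' where M': "M ** M' = mat 1" "M' ** M = mat 1"
        by (auto simp: invertible_det_nz [symmetric] invertible_def)
      have Mz: "(M *v z) $ r = (if r = l then 0 else z $ r) + (Q *v x) $ r * z $ l" for z r
        unfolding M_def by (rule replace_column_mult)
      have PQ': "(P ** M) ** (M' ** Q) = mat 1" "(M' ** Q) ** (P ** M) = mat 1"
        using PQ M' by (metis matrix_mul_assoc matrix_mul_rid)+
      have col: "column c (P ** M) \<in> V" for c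
      proof -
        have "column c (P ** M) = P *v column c M"
          by (simp add: vec_eq_iff column_def matrix_matrix_mult_def matrix_vector_mult_def)
        also have "column c M = (if c = l then Q *v x else axis c 1)"
          by (auto simp: M_def vec_eq_iff column_def mat_def axis_def)
        also have "P *v \<dots> = (if c = l then P *v (Q *v x) else column c P)"
          by (simp add: matrix_vector_mult_axis)
        finally show ?thesis using PQ P x by (auto simp: matrix_vector_mul_assoc)
      qed
      let ?z = "(M' ** Q) *v y"
      have "M *v ?z = Q *v y" using M' by (simp add: matrix_vector_mul_assoc matrix_mul_assoc)
      then have "?z $ l \<noteq> 0" "?z $ i' \<noteq> 0" "?z $ m \<noteq> 0"
        using Mz [of ?z l] Mz [of ?z i'] Mz [of ?z m] i' y Qx Qy by auto
      then show ?thesis using large [OF PQ' col y(1), of l i' m] i' by auto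
    qed
  qed
qed

section \<open>The upper bound\<close>

lemma nat_subgroup_eq_multiples:
  fixes E :: "nat set"
  assumes N: "N > 0" "N \<in> E" and add: "\<And>i j. i \<in> E \<Longrightarrow> j \<in> E \<Longrightarrow> i + j \<in> E"
    and mod: "\<And>k. k + N \<in> E \<Longrightarrow> k \<in> E"
  obtains d where "d > 0" "d dvd N" "\<And>k. k \<in> E \<longleftrightarrow> d dvd k"
proof -
  define d where "d = (LEAST d. d > 0 \<and> d \<in> E)"
  have d: "d > 0 \<and> d \<in> E" using LeastI [of "\<lambda>d. d > 0 \<and> d \<in> E" N] N by (simp add: d_def)
  have min: "k = 0" if "k \<in> E" "k < d" for k
    using that not_less_Least [of k "\<lambda>d. d > 0 \<and> d \<in> E"] by (auto simp: d_def)
  have "0 \<in> E" using mod [of 0] N by simp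
  then have mult: "t * k \<in> E" if "k \<in> E" for t k using that add by (induction t) auto
  have mods: "k \<in> E" if "k + t * N \<in> E" for k t
    using that by (induction t) (auto simp: mod ac_simps intro: mod)
  have "k \<in> E \<longleftrightarrow> d dvd k" for k
  proof
    assume "k \<in> E"
    \<comment> \<open>Instead of subtracting (k div d) d, its (N - 1)-fold multiple is added; the
      two differ by a multiple of N, which \<open>mods\<close> removes.\<close>
    moreover have "(k div d) * d * (N - 1) \<in> E" using mult [of d "(k div d) * (N - 1)"] d by (simp add: ac_simps)
    ultimately have "k + (k div d) * d * (N - 1) \<in> E" using add by blast
    also have "k + (k div d) * d * (N - 1) = k mod d + (k div d * d + (k div d) * d * (N - 1))"
      by simp
    also have "k div d * d + (k div d) * d * (N - 1) = (k div d * d) * N"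
      using N(1) by (cases N) simp_all
    finally have "k mod d \<in> E" using mods by blast
    then show "d dvd k" using min [of "k mod d"] d by (simp add: mod_eq_0_iff_dvd)
  next
    assume "d dvd k"
    then obtain t where "k = d * t" by blast
    then show "k \<in> E" using mult [of d t] d by (simp add: mult.commute)
  qed
  then show thesis using that [of d] d N by blast
qed

text \<open>
  Subgroups of a cyclic group of order \<open>N\<close> are encoded by the generators of their preimages in
  \<open>\<int>\<close>, so that \<open>d0\<close> stands for the subgroup of order \<open>e\<close>. For every prime divisor of \<open>e\<close>,
  one of the given subgroups has the smallest \<open>p\<close>-part.
\<close>

lemma cyclic_subgroup_intersection:
  fixes d :: "'b \<Rightarrow> nat"
  assumes "finite J" and N: "N = d0 * e" "N > 0" and dvd: "\<And>j. j \<in> J \<Longrightarrow> d j dvd N"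
  shows "\<exists>J'\<subseteq>J. card J' \<le> omega e \<and>
    (\<forall>k. d0 dvd k \<longrightarrow> (\<forall>i\<in>J'. d i dvd k) \<longrightarrow> (\<forall>j\<in>J. d j dvd k))"
proof (cases "J = {}")
  case False
  have e: "e > 0" "d0 > 0" using N by auto
  have "\<exists>i\<in>J. \<forall>j\<in>J. multiplicity p (d j) \<le> multiplicity p (d i)" for p
  proof -
    let ?M = "(\<lambda>j. multiplicity p (d j)) ` J"
    have M: "finite ?M" "?M \<noteq> {}" using assms(1) False by auto
    then obtain i where i: "i \<in> J" "Max ?M = multiplicity p (d i)" using Max_in [OF M] by blast
    have "\<forall>j\<in>J. multiplicity p (d j) \<le> multiplicity p (d i)"
      unfolding i(2) [symmetric] using M by (intro ballI Max_ge) auto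
    then show ?thesis using i(1) by blast
  qed
  then obtain i where i: "\<And>p. i p \<in> J" "\<And>p j. j \<in> J \<Longrightarrow> multiplicity p (d j) \<le> multiplicity p (d (i p))"
    by metis
  let ?P = "{p. prime p \<and> p dvd e}"
  have "finite ?P" using e finite_divisors_nat [of e] by (rule_tac finite_subset [of _ "{p. p dvd e}"]) auto
  then have "card (i ` ?P) \<le> omega e" unfolding omega_def by (rule card_image_le)
  moreover have "d j dvd k" if k: "d0 dvd k" "\<forall>i\<in>i ` ?P. d i dvd k" and j: "j \<in> J" for k j
  proof (cases "k = 0")
    case k0: False
    have "d j \<noteq> 0" using dvd [OF j] N(2) by (auto dest: dvd_0_left)
    then show ?thesis
    proof (rule multiplicity_le_imp_dvd)
      fix p :: nat assume p: "prime p"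
      show "multiplicity p (d j) \<le> multiplicity p k"
      proof (cases "p dvd e")
        case True
        then have "multiplicity p (d (i p)) \<le> multiplicity p k"
          using k(2) p k0 by (intro dvd_imp_multiplicity_le) auto
        then show ?thesis using i(2) [OF j, of p] by simp
      next
        case False
        \<comment> \<open>For a prime not dividing \<open>e\<close> the p-parts of \<open>N\<close>
          and \<open>d0\<close> agree, so divisibility by \<open>d0\<close> takes care of
          it.\<close>
        have "multiplicity p (d j) \<le> multiplicity p N"
          using dvd [OF j] N by (intro dvd_imp_multiplicity_le) auto
        also have "\<dots> = multiplicity p d0"
          using p e False by (simp add: N prime_elem_multiplicity_mult_distrib not_dvd_imp_multiplicity_0)
        also have "\<dots> \<le> multiplicity p k" using k(1) k0 by (rule dvd_imp_multiplicity_le)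
        finally show ?thesis .
      qed
    qed
  qed simp
  ultimately show ?thesis using i(1) by (intro exI [of _ "i ` ?P"]) blast
qed (auto intro: exI [of _ "{}"])

lemma frob_order:
  obtains N where "N > 0" "\<And>k. (frob ^^ k :: 'q::finite_field \<Rightarrow> 'q) = id \<longleftrightarrow> N dvd k"
proof -
  obtain f where f: "CARD('q) = CHAR('q) ^ f" "f > 0" by (rule card_finite_field)
  let ?E = "{k. (frob ^^ k :: 'q \<Rightarrow> 'q) = id}"
  have fE: "f \<in> ?E"
    using frob_funpow_eq_id [OF f(1), of 1] by simp
  have add: "i + j \<in> ?E" if "i \<in> ?E" "j \<in> ?E" for i j using that by (simp add: funpow_add)
  have mod: "i \<in> ?E" if "i + f \<in> ?E" for i using that fE by (simp add: funpow_add)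
  obtain d where "d > 0" "\<And>k. k \<in> ?E \<longleftrightarrow> d dvd k"
    by (rule nat_subgroup_eq_multiples [OF f(2) fE add mod]) blast+
  then show thesis using that by simp
qed

lemma automorphism_subgroup_multiples:
  fixes D :: "('q::finite_field \<Rightarrow> 'q) set"
  assumes N: "N > 0" "\<And>k. (frob ^^ k :: 'q \<Rightarrow> 'q) = id \<longleftrightarrow> N dvd k"
    and D: "id \<in> D" "\<And>\<sigma> \<tau>. \<sigma> \<in> D \<Longrightarrow> \<tau> \<in> D \<Longrightarrow> \<sigma> \<circ> \<tau> \<in> D"
  obtains d where "d > 0" "d dvd N" "\<And>k. (frob ^^ k :: 'q \<Rightarrow> 'q) \<in> D \<longleftrightarrow> d dvd k"
proof -
  let ?E = "{k. (frob ^^ k :: 'q \<Rightarrow> 'q) \<in> D}"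
  have NE: "N \<in> ?E" using N(2) [of N] D(1) by simp
  have add: "i + j \<in> ?E" if "i \<in> ?E" "j \<in> ?E" for i j using that D(2) by (simp add: funpow_add)
  have mod: "i \<in> ?E" if "i + N \<in> ?E" for i using that N(2) [of N] by (simp add: funpow_add)
  obtain d where "d > 0" "d dvd N" "\<And>k. k \<in> ?E \<longleftrightarrow> d dvd k"
    by (rule nat_subgroup_eq_multiples [OF N(1) NE add mod]) blast+
  then show thesis using that by simp
qed

text \<open>Powers of Frobenius with exponents below \<open>N\<close> are distinct, and those in
  \<open>D\<close> have the exponents d t with t < N / d.\<close>

lemma card_automorphism_subgroup:
  fixes D :: "('q::finite_field \<Rightarrow> 'q) set"
  assumes N: "N > 0" "\<And>k. (frob ^^ k :: 'q \<Rightarrow> 'q) = id \<longleftrightarrow> N dvd k"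
    and D: "D \<subseteq> frob_powers" and d: "d > 0" "d dvd N" "\<And>k. (frob ^^ k :: 'q \<Rightarrow> 'q) \<in> D \<longleftrightarrow> d dvd k"
  shows "N = d * card D"
proof -
  obtain e where e: "N = d * e" using d(2) by blast
  have inj_frob: "inj (frob ^^ k :: 'q \<Rightarrow> 'q)" for k
    by (rule injI) (metis aut_eq_iff frob_funpow_in)
  have neq: "(frob ^^ i :: 'q \<Rightarrow> 'q) \<noteq> frob ^^ j" if "i < j" "j < N" for i j
  proof
    assume eq: "(frob ^^ i :: 'q \<Rightarrow> 'q) = frob ^^ j"
    have "(frob ^^ (j - i) :: 'q \<Rightarrow> 'q) = id"
    proof
      fix x :: 'q
      have "(frob ^^ i) ((frob ^^ (j - i)) x) = (frob ^^ (i + (j - i))) x"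
        by (simp only: funpow_add comp_apply)
      also have "\<dots> = (frob ^^ i) x" using that eq by simp
      finally have "(frob ^^ i) ((frob ^^ (j - i)) x) = (frob ^^ i) x" .
      then show "(frob ^^ (j - i)) x = id x" using inj_frob [of i] by (simp add: inj_eq)
    qed
    then show False using N that by (auto dest: dvd_imp_le)
  qed
  have "D = (\<lambda>t. frob ^^ (d * t)) ` {..<e}"
  proof (intro equalityI subsetI)
    fix \<sigma> assume "\<sigma> \<in> D"
    then obtain k where k: "\<sigma> = frob ^^ k" using D unfolding frob_powers_def by blast
    have "(frob ^^ (N * (k div N)) :: 'q \<Rightarrow> 'q) = id" using N by simp
    then have k': "\<sigma> = frob ^^ (k mod N)"
      unfolding k by (subst mult_div_mod_eq [of N k, symmetric]) (simp only: funpow_add id_comp)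
    then have "d dvd k mod N" using \<open>\<sigma> \<in> D\<close> d by simp
    then obtain t where t: "k mod N = d * t" by blast
    then have "t < e" using e N(1) mod_less_divisor [of N k] by simp
    then show "\<sigma> \<in> (\<lambda>t. frob ^^ (d * t)) ` {..<e}" using t k' by auto
  next
    fix \<sigma> assume "\<sigma> \<in> (\<lambda>t. (frob ^^ (d * t) :: 'q \<Rightarrow> 'q)) ` {..<e}"
    then show "\<sigma> \<in> D" using d(3) dvd_triv_left by blast
  qed
  moreover have "inj_on (\<lambda>t. frob ^^ (d * t) :: 'q \<Rightarrow> 'q) {..<e}"
  proof (rule linorder_inj_onI')
    fix i j assume "i \<in> {..<e}" "j \<in> {..<e}" "i < j"
    then have "d * i < d * j" "d * j < N" using d(1) by (simp_all add: e)
    then show "(frob ^^ (d * i) :: 'q \<Rightarrow> 'q) \<noteq> frob ^^ (d * j)" by (rule neq)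
  qed
  ultimately show ?thesis using e by (simp add: card_image)
qed

context semilinear_group
begin

definition auts :: "('q \<Rightarrow> 'q) set" where "auts = snd ` R"

lemma determines_orbits_upper:
  assumes n: "CARD('n) \<ge> 2"
  shows "determines_orbits R (max (2 * CARD('n) - 2) (CARD('n) + 1) + 1 + omega (card auts))"
    (is "determines_orbits R ?r")
  unfolding determines_orbits_def
proof (intro allI impI, elim conjE)
  fix k and x y :: "nat \<Rightarrow> 'q ^ 'n"
  assume k: "k \<ge> ?r" and nz: "\<forall>i<k. x i \<noteq> 0 \<and> y i \<noteq> 0"
    and eq: "\<forall>I\<subseteq>{..<k}. card I = ?r \<longrightarrow> (\<exists>g\<in>R. \<forall>i\<in>I. sends g (x i) (y i))"
  obtain S0 where S0: "S0 \<subseteq> x ` {..<k}" "card S0 \<le> max (2 * CARD('n) - 2) (CARD('n) + 1)"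
    "\<And>A. (\<forall>v\<in>S0. eigen A v) \<Longrightarrow> (\<forall>v\<in>x ` {..<k}. eigen A v)"
    using exists_small_fixing_set [of "x ` {..<k}"] nz n by fastforce
  obtain S where S: "S \<subseteq> {..<k}" "S0 = x ` S" "inj_on x S"
    using S0(1) by (meson subset_image_inj)
  have card_S: "card S \<le> max (2 * CARD('n) - 2) (CARD('n) + 1)" using S S0(2) by (simp add: card_image)
  \<comment> \<open>The automorphisms induced by the common stabiliser in \<open>R\<close> of the
    points in \<open>S\<close> and the point \<open>j\<close>; the number \<open>d j\<close> chosen
    below encodes this subgroup.\<close>
  define T where "T j = {\<sigma>. \<exists>A. (A, \<sigma>) \<in> R \<and> (\<forall>i\<in>insert j S. sends (A, \<sigma>) (x i) (x i))}" for j
  obtain N where N: "N > 0" "\<And>k. (frob ^^ k :: 'q \<Rightarrow> 'q) = id \<longleftrightarrow> N dvd k"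
    by (rule frob_order) blast
  have sends_one: "sends (mat 1, id) v v" for v :: "'q ^ 'n"
    unfolding sends_def by (intro exI [of _ 1]) (simp add: semilinear_map_eq)
  have T1: "id \<in> T j" for j unfolding T_def using R_one sends_one by blast
  have T2: "\<sigma> \<circ> \<tau> \<in> T j" if \<sigma>: "\<sigma> \<in> T j" and \<tau>: "\<tau> \<in> T j" for \<sigma> \<tau> j
  proof -
    obtain A where A: "(A, \<sigma>) \<in> R" "\<forall>i\<in>insert j S. sends (A, \<sigma>) (x i) (x i)"
      using \<sigma> unfolding T_def by blast
    obtain B where B: "(B, \<tau>) \<in> R" "\<forall>i\<in>insert j S. sends (B, \<tau>) (x i) (x i)"
      using \<tau> unfolding T_def by blast
    show ?thesis unfolding T_def using R_mult [OF A(1) B(1)] sends_mult [OF A(1)] A(2) B(2) by blast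
  qed
  have "\<exists>d. d > 0 \<and> d dvd N \<and> (\<forall>k. (frob ^^ k :: 'q \<Rightarrow> 'q) \<in> T j \<longleftrightarrow> d dvd k)" for j
    by (rule automorphism_subgroup_multiples [OF N T1 T2]) blast+
  then obtain d where d: "\<And>j. d j dvd N" "\<And>j k. (frob ^^ k :: 'q \<Rightarrow> 'q) \<in> T j \<longleftrightarrow> d j dvd k" by metis
  have auts: "id \<in> auts" "auts \<subseteq> frob_powers" unfolding auts_def
    using R_one R_carrier by force+
  have "\<sigma> \<circ> \<tau> \<in> auts" if "\<sigma> \<in> auts" "\<tau> \<in> auts" for \<sigma> \<tau>
    using that R_mult unfolding auts_def by force
  then obtain d0 where d0: "d0 > 0" "d0 dvd N" "\<And>k. (frob ^^ k :: 'q \<Rightarrow> 'q) \<in> auts \<longleftrightarrow> d0 dvd k"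
    using automorphism_subgroup_multiples [OF N auts(1)] by blast
  have "N = d0 * card auts" using card_automorphism_subgroup [OF N auts(2) d0] .
  then obtain J where J: "J \<subseteq> {..<k}" "card J \<le> omega (card auts)"
    "\<And>l. d0 dvd l \<Longrightarrow> (\<forall>i\<in>J. d i dvd l) \<Longrightarrow> (\<forall>j\<in>{..<k}. d j dvd l)"
    using cyclic_subgroup_intersection [of "{..<k}" N d0 "card auts" d] N(1) d(1) by auto
  \<comment> \<open>The automorphism of \<open>g\<close> also occurs for some \<open>B\<close>
    fixing \<open>S\<close> and \<open>x j\<close>. Then \<open>g\<close> is \<open>B\<close>
    followed by a linear \<open>C\<close> which fixes \<open>S\<close>, hence every point by the
    choice of \<open>S0\<close>; so \<open>g\<close> fixes \<open>x j\<close> because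
    \<open>B\<close> does.\<close>
  have fix_all: "sends g (x j) (x j)"
    if g: "g \<in> R" "\<forall>i\<in>S \<union> J. sends g (x i) (x i)" and j: "j < k" for g j
  proof -
    obtain A \<sigma> where A: "g = (A, \<sigma>)" by (metis surj_pair)
    have "\<sigma> \<in> frob_powers" using R_carrier g A by blast
    then obtain l where l: "\<sigma> = frob ^^ l" by (rule frob_powersE)
    have "\<sigma> \<in> auts" using g A by (force simp: auts_def)
    moreover have "\<sigma> \<in> T i" if "i \<in> J" for i unfolding T_def using g A that by blast
    ultimately have "d j dvd l" using J(3) [of l] d0(3) d(2) l j by auto
    then have "\<sigma> \<in> T j" using d(2) l by blast
    then obtain B where B: "(B, \<sigma>) \<in> R" "\<forall>i\<in>insert j S. sends (B, \<sigma>) (x i) (x i)"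
      unfolding T_def by blast
    obtain C where C: "(C, id) \<in> R" "C ** B = A" using linear_quotient g(1) A B(1) by blast
    have "eigen C (x i)" if i: "sends (A, \<sigma>) (x i) (x i)" "sends (B, \<sigma>) (x i) (x i)" for i
    proof -
      obtain a where a: "a \<noteq> 0" "A *v aut_vec \<sigma> (x i) = a *s x i"
        using i unfolding sends_def semilinear_map_eq by blast
      obtain b where b: "b \<noteq> 0" "B *v aut_vec \<sigma> (x i) = b *s x i"
        using i unfolding sends_def semilinear_map_eq by blast
      have "b *s (C *v x i) = a *s x i"
        using a b C(2) by (metis matrix_vector_mul_assoc vector_scalar_commute)
      then have "C *v x i = (a / b) *s x i"
        using b(1) by (metis (no_types, lifting) divide_inverse mult.commute vec.scale_scale
            vec.scale_one left_inverse)
      then show ?thesis unfolding eigen_def by blast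
    qed
    then have "\<forall>v\<in>S0. eigen C v" using g(2) B(2) A S(2) by blast
    then have "eigen C (x j)" using S0(3) j by blast
    then obtain c where c: "C *v x j = c *s x j" unfolding eigen_def by blast
    obtain b where b: "b \<noteq> 0" "B *v aut_vec \<sigma> (x j) = b *s x j"
      using B unfolding sends_def semilinear_map_eq by blast
    have "C *v x j \<noteq> 0" using R_carrier [OF C(1)] nz j by (simp add: invertible_mult_vec_eq_0_iff)
    then have "c \<noteq> 0" using c by auto
    moreover have "A *v aut_vec \<sigma> (x j) = (b * c) *s x j"
      using b(2) c C(2) by (metis matrix_vector_mul_assoc vector_scalar_commute vec.scale_scale)
    ultimately show ?thesis unfolding A sends_def semilinear_map_eq using b(1)
      by (intro exI [of _ "b * c"]) simp
  qed
  have ex: "\<exists>g\<in>R. \<forall>i\<in>insert j (S \<union> J). sends g (x i) (y i)" if j: "j < k" for j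
  proof -
    have fin: "finite S" "finite J" using S(1) J(1) finite_subset by blast+
    have "card (insert j (S \<union> J)) \<le> ?r"
      using card_insert_le_m1 [of "card S + card J + 1" "S \<union> J" j] card_Un_le [of S J] card_S J(2)
        card_insert_if [of "S \<union> J" j] fin by auto
    moreover have "insert j (S \<union> J) \<subseteq> {..<k}" using S(1) J(1) j by auto
    ultimately obtain I where I: "insert j (S \<union> J) \<subseteq> I" "I \<subseteq> {..<k}" "card I = ?r"
      using exists_subset_between [of "insert j (S \<union> J)" ?r "{..<k}"] k by auto
    then show ?thesis using eq by (meson subsetD)
  qed
  have "k > 0" using k by simp
  \<comment> \<open>The index 0 is an arbitrary choice; what matters is that \<open>h\<close> is
    correct on \<open>S \<union> J\<close>.\<close>
  then obtain h where h: "h \<in> R" "\<forall>i\<in>insert 0 (S \<union> J). sends h (x i) (y i)" using ex by blast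
  show "\<exists>g\<in>R. \<forall>i<k. sends g (x i) (y i)"
  proof (intro bexI [OF _ h(1)] allI impI)
    fix i assume i: "i < k"
    obtain g where g: "g \<in> R" "\<forall>j\<in>insert i (S \<union> J). sends g (x j) (y j)" using ex i by blast
    \<comment> \<open>\<open>t\<close> is \<open>h\<close> followed by the inverse of
      \<open>g\<close>. It fixes \<open>S \<union> J\<close> pointwise, hence all points, so
      \<open>h\<close> agrees with \<open>g\<close> at \<open>i\<close>.\<close>
    obtain t where t: "t \<in> R" "\<And>u v. sends h u v \<Longrightarrow> sends g u v \<Longrightarrow> sends t u u"
      "\<And>u v. sends t u u \<Longrightarrow> sends g u v \<Longrightarrow> sends h u v"
      using sends_quotient [OF h(1) g(1)] by blast
    have "sends t (x i) (x i)" using g(2) h(2) t i by (intro fix_all) blast+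
    then show "sends h (x i) (y i)" using t(3) g(2) by blast
  qed
qed

end

section \<open>Lower bounds\<close>

definition rc :: "(('q::finite_field ^ 'n ^ 'n) \<times> ('q \<Rightarrow> 'q)) set \<Rightarrow> nat" where
  "rc R = (LEAST r. r \<ge> 1 \<and> determines_orbits R r)"

text \<open>A set of size \<open>r\<close> extends to one of size \<open>s\<close> inside the index
  set. So a single failing \<open>r\<close> bounds \<open>rc\<close> from below.\<close>

lemma determines_orbits_mono:
  assumes "determines_orbits R r" "r \<le> s"
  shows "determines_orbits R s"
  unfolding determines_orbits_def
proof (intro allI impI, elim conjE)
  fix k and x y :: "nat \<Rightarrow> 'a ^ 'b"
  assume k: "k \<ge> s" and nz: "\<forall>i<k. x i \<noteq> 0 \<and> y i \<noteq> 0"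
    and eq: "\<forall>I\<subseteq>{..<k}. card I = s \<longrightarrow> (\<exists>g\<in>R. \<forall>i\<in>I. sends g (x i) (y i))"
  have "\<exists>g\<in>R. \<forall>i\<in>I. sends g (x i) (y i)" if I: "I \<subseteq> {..<k}" "card I = r" for I
  proof -
    obtain I' where I': "I \<subseteq> I'" "I' \<subseteq> {..<k}" "card I' = s"
      using exists_subset_between [of I s "{..<k}"] I k assms(2) by auto
    then obtain g where "g \<in> R" "\<forall>i\<in>I'. sends g (x i) (y i)" using eq by blast
    then show ?thesis using I'(1) by blast
  qed
  then show "\<exists>g\<in>R. \<forall>i<k. sends g (x i) (y i)"
    using assms k nz unfolding determines_orbits_def by simp
qed

text \<open>Two tuples are given as a finite set of (source, target) pairs, which suits
  configurations built from families of points; an enumeration restores the indexed form.\<close>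

lemma not_determines_orbits:
  assumes Q: "finite Q" "r \<le> card Q" "\<And>x y. (x, y) \<in> Q \<Longrightarrow> x \<noteq> 0 \<and> y \<noteq> 0"
    and local: "\<And>I. I \<subseteq> Q \<Longrightarrow> card I = r \<Longrightarrow> \<exists>g\<in>R. \<forall>(x, y)\<in>I. sends g x y"
    and global: "\<not> (\<exists>g\<in>R. \<forall>(x, y)\<in>Q. sends g x y)"
  shows "\<not> determines_orbits R r"
proof
  assume *: "determines_orbits R r"
  obtain f where f: "bij_betw f {..<card Q} Q"
    using ex_bij_betw_nat_finite [OF Q(1)] by (auto simp: atLeast0LessThan)
  have fQ: "f i \<in> Q" if "i < card Q" for i using f that by (auto simp: bij_betw_def)
  have loc: "\<exists>g\<in>R. \<forall>i\<in>I. sends g (fst (f i)) (snd (f i))" if I: "I \<subseteq> {..<card Q}" "card I = r" for I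
  proof -
    have "f ` I \<subseteq> Q" "card (f ` I) = r"
      using I f fQ by (auto simp: bij_betw_def card_image inj_on_subset)
    then obtain g where "g \<in> R" "\<forall>(x, y)\<in>f ` I. sends g x y" using local by blast
    then show ?thesis by (intro bexI [of _ g]) (auto simp: case_prod_beta)
  qed
  have nz: "fst (f i) \<noteq> 0 \<and> snd (f i) \<noteq> 0" if "i < card Q" for i
    using Q(3) [of "fst (f i)" "snd (f i)"] fQ [OF that] by simp
  have "\<exists>g\<in>R. \<forall>i<card Q. sends g (fst (f i)) (snd (f i))"
    using * Q(2) loc nz unfolding determines_orbits_def by simp
  then obtain g where g: "g \<in> R" "\<forall>i<card Q. sends g (fst (f i)) (snd (f i))" by blast
  have "\<forall>(x, y)\<in>Q. sends g x y"
  proof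
    fix z assume "z \<in> Q"
    then obtain i where "i < card Q" "z = f i" using f by (auto simp: bij_betw_def)
    then show "case z of (x, y) \<Rightarrow> sends g x y" using g(2) by (simp add: case_prod_beta)
  qed
  then show False using g(1) global by blast
qed

section \<open>Matrices for the explicit matches\<close>

definition diag :: "('n \<Rightarrow> 'q) \<Rightarrow> 'q::field ^ 'n ^ 'n" where
  "diag d = (\<chi> i j. if i = j then d i else 0)"

lemma diag_mult_nth [simp]: "(diag d *v x) $ i = d i * x $ i"
proof -
  have "(\<Sum>j\<in>UNIV. (if i = j then d i else 0) * x $ j) = (\<Sum>j\<in>UNIV. if j = i then d i * x $ i else 0)"
    by (rule sum.cong) auto
  then show ?thesis by (simp add: diag_def matrix_vector_mult_def)
qed

lemma det_diag [simp]: "det (diag d) = prod d UNIV"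
  by (subst det_diagonal) (simp_all add: diag_def)

definition replace_col :: "'n \<Rightarrow> 'q ^ 'n \<Rightarrow> 'q::field ^ 'n ^ 'n" where
  "replace_col k x = (\<chi> i j. if j = k then x $ i else mat 1 $ i $ j)"

lemma det_replace_col [simp]: "det (replace_col k x) = x $ k"
  unfolding replace_col_def by (rule det_replace_column)

lemma replace_col_mult_nth [simp]:
  "(replace_col k x *v z) $ r = (if r = k then 0 else z $ r) + x $ r * z $ k"
  unfolding replace_col_def by (rule replace_column_mult)

definition replace_row :: "'n \<Rightarrow> 'q ^ 'n \<Rightarrow> 'q::field ^ 'n ^ 'n" where
  "replace_row k x = transpose (replace_col k x)"

lemma det_replace_row [simp]: "det (replace_row k x) = x $ k"
  by (simp add: replace_row_def det_transpose)

lemma replace_row_mult_nth [simp]: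
  "(replace_row k x *v z) $ r = (if r = k then \<Sum>j\<in>UNIV. x $ j * z $ j else z $ r)"
proof -
  have "(replace_row k x *v z) $ r = (\<Sum>j\<in>UNIV. (if r = k then x $ j else mat 1 $ j $ r) * z $ j)"
    by (simp add: replace_row_def replace_col_def matrix_vector_mult_def transpose_def)
  also have "\<dots> = (\<Sum>j\<in>UNIV. if r = k then x $ j * z $ j else if j = r then z $ r else 0)"
    by (rule sum.cong) (auto simp: mat_def)
  finally show ?thesis by simp
qed

lemma sum_axis2:
  fixes x :: "'q::field ^ 'n"
  assumes "i \<noteq> j"
  shows "(\<Sum>k\<in>UNIV. ((axis i s :: 'q ^ 'n) $ k + (axis j t :: 'q ^ 'n) $ k) * x $ k) = s * x $ i + t * x $ j"
proof -
  have "((axis i s :: 'q ^ 'n) $ k + (axis j t :: 'q ^ 'n) $ k) * x $ k =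
      (if k = i then s * x $ i else 0) + (if k = j then t * x $ j else 0)" for k
    using assms by (auto simp: axis_def)
  then show ?thesis by (simp add: sum.distrib)
qed

lemma sendsI: "c \<noteq> 0 \<Longrightarrow> (\<And>k. (A *v aut_vec \<sigma> x) $ k = c * y $ k) \<Longrightarrow> sends (A, \<sigma>) x y"
  unfolding sends_def semilinear_map_eq by (auto simp: vec_eq_iff)

lemma mult_on_support:
  fixes A :: "'q::field ^ 'n ^ 'n"
  assumes A: "\<And>i. i \<in> I \<Longrightarrow> A *v axis i 1 = a i *s axis i 1" and x: "\<And>i. i \<notin> I \<Longrightarrow> x $ i = 0"
  shows "(A *v x) $ r = a r * x $ r"
proof -
  have "A $ r $ j * x $ j = (if j = r then a r * x $ r else 0)" for j
  proof (cases "j \<in> I")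
    case True
    then have "column j A = a j *s axis j 1" using A matrix_vector_mult_axis [of A j 1] by simp
    then have "A $ r $ j = a j * axis j 1 $ r" by (simp add: column_def vec_eq_iff)
    then show ?thesis by (auto simp: axis_def)
  qed (use x in auto)
  then show ?thesis by (simp add: matrix_vector_mult_def)
qed

context semilinear_group
begin

lemma rc_determines:
  assumes "CARD('n) \<ge> 2"
  shows "determines_orbits R (rc R)" "rc R \<ge> 1"
    "rc R \<le> max (2 * CARD('n) - 2) (CARD('n) + 1) + 1 + omega (card auts)"
proof -
  let ?r = "max (2 * CARD('n) - 2) (CARD('n) + 1) + 1 + omega (card auts)"
  have r: "?r \<ge> 1 \<and> determines_orbits R ?r" using determines_orbits_upper [OF assms] by simp
  show "rc R \<le> ?r" unfolding rc_def using Least_le [of "\<lambda>r. r \<ge> 1 \<and> determines_orbits R r", OF r] .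
  show "determines_orbits R (rc R)" "rc R \<ge> 1"
    using LeastI [of "\<lambda>r. r \<ge> 1 \<and> determines_orbits R r", OF r] by (simp_all add: rc_def)
qed

lemma rc_gt:
  assumes "CARD('n) \<ge> 2"
    and "finite Q" "r \<le> card Q" "\<And>x y. (x, y) \<in> Q \<Longrightarrow> x \<noteq> 0 \<and> y \<noteq> 0"
    and "\<And>I. I \<subseteq> Q \<Longrightarrow> card I = r \<Longrightarrow> \<exists>g\<in>R. \<forall>(x, y)\<in>I. sends g x y"
    and "\<not> (\<exists>g\<in>R. \<forall>(x, y)\<in>Q. sends g x y)"
  shows "r < rc R"
proof (rule ccontr)
  assume "\<not> r < rc R"
  then have "determines_orbits R r"
    using determines_orbits_mono [OF rc_determines(1) [OF assms(1)], of r] by simp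
  then show False using not_determines_orbits [OF assms(2-)] by blast
qed

text \<open>Any \<open>card Q - 1\<close> pairs lie in some \<open>Q - {z}\<close>, so a minimal
  configuration without a match bounds \<open>rc\<close> by its size.\<close>

lemma rc_ge_card:
  assumes n: "CARD('n) \<ge> 2"
    and Q: "finite Q" "Q \<noteq> {}" "\<And>x y. (x, y) \<in> Q \<Longrightarrow> x \<noteq> 0 \<and> y \<noteq> 0"
    and local: "\<And>z. z \<in> Q \<Longrightarrow> \<exists>g\<in>R. \<forall>(x, y)\<in>Q - {z}. sends g x y"
    and global: "\<not> (\<exists>g\<in>R. \<forall>(x, y)\<in>Q. sends g x y)"
  shows "card Q \<le> rc R"
proof -
  have "card Q > 0" using Q by (simp add: card_gt_0_iff)
  have "card Q - 1 < rc R"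
  proof (rule rc_gt [OF n Q(1) _ Q(3) _ global])
    fix I assume I: "I \<subseteq> Q" "card I = card Q - 1"
    then obtain z where "z \<in> Q" "z \<notin> I" using \<open>card Q > 0\<close> by (cases "I = Q") auto
    then show "\<exists>g\<in>R. \<forall>(x, y)\<in>I. sends g x y" using local [of z] I(1) by blast
  qed auto
  then show ?thesis by simp
qed

end

text \<open>
  Two flats meeting in the point \<open>\<langle>axis i + axis j\<rangle>\<close>: the line through \<open>axis i\<close> and \<open>axis j\<close>
  with one further point, and a flat carrying a frame and one further point.
  On each of them the points determine, together with the common point,
  a cross ratio \<open>\<alpha>\<close>, and the automorphism moving the first cross ratio must fix the second.
\<close>

locale two_flats =
  fixes I :: "'n::finite set" and i j :: 'n and \<alpha> :: "'q::finite_field" and \<psi> :: "'q \<Rightarrow> 'q"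
  assumes ij: "i \<in> I" "j \<in> I" "i \<noteq> j" and I: "card I \<ge> 3"
    and \<alpha>: "\<alpha> \<noteq> 0" "\<And>x. x \<noteq> 0 \<Longrightarrow> \<exists>k. x = \<alpha> ^ k"
    and \<psi>: "\<psi> \<in> frob_powers" "\<psi> \<noteq> id"
begin

text \<open>\<open>u\<close> completes the basis points of \<open>I\<close> to a frame, and v -
  \<alpha> u = (1 - \<alpha>) (e_i + e_j). So the line through \<open>u\<close> and \<open>v\<close>
  meets the line through e_i and e_j in the common point of the two flats. Only the pair of
  \<open>w \<alpha>\<close> has different source and target.\<close>

definition u :: "'q ^ 'n" where "u = (\<chi> k. if k \<in> I then 1 else 0)"
definition v :: "'q ^ 'n" where "v = (\<chi> k. if k = i \<or> k = j then 1 else if k \<in> I then \<alpha> else 0)"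
definition w :: "'q \<Rightarrow> 'q ^ 'n" where "w \<beta> = axis i 1 + axis j \<beta>"
definition flats :: "(('q ^ 'n) \<times> ('q ^ 'n)) set" where
  "flats = (\<lambda>k. (axis k 1, axis k 1)) ` I \<union> {(u, u), (v, v), (w \<alpha>, w (\<psi> \<alpha>))}"

lemma u_nth: "u $ k = (if k \<in> I then 1 else 0)" by (simp add: u_def)
lemma v_nth: "v $ k = (if k = i \<or> k = j then 1 else if k \<in> I then \<alpha> else 0)" by (simp add: v_def)
lemma w_nth: "w \<beta> $ k = (if k = i then 1 else if k = j then \<beta> else 0)"
  using ij by (simp add: w_def axis_def)

lemma fixes_\<alpha>: "\<sigma> \<in> frob_powers \<Longrightarrow> \<sigma> \<alpha> = \<alpha> \<Longrightarrow> \<sigma> = id"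
  using aut_eq_id_if_fixes_generator \<alpha>(2) by blast

lemma \<psi>\<alpha>: "\<psi> \<alpha> \<noteq> \<alpha>" "\<alpha> \<noteq> 1" "\<psi> \<alpha> \<noteq> 1" "\<psi> \<alpha> \<noteq> 0"
proof -
  show *: "\<psi> \<alpha> \<noteq> \<alpha>" using fixes_\<alpha> \<psi> by blast
  then show "\<alpha> \<noteq> 1" using \<psi> by auto
  then show "\<psi> \<alpha> \<noteq> 1" using \<psi> aut_eq_iff [of \<psi> \<alpha> 1] by simp
  show "\<psi> \<alpha> \<noteq> 0" using \<psi> \<alpha> by simp
qed

lemma third: obtains k where "k \<in> I" "k \<noteq> i" "k \<noteq> j"
proof -
  have "card {i, j} < card I" using I ij by simp
  then have "\<not> I \<subseteq> {i, j}" using card_mono [of "{i, j}" I] by auto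
  then show thesis using that by blast
qed

lemma finite_flats: "finite flats"
  by (simp add: flats_def)

lemma flats_ne_axis: "u \<noteq> axis l 1" "v \<noteq> axis l 1" "w \<alpha> \<noteq> axis l 1"
proof -
  obtain m where m: "m = i \<or> m = j" "m \<noteq> l" using ij by metis
  then have "axis l 1 $ m = (0 :: 'q)" "u $ m \<noteq> 0" "v $ m \<noteq> 0" "w \<alpha> $ m \<noteq> 0"
    using ij \<alpha>(1) by (auto simp: u_nth v_nth w_nth axis_def)
  then show "u \<noteq> axis l 1" "v \<noteq> axis l 1" "w \<alpha> \<noteq> axis l 1" by metis+
qed

lemma flats_axisD: "(axis l 1, y) \<in> flats \<Longrightarrow> y = axis l 1"
  using flats_ne_axis [of l] unfolding flats_def by (auto simp: axis_eq_axis)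

lemma card_flats: "card flats = card I + 3"
proof -
  obtain k where k: "k \<in> I" "k \<noteq> i" "k \<noteq> j" by (rule third)
  have "u $ k \<noteq> v $ k" "u $ k \<noteq> w \<alpha> $ k" "v $ k \<noteq> w \<alpha> $ k"
    using k ij \<alpha>(1) \<psi>\<alpha> by (auto simp: u_nth v_nth w_nth)
  then have ne: "u \<noteq> v" "u \<noteq> w \<alpha>" "v \<noteq> w \<alpha>" by metis+
  have "inj_on (\<lambda>k. (axis k 1, axis k 1) :: ('q ^ 'n) \<times> ('q ^ 'n)) I"
    by (rule inj_onI) (simp add: axis_eq_axis)
  then have "card ((\<lambda>k. (axis k 1, axis k 1) :: ('q ^ 'n) \<times> ('q ^ 'n)) ` I) = card I"
    by (rule card_image)
  moreover have "card {(u, u), (v, v), (w \<alpha>, w (\<psi> \<alpha>))} = 3" using ne by simp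
  moreover have "(\<lambda>k. (axis k 1, axis k 1)) ` I \<inter> {(u, u), (v, v), (w \<alpha>, w (\<psi> \<alpha>))} = {}"
    using flats_ne_axis by auto
  ultimately show ?thesis unfolding flats_def by (subst card_Un_disjoint) simp_all
qed

lemma flats_nonzero: "(x, y) \<in> flats \<Longrightarrow> x \<noteq> 0 \<and> y \<noteq> 0"
proof -
  have "u $ i = 1" "v $ i = 1" "w \<beta> $ i = 1" for \<beta> using ij by (simp_all add: u_nth v_nth w_nth)
  then have "u \<noteq> 0" "v \<noteq> 0" "w \<beta> \<noteq> 0" for \<beta> by (metis zero_index zero_neq_one)+
  then show "(x, y) \<in> flats \<Longrightarrow> x \<noteq> 0 \<and> y \<noteq> 0" by (auto simp: flats_def axis_eq_0_iff)
qed

lemma flats_supported: "(x, y) \<in> flats \<Longrightarrow> k \<notin> I \<Longrightarrow> x $ k = 0"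
  using ij by (auto simp: flats_def u_nth v_nth w_nth axis_def)

text \<open>The basis points make \<open>A\<close> diagonal on \<open>I\<close>, \<open>u\<close>
  makes the entries equal, and \<open>v\<close> then gives \<sigma> \<alpha> = \<alpha>, so \<sigma>
  = id as \<alpha> generates the field. But then \<open>w \<alpha>\<close> cannot reach
  \<open>w (\<psi> \<alpha>)\<close>.\<close>

lemma flats_inequivalent:
  assumes \<sigma>: "\<sigma> \<in> frob_powers" and g: "\<forall>(x, y)\<in>flats. sends (A, \<sigma>) x y"
  shows False
proof -
  have "\<exists>c. c \<noteq> 0 \<and> (k \<in> I \<longrightarrow> A *v axis k 1 = c *s axis k 1)" for k
  proof (cases "k \<in> I")
    case True
    then have "sends (A, \<sigma>) (axis k 1) (axis k 1)" using g by (auto simp: flats_def)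
    then show ?thesis using \<sigma> by (auto simp: sends_def semilinear_map_eq)
  qed (auto intro: exI [of _ 1])
  then obtain a where a: "\<And>k. a k \<noteq> 0" "\<And>k. k \<in> I \<Longrightarrow> A *v axis k 1 = a k *s axis k 1" by metis
  have eq: "\<exists>c. \<forall>k. a k * \<sigma> (x $ k) = c * y $ k" if xy: "(x, y) \<in> flats" for x y
  proof -
    have "sends (A, \<sigma>) x y" using g xy by blast
    then obtain c where c: "A *v aut_vec \<sigma> x = c *s y"
      unfolding sends_def semilinear_map_eq by blast
    have h: "(A *v aut_vec \<sigma> x) $ k = a k * \<sigma> (x $ k)" for k
      by (subst mult_on_support [of I A a]) (use a flats_supported [OF xy] \<sigma> in auto)
    show ?thesis by (intro exI [of _ c] allI) (simp add: c flip: h)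
  qed
  obtain k where k: "k \<in> I" "k \<noteq> i" "k \<noteq> j" by (rule third)
  obtain c where c: "\<And>k. a k * \<sigma> (u $ k) = c * u $ k" using eq [of u u] by (auto simp: flats_def)
  have ac: "a l = c" if "l \<in> I" for l using c [of l] that \<sigma> by (simp add: u_nth)
  have c0: "c \<noteq> 0" using a(1) [of i] ac ij by auto
  obtain d where d: "\<And>k. a k * \<sigma> (v $ k) = d * v $ k" using eq [of v v] by (auto simp: flats_def)
  have "\<sigma> \<alpha> = \<alpha>" using d [of i] d [of k] k ij ac c0 \<sigma> by (simp add: v_nth)
  then have "\<sigma> = id" using fixes_\<alpha> \<sigma> by blast
  obtain d where "\<And>k. a k * \<sigma> (w \<alpha> $ k) = d * w (\<psi> \<alpha>) $ k"
    using eq [of "w \<alpha>" "w (\<psi> \<alpha>)"] by (auto simp: flats_def)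
  from this [of i] this [of j] have "\<psi> \<alpha> = \<alpha>"
    using ij ac c0 \<open>\<sigma> = id\<close> by (simp add: w_nth)
  then show False using \<psi>\<alpha> by blast
qed

text \<open>The homology with centre e_j that fixes the hyperplane x_i = x_j pointwise, hence
  \<open>u\<close>, \<open>v\<close> and all basis points except e_i. Its factor solves 1 - s + s
  \<alpha> = \<psi> \<alpha>, which moves \<open>w \<alpha>\<close> correctly; the form \<psi> x / x
  prepares the computation modulo cubes.\<close>

definition homology1 :: "'q ^ 'n ^ 'n" where
  "homology1 = (let s = \<psi> (\<alpha> - 1) / (\<alpha> - 1) in replace_row j (axis i (1 - s) + axis j s))"

text \<open>The same with centre e_i. Now s + (1 - s) \<alpha> = \<alpha> / \<psi> \<alpha>, as
  \<open>w (\<psi> \<alpha>)\<close> is reached up to the factor \<alpha> / \<psi> \<alpha>.\<close>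

definition homology2 :: "'q ^ 'n ^ 'n" where
  "homology2 = (let s = (\<alpha> / \<psi> \<alpha>) * (\<psi> (\<alpha> - 1) / (\<alpha> - 1)) in replace_row i (axis i s + axis j (1 - s)))"

lemma det_homology:
  "det homology1 = \<psi> (\<alpha> - 1) / (\<alpha> - 1)" "det homology2 = (\<alpha> / \<psi> \<alpha>) * (\<psi> (\<alpha> - 1) / (\<alpha> - 1))"
  using ij by (simp_all add: homology1_def homology2_def Let_def axis_def)

lemma sends_homology1:
  assumes "(x, y) \<in> flats" "x \<noteq> axis i 1"
  shows "sends (homology1, id) x y"
proof -
  define s where "s = \<psi> (\<alpha> - 1) / (\<alpha> - 1)"
  have s: "s \<noteq> 0" "s * (\<alpha> - 1) = \<psi> \<alpha> - 1" using \<psi> \<psi>\<alpha> by (simp_all add: s_def)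
  have nth: "(homology1 *v z) $ k = (if k = j then (1 - s) * z $ i + s * z $ j else z $ k)" for z k
    unfolding homology1_def Let_def s_def [symmetric] using ij by (simp add: sum_axis2)
  consider k where "k \<in> I" "k \<noteq> i" "x = axis k 1" "y = axis k 1" | "x = u" "y = u" | "x = v" "y = v"
    | "x = w \<alpha>" "y = w (\<psi> \<alpha>)" using assms by (auto simp: flats_def)
  then show ?thesis
  proof cases
    case (1 k)
    then show ?thesis using s ij by (intro sendsI [of "if k = j then s else 1"]) (auto simp: nth axis_def)
  next
    case 2
    then show ?thesis using ij by (intro sendsI [of 1]) (auto simp: nth u_nth)
  next
    case 3
    then show ?thesis using ij by (intro sendsI [of 1]) (auto simp: nth v_nth)
  next
    case 4
    have "1 - s + s * \<alpha> = \<psi> \<alpha>" using s(2) by (simp add: algebra_simps)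
    then show ?thesis using 4 ij by (intro sendsI [of 1]) (auto simp: nth w_nth)
  qed
qed

lemma sends_homology2:
  assumes "(x, y) \<in> flats" "x \<noteq> axis j 1"
  shows "sends (homology2, id) x y"
proof -
  define s where "s = (\<alpha> / \<psi> \<alpha>) * (\<psi> (\<alpha> - 1) / (\<alpha> - 1))"
  have s: "s \<noteq> 0" "s * \<psi> \<alpha> * (\<alpha> - 1) = \<alpha> * (\<psi> \<alpha> - 1)" using \<psi> \<psi>\<alpha> \<alpha>(1) by (simp_all add: s_def)
  have nth: "(homology2 *v z) $ k = (if k = i then s * z $ i + (1 - s) * z $ j else z $ k)" for z k
    unfolding homology2_def Let_def s_def [symmetric] using ij by (simp add: sum_axis2)
  consider k where "k \<in> I" "k \<noteq> j" "x = axis k 1" "y = axis k 1" | "x = u" "y = u" | "x = v" "y = v"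
    | "x = w \<alpha>" "y = w (\<psi> \<alpha>)" using assms by (auto simp: flats_def)
  then show ?thesis
  proof cases
    case (1 k)
    then show ?thesis using s ij by (intro sendsI [of "if k = i then s else 1"]) (auto simp: nth axis_def)
  next
    case 2
    then show ?thesis using ij by (intro sendsI [of 1]) (auto simp: nth u_nth)
  next
    case 3
    then show ?thesis using ij by (intro sendsI [of 1]) (auto simp: nth v_nth)
  next
    case 4
    have "(s + (1 - s) * \<alpha>) * \<psi> \<alpha> = \<alpha>" using s(2) by (simp add: algebra_simps)
    then have "s + (1 - s) * \<alpha> = \<alpha> / \<psi> \<alpha>" using \<psi>\<alpha> by (simp add: eq_divide_eq)
    then show ?thesis using 4 ij \<psi>\<alpha> \<alpha>(1)
      by (intro sendsI [of "\<alpha> / \<psi> \<alpha>"]) (auto simp: nth w_nth)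
  qed
qed

lemma semilinear_omit_basis_point:
  assumes l: "l \<in> I" "l \<noteq> i" "l \<noteq> j"
  shows "\<exists>A. invertible A \<and> (\<forall>(x, y)\<in>flats - {(axis l 1, axis l 1)}. sends (A, \<psi>) x y)"
proof -
  \<comment> \<open>Ansatz: after \<psi>, scale e_i and e_j by \<kappa>, the other basis vectors by
    \<mu>, and send e_l to \<mu> e_l + (\<mu> - \<kappa>) (e_i + e_j), so that \<open>u\<close> gets
    the factor \<mu>. Fixing \<open>v\<close> means \<mu> \<psi>(\<alpha>) = \<alpha> and \<kappa> +
    (\<mu> - \<kappa>) \<psi>(\<alpha>) = 1, which determines both constants.\<close>
  define \<mu> where "\<mu> = \<alpha> / \<psi> \<alpha>"
  define \<kappa> where "\<kappa> = (1 - \<alpha>) / (1 - \<psi> \<alpha>)"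
  define d where "d k = (if k = i \<or> k = j then \<kappa> else \<mu>)" for k
  define t where "t = (\<mu> - \<kappa>) / \<kappa>"
  have \<mu>: "\<mu> \<noteq> 0" "\<mu> * \<psi> \<alpha> = \<alpha>" and \<kappa>: "\<kappa> \<noteq> 0" "\<kappa> * (1 - \<psi> \<alpha>) = 1 - \<alpha>"
    using \<psi>\<alpha> \<alpha>(1) by (auto simp: \<mu>_def \<kappa>_def)
  have t: "\<kappa> * t = \<mu> - \<kappa>" using \<kappa>(1) by (simp add: t_def)
  define A where "A = diag d ** replace_col l (axis l 1 + axis i t + axis j t)"
  have nth: "(A *v z) $ k = (if k = i \<or> k = j then \<kappa> * z $ k + (\<mu> - \<kappa>) * z $ l else \<mu> * z $ k)" for z k
  proof -
    have "(A *v z) $ k = d k * ((if k = l then 0 else z $ k) + (axis l 1 + axis i t + axis j t :: 'q ^ 'n) $ k * z $ l)"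
      unfolding A_def by (simp flip: matrix_vector_mul_assoc)
    then show ?thesis using l ij by (auto simp: d_def axis_def algebra_simps simp flip: t)
  qed
  have "det A \<noteq> 0" using l \<mu> \<kappa> by (simp add: A_def det_mul axis_def d_def)
  moreover have "sends (A, \<psi>) x y" if xy: "(x, y) \<in> flats - {(axis l 1, axis l 1)}" for x y
  proof -
    consider k where "k \<in> I" "k \<noteq> l" "x = axis k 1" "y = axis k 1" | "x = u" "y = u" | "x = v" "y = v"
      | "x = w \<alpha>" "y = w (\<psi> \<alpha>)" using xy by (auto simp: flats_def)
    then show ?thesis
    proof cases
      case (1 k)
      then show ?thesis using \<mu> \<kappa> ij l \<psi>
        by (intro sendsI [of "if k = i \<or> k = j then \<kappa> else \<mu>"]) (auto simp: nth axis_def)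
    next
      case 2
      then show ?thesis using \<mu>(1) ij l \<psi> by (intro sendsI [of \<mu>]) (auto simp: nth u_nth)
    next
      case 3
      have "\<kappa> + (\<mu> - \<kappa>) * \<psi> \<alpha> = 1" using \<mu>(2) \<kappa>(2) by (simp add: algebra_simps)
      then show ?thesis using 3 \<mu>(2) ij l \<psi> by (intro sendsI [of 1]) (auto simp: nth v_nth)
    next
      case 4
      then show ?thesis using \<kappa>(1) ij l \<psi> by (intro sendsI [of \<kappa>]) (auto simp: nth w_nth)
    qed
  qed
  ultimately show ?thesis by (intro exI [of _ A]) (auto simp: invertible_det_nz)
qed

lemma semilinear_omit_point:
  assumes z: "z \<in> flats"
  shows "\<exists>A \<tau>. invertible A \<and> \<tau> \<in> {id, \<psi>} \<and> (\<forall>(x, y)\<in>flats - {z}. sends (A, \<tau>) x y)"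
proof -
  have inv1: "invertible (mat 1 :: 'q ^ 'n ^ 'n)" by (simp add: invertible_det_nz)
  consider "z = (axis i 1, axis i 1)" | "z = (axis j 1, axis j 1)"
    | l where "l \<in> I" "l \<noteq> i" "l \<noteq> j" "z = (axis l 1, axis l 1)"
    | "z = (u, u)" | "z = (v, v)" | "z = (w \<alpha>, w (\<psi> \<alpha>))"
    using z unfolding flats_def by blast
  then show ?thesis
  proof cases
    case 1
    have "det homology1 \<noteq> 0" using \<psi> \<psi>\<alpha> by (simp add: det_homology)
    moreover have "sends (homology1, id) x y" if xy: "(x, y) \<in> flats - {z}" for x y
      using xy 1 flats_axisD [of i y] by (intro sends_homology1) auto
    ultimately show ?thesis by (intro exI [of _ homology1] exI [of _ id]) (auto simp: invertible_det_nz)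
  next
    case 2
    have "det homology2 \<noteq> 0" using \<psi> \<psi>\<alpha> \<alpha>(1) by (simp add: det_homology)
    moreover have "sends (homology2, id) x y" if xy: "(x, y) \<in> flats - {z}" for x y
      using xy 2 flats_axisD [of j y] by (intro sends_homology2) auto
    ultimately show ?thesis by (intro exI [of _ homology2] exI [of _ id]) (auto simp: invertible_det_nz)
  next
    case (3 l)
    then show ?thesis using semilinear_omit_basis_point by blast
  next
    case 4
    \<comment> \<open>Without \<open>u\<close> the diagonal entries off \<open>i\<close> and
      \<open>j\<close> are free to undo the effect of \<psi> on \<open>v\<close>.\<close>
    define d where "d k = (if k = i \<or> k = j then 1 else \<alpha> / \<psi> \<alpha>)" for k
    have d0: "d k \<noteq> 0" for k using \<alpha>(1) \<psi>\<alpha> by (simp add: d_def)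
    have "sends (diag d, \<psi>) x y" if xy: "(x, y) \<in> flats - {z}" for x y
    proof -
      consider k where "x = axis k 1" "y = axis k 1" | "x = v" "y = v"
        | "x = w \<alpha>" "y = w (\<psi> \<alpha>)" using xy 4 by (auto simp: flats_def)
      then show ?thesis
      proof cases
        case (1 k)
        then show ?thesis using d0 \<psi> by (intro sendsI [of "d k"]) (auto simp: axis_def)
      next
        case 2
        then show ?thesis using \<psi> \<psi>\<alpha> ij by (intro sendsI [of 1]) (auto simp: v_nth d_def)
      next
        case 3
        then show ?thesis using \<psi> ij by (intro sendsI [of 1]) (auto simp: w_nth d_def)
      qed
    qed
    moreover have "invertible (diag d)" using d0 by (simp add: invertible_det_nz)
    ultimately show ?thesis by (intro exI [of _ "diag d"] exI [of _ \<psi>]) auto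
  next
    case 5
    \<comment> \<open>Without \<open>v\<close>, applying \<psi> to the coordinates suffices: apart
      from those of \<open>w \<alpha>\<close> they are all 0 or 1.\<close>
    have "sends (mat 1, \<psi>) x y" if "(x, y) \<in> flats - {z}" for x y
      using that 5 \<psi> ij by (intro sendsI [of 1]) (auto simp: flats_def axis_def u_nth w_nth)
    then show ?thesis using inv1 by blast
  next
    case 6
    have "sends (mat 1, id) x y" if "(x, y) \<in> flats - {z}" for x y
      using that 6 by (intro sendsI [of 1]) (auto simp: flats_def)
    then show ?thesis using inv1 by blast
  qed
qed

text \<open>
  The two homologies have determinant \<open>\<psi> x / x\<close> up to cubes. Four points including all three
  on the first line leave only one further point, whose scaling can adjust the determinant.
\<close>

lemma special_linear_four_points:
  assumes UNIV: "CARD('n) = 3" "I = UNIV"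
    and cubes: "\<And>x. x \<noteq> 0 \<Longrightarrow> \<exists>t. t \<noteq> 0 \<and> \<psi> x = t ^ 3 * x"
    and F: "F \<subseteq> flats" "card F = 4"
  shows "\<exists>A t. t \<noteq> 0 \<and> det A = t ^ 3 \<and> (\<forall>(x, y)\<in>F. sends (A, id) x y)"
proof -
  let ?w = "(w \<alpha>, w (\<psi> \<alpha>))" and ?i = "(axis i 1, axis i 1) :: ('q ^ 'n) \<times> ('q ^ 'n)"
    and ?j = "(axis j 1, axis j 1) :: ('q ^ 'n) \<times> ('q ^ 'n)"
  obtain r where r: "r \<noteq> 0" "\<psi> (\<alpha> - 1) = r ^ 3 * (\<alpha> - 1)" using cubes [of "\<alpha> - 1"] \<psi>\<alpha> by auto
  obtain s where s: "s \<noteq> 0" "\<psi> \<alpha> = s ^ 3 * \<alpha>" using cubes [of \<alpha>] \<alpha>(1) by auto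
  consider "?w \<notin> F" | "?i \<notin> F" | "?j \<notin> F" | "?w \<in> F" "?i \<in> F" "?j \<in> F" by blast
  then show ?thesis
  proof cases
    case 1
    have "sends (mat 1, id) x y" if xy: "(x, y) \<in> F" for x y
      using xy 1 F(1) by (intro sendsI [of 1]) (auto simp: flats_def)
    then show ?thesis by (intro exI [of _ "mat 1"] exI [of _ 1]) auto
  next
    case 2
    have "sends (homology1, id) x y" if xy: "(x, y) \<in> F" for x y
      using xy 2 F(1) flats_axisD [of i y] by (intro sends_homology1) auto
    moreover have "det homology1 = r ^ 3" using r \<psi>\<alpha> by (simp add: det_homology)
    ultimately show ?thesis using r by (intro exI [of _ homology1] exI [of _ r]) auto
  next
    case 3
    have "sends (homology2, id) x y" if xy: "(x, y) \<in> F" for x y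
      using xy 3 F(1) flats_axisD [of j y] by (intro sends_homology2) auto
    moreover have "det homology2 = (r / s) ^ 3" using r s \<psi>\<alpha> \<alpha>(1)
      unfolding det_homology by (simp add: power_divide)
    ultimately show ?thesis using r s by (intro exI [of _ homology2] exI [of _ "r / s"]) auto
  next
    case 4
    obtain k where kI: "k \<in> I" and k: "k \<noteq> i" "k \<noteq> j" using third by metis
    have "card {i, j, k} = CARD('n)" using k ij UNIV by simp
    then have ijk: "UNIV = {i, j, k}" using card_seteq [of UNIV "{i, j, k}"] by simp
    have neq: "?w \<noteq> ?i" "?w \<noteq> ?j" "?i \<noteq> ?j" using flats_ne_axis ij by (auto simp: axis_eq_axis)
    then have "card (F - {?w, ?i, ?j}) = 1"
      using F(2) 4 by (subst card_Diff_subset) simp_all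
    then obtain z where z: "F - {?w, ?i, ?j} = {z}" by (auto simp: card_1_singleton_iff)
    then have "z \<in> flats" "z \<notin> {?w, ?i, ?j}" using F(1) by auto
    then obtain l where "z = (axis l 1, axis l 1) \<and> l \<noteq> i \<and> l \<noteq> j \<or> z = (u, u) \<or> z = (v, v)"
      unfolding flats_def by blast
    moreover have "l = i \<or> l = j \<or> l = k" using ijk by blast
    moreover have "u $ k \<noteq> 0" "v $ k \<noteq> 0" using k kI \<alpha>(1) by (simp_all add: u_nth v_nth)
    ultimately obtain p where p: "z = (p, p)" "p $ k \<noteq> 0" by auto
    have F_eq: "F = {?w, ?i, ?j, (p, p)}" using z 4 p by blast
    \<comment> \<open>In the basis e_i, e_j, p the map is diagonal with entries 1, \<delta>, 1 /
      \<delta>: the first two move \<open>w \<alpha>\<close> correctly, the third is free since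
      \<open>p\<close> lies off the line and makes the determinant 1. Column k of this matrix is
      \<open>g\<close> times 1 / \<delta>.\<close>
    define \<delta> where "\<delta> = \<psi> \<alpha> / \<alpha>"
    have \<delta>: "\<delta> \<noteq> 0" "\<delta> * \<alpha> = \<psi> \<alpha>" using \<psi>\<alpha> \<alpha>(1) by (simp_all add: \<delta>_def)
    define d where "d l = (if l = j then \<delta> else if l = k then 1 / \<delta> else 1)" for l
    define g where "g = (axis k 1 + axis i ((1 - \<delta>) * p $ i / p $ k) +
      axis j ((1 - \<delta> * \<delta>) * p $ j / p $ k) :: 'q ^ 'n)"
    define A where "A = replace_col k g ** diag d"
    have nth: "(A *v x) $ l = (if l = k then 0 else d l * x $ l) + g $ l * (1 / \<delta> * x $ k)" for x l
      using k unfolding A_def by (simp flip: matrix_vector_mul_assoc) (simp add: d_def)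
    have g: "g $ k = 1" "g $ i = (1 - \<delta>) * p $ i / p $ k" "g $ j = (1 - \<delta> * \<delta>) * p $ j / p $ k"
      using k ij by (simp_all add: g_def axis_def)
    have "prod d UNIV = 1" unfolding ijk using k ij \<delta> by (simp add: d_def)
    then have "det A = 1 ^ 3" using g by (simp add: A_def det_mul)
    moreover have "sends (A, id) (w \<alpha>) (w (\<psi> \<alpha>))"
      using k \<delta> ij by (intro sendsI [of 1]) (auto simp: nth w_nth d_def)
    moreover have "sends (A, id) (axis i 1) (axis i 1)"
      using k ij by (intro sendsI [of 1]) (auto simp: nth axis_def d_def)
    moreover have "sends (A, id) (axis j 1) (axis j 1)"
      using k ij \<delta> by (intro sendsI [of \<delta>]) (auto simp: nth axis_def d_def)
    moreover have "sends (A, id) p p"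
    proof (rule sendsI)
      show "1 / \<delta> \<noteq> 0" using \<delta> by simp
      fix l
      have "l = i \<or> l = j \<or> l = k" using ijk by blast
      then show "(A *v aut_vec id p) $ l = 1 / \<delta> * p $ l"
        using k ij \<delta>(1) p(2) by (elim disjE) (simp_all add: nth g d_def field_simps)
    qed
    ultimately show ?thesis unfolding F_eq by (intro exI [of _ A] exI [of _ 1]) auto
  qed
qed

end

section \<open>Bounds in dimension at least 3 from flats and determinants\<close>

lemma obtain_outside:
  assumes "finite B" "card B < card A"
  obtains x where "x \<in> A" "x \<notin> B"
proof -
  have "\<not> A \<subseteq> B" using card_mono [of B A] assms by auto
  then show thesis using that by blast
qed

context semilinear_group
begin

text \<open>Points of the configuration have no coordinates outside \<open>I\<close>, so a matching
  map may be altered there until it lies in \<open>R\<close>; this is what \<open>ext\<close>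
  provides, both for \<open>I = UNIV\<close> and for a hyperplane.\<close>

lemma rc_ge_two_flats:
  fixes \<alpha> :: 'q and I :: "'n set"
  assumes "two_flats I i j \<alpha> \<psi>" "CARD('n) \<ge> 2"
    and ext: "\<And>A \<tau>. invertible A \<Longrightarrow> \<tau> \<in> {id, \<psi>} \<Longrightarrow>
      \<exists>A'. (A', \<tau>) \<in> R \<and> (\<forall>x. (\<forall>k. k \<notin> I \<longrightarrow> x $ k = 0) \<longrightarrow> A' *v x = A *v x)"
  shows "card I + 3 \<le> rc R"
proof -
  interpret two_flats I i j \<alpha> \<psi> by fact
  have "card flats \<le> rc R"
  proof (rule rc_ge_card [OF assms(2) finite_flats])
    show "flats \<noteq> {}" by (simp add: flats_def)
    show "x \<noteq> 0 \<and> y \<noteq> 0" if "(x, y) \<in> flats" for x y using flats_nonzero that .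
  next
    fix z assume "z \<in> flats"
    then obtain A \<tau> where A: "invertible A" "\<tau> \<in> {id, \<psi>}" "\<forall>(x, y)\<in>flats - {z}. sends (A, \<tau>) x y"
      using semilinear_omit_point by blast
    obtain A' where A': "(A', \<tau>) \<in> R" "\<forall>x. (\<forall>k. k \<notin> I \<longrightarrow> x $ k = 0) \<longrightarrow> A' *v x = A *v x"
      using ext [OF A(1,2)] by blast
    have "sends (A', \<tau>) x y" if xy: "(x, y) \<in> flats - {z}" for x y
    proof -
      have "\<tau> 0 = 0" using A(2) \<psi> by auto
      then have "\<forall>k. k \<notin> I \<longrightarrow> aut_vec \<tau> x $ k = 0" using flats_supported [of x y] xy by simp
      then have "A' *v aut_vec \<tau> x = A *v aut_vec \<tau> x" using A'(2) by blast
      moreover have "sends (A, \<tau>) x y" using A(3) xy by blast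
      ultimately show ?thesis by (simp add: sends_def semilinear_map_eq)
    qed
    then show "\<exists>g\<in>R. \<forall>(x, y)\<in>flats - {z}. sends g x y" using A'(1) by blast
  next
    show "\<not> (\<exists>g\<in>R. \<forall>(x, y)\<in>flats. sends g x y)"
      using flats_inequivalent R_carrier by (metis surj_pair)
  qed
  then show ?thesis by (simp add: card_flats)
qed

text \<open>With GL in \<open>R\<close>, products with \<open>(A0, \<psi>)\<close> realise every
  invertible matrix together with \<psi>, so the flats may use all coordinates.\<close>

lemma rc_ge_if_general_linear:
  assumes n: "CARD('n) \<ge> 3" and GL: "\<And>A. invertible A \<Longrightarrow> (A, id) \<in> R"
    and \<psi>: "(A0, \<psi>) \<in> R" "\<psi> \<noteq> id"
  shows "CARD('n) + 3 \<le> rc R"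
proof -
  obtain \<gamma> :: 'q where \<gamma>: "\<gamma> \<noteq> 0" "\<And>x. x \<noteq> 0 \<Longrightarrow> \<exists>k. x = \<gamma> ^ k" using finite_field_generator by blast
  have "\<exists>i j :: 'n. i \<noteq> j"
  proof (rule ccontr)
    assume "\<not> ?thesis"
    then have "card (UNIV :: 'n set) \<le> Suc 0" by (subst card_le_Suc0_iff_eq) auto
    then show False using n by simp
  qed
  then obtain i j :: 'n where "i \<noteq> j" by blast
  have \<psi>_aut: "invertible A0" "\<psi> \<in> frob_powers" using R_carrier \<psi> by blast+
  have "two_flats UNIV i j \<gamma> \<psi>"
    using \<open>i \<noteq> j\<close> n \<gamma> \<psi> \<psi>_aut by unfold_locales auto
  then have "card (UNIV :: 'n set) + 3 \<le> rc R"
  proof (rule rc_ge_two_flats)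
    fix A :: "'q ^ 'n ^ 'n" and \<tau> :: "'q \<Rightarrow> 'q" assume A: "invertible A" "\<tau> \<in> {id, \<psi>}"
    obtain B where B: "B ** A0 = mat 1" "invertible B" using \<psi>_aut(1) unfolding invertible_def by metis
    have "((A ** B) ** map_matrix id A0, id \<circ> \<psi>) \<in> R"
      using R_mult [OF GL \<psi>(1)] A(1) B(2) invertible_mult by blast
    then have "(A, \<psi>) \<in> R" using B by (simp flip: matrix_mul_assoc)
    then show "\<exists>A'. (A', \<tau>) \<in> R \<and> (\<forall>x. (\<forall>k. k \<notin> UNIV \<longrightarrow> x $ k = 0) \<longrightarrow> A' *v x = A *v x)"
      using A GL by blast
  qed (use n in simp)
  then show ?thesis .
qed

text \<open>On a hyperplane the determinant imposes no condition.\<close>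

lemma rc_ge_if_dim_ge_4:
  assumes n: "CARD('n) \<ge> 4" and \<psi>: "(A0, \<psi>) \<in> R" "\<psi> \<noteq> id"
  shows "CARD('n) + 2 \<le> rc R"
proof -
  obtain \<gamma> :: 'q where \<gamma>: "\<gamma> \<noteq> 0" "\<And>x. x \<noteq> 0 \<Longrightarrow> \<exists>k. x = \<gamma> ^ k" using finite_field_generator by blast
  fix k0 :: 'n
  let ?I = "UNIV - {k0}"
  have card_I: "card ?I = CARD('n) - 1" by simp
  obtain i where i: "i \<in> ?I" by (rule obtain_outside [of "{}" ?I]) (use card_I n in simp_all)
  obtain j where j: "j \<in> ?I" "i \<noteq> j" by (rule obtain_outside [of "{i}" ?I]) (use card_I n in auto)
  have \<psi>_aut: "\<psi> \<in> frob_powers" using R_carrier \<psi> by blast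
  \<comment> \<open>Here n \<ge> 4 enters: the hyperplane must offer three coordinates.\<close>
  have "two_flats ?I i j \<gamma> \<psi>"
    using i j n \<gamma> \<psi> \<psi>_aut by unfold_locales auto
  then have "card ?I + 3 \<le> rc R"
  proof (rule rc_ge_two_flats)
    fix A :: "'q ^ 'n ^ 'n" and \<tau> :: "'q \<Rightarrow> 'q" assume A: "invertible A" "\<tau> \<in> {id, \<psi>}"
    obtain B where B: "(B, \<tau>) \<in> R" using A(2) R_one \<psi>(1) by auto
    have det: "det A \<noteq> 0" "det B \<noteq> 0" using A(1) R_carrier [OF B] by (simp_all add: invertible_det_nz)
    \<comment> \<open>The entry at \<open>k0\<close> is invisible on the hyperplane and brings the
      determinant to that of \<open>B\<close>, an element of \<open>R\<close> with the wanted
      automorphism.\<close>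
    define A' where "A' = A ** diag (\<lambda>k. if k = k0 then det B / det A else 1)"
    have "det A' = 1 ^ CARD('n) * det B" using det by (simp add: A'_def det_mul prod.delta')
    then have "(A', \<tau>) \<in> R" using R_same_det [OF B, of A' 1] by simp
    moreover have "A' *v x = A *v x" if "\<forall>k. k \<notin> ?I \<longrightarrow> x $ k = 0" for x
    proof -
      have "diag (\<lambda>k. if k = k0 then det B / det A else 1) *v x = x"
        using that by (auto simp: vec_eq_iff)
      then show ?thesis by (simp add: A'_def flip: matrix_vector_mul_assoc)
    qed
    ultimately show "\<exists>A'. (A', \<tau>) \<in> R \<and> (\<forall>x. (\<forall>k. k \<notin> ?I \<longrightarrow> x $ k = 0) \<longrightarrow> A' *v x = A *v x)"
      by blast
  qed (use n in simp)
  then show ?thesis using n card_I by simp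
qed

text \<open>\<psi> only serves to build the two tuples. Four of the six pairs are always matched by
  a linear map with cube determinant, which lies in \<open>R\<close> whatever automorphisms
  \<open>R\<close> contains.\<close>

lemma rc_ge_5_if_trivial_mod_cubes:
  fixes \<psi> :: "'q \<Rightarrow> 'q"
  assumes n: "CARD('n) = 3" and \<psi>: "\<psi> \<in> frob_powers" "\<psi> \<noteq> id"
    and cubes: "\<And>x. x \<noteq> 0 \<Longrightarrow> \<exists>t. t \<noteq> 0 \<and> \<psi> x = t ^ 3 * x"
  shows "5 \<le> rc R"
proof -
  obtain \<gamma> :: 'q where \<gamma>: "\<gamma> \<noteq> 0" "\<And>x. x \<noteq> 0 \<Longrightarrow> \<exists>k. x = \<gamma> ^ k" using finite_field_generator by blast
  fix i :: 'n
  obtain j where j: "j \<noteq> i" by (rule obtain_outside [of "{i}" "UNIV :: 'n set"]) (use n in auto)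
  interpret two_flats UNIV i j \<gamma> \<psi>
    using j n \<gamma> \<psi> by unfold_locales (auto simp: eq_commute [of i j])
  have "4 < rc R"
  proof (rule rc_gt [OF _ finite_flats _ flats_nonzero])
    fix F assume "F \<subseteq> flats" "card F = 4"
    then obtain A t where "t \<noteq> 0" "det A = t ^ 3" "\<forall>(x, y)\<in>F. sends (A, id) x y"
      using special_linear_four_points [OF n refl cubes] by blast
    then show "\<exists>g\<in>R. \<forall>(x, y)\<in>F. sends g x y" using R_nth_power_det [of A t] n by auto
  next
    show "\<not> (\<exists>g\<in>R. \<forall>(x, y)\<in>flats. sends g x y)"
      using flats_inequivalent R_carrier by (metis surj_pair)
  qed (use n card_flats in auto)
  then show ?thesis by simp
qed

text \<open>
  The vectors \<open>axis k 1\<close> and \<open>axis k 1 + axis z 1\<close> for \<open>k \<noteq> z\<close> are connected, but omitting any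
  one of them splits off a point; then its multiplicity can be used to adjust the determinant.
\<close>

lemma rc_ge_if_dets_powers:
  assumes n: "CARD('n) \<ge> 3"
    and dets: "\<And>A \<sigma>. (A, \<sigma>) \<in> R \<Longrightarrow> \<exists>t. t \<noteq> 0 \<and> det A = t ^ CARD('n)"
    and \<mu>: "\<mu> \<noteq> (0 :: 'q)" "\<And>t. \<mu> \<noteq> t ^ CARD('n)"
  shows "2 * CARD('n) - 2 \<le> rc R"
proof -
  fix z :: 'n
  let ?I = "UNIV - {z}"
  let ?e = "\<lambda>k. axis k 1 :: 'q ^ 'n"
  define f where "f c k = axis k 1 + axis z c" for c :: 'q and k :: 'n
  \<comment> \<open>The targets are the images of the sources under the diagonal matrix with entry
    \<mu> at \<open>z\<close>, whose determinant is not an n-th power.\<close>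
  define Q where "Q = (\<lambda>k. (?e k, ?e k)) ` ?I \<union> (\<lambda>k. (f 1 k, f \<mu> k)) ` ?I"
  have f_nth: "f c k $ l = (if l = k then 1 else if l = z then c else 0)" if "k \<noteq> z" for c k l
    using that by (auto simp: f_def axis_def)
  have e_ne_f: "?e k \<noteq> f 1 l" if "k \<noteq> z" "l \<noteq> z" for k l
    using that f_nth [of l 1 z] by (auto simp: axis_def vec_eq_iff)
  have "inj_on (\<lambda>k. (?e k, ?e k)) ?I" by (rule inj_onI) (simp add: axis_eq_axis)
  moreover have "inj_on (\<lambda>k. (f 1 k, f \<mu> k)) ?I" by (rule inj_onI) (simp add: f_def axis_eq_axis)
  moreover have "(\<lambda>k. (?e k, ?e k)) ` ?I \<inter> (\<lambda>k. (f 1 k, f \<mu> k)) ` ?I = {}" using e_ne_f by auto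
  ultimately have card_Q: "card Q = 2 * CARD('n) - 2"
    unfolding Q_def by (subst card_Un_disjoint) (simp_all add: card_image)
  have SL: "(A, id) \<in> R" if "det A = 1" for A using R_SL that .
  have "card Q \<le> rc R"
  proof (rule rc_ge_card)
    show "finite Q" by (simp add: Q_def)
    show "Q \<noteq> {}" using card_Q n by auto
    show "x \<noteq> 0 \<and> y \<noteq> 0" if "(x, y) \<in> Q" for x y
    proof -
      have "f c k \<noteq> 0" if "k \<noteq> z" for c k using f_nth [OF that, of c k] by auto
      then show ?thesis using that by (auto simp: Q_def axis_eq_0_iff)
    qed
  next
    fix q assume "q \<in> Q"
    then obtain k where k: "k \<noteq> z" "q = (?e k, ?e k) \<or> q = (f 1 k, f \<mu> k)" by (auto simp: Q_def)
    \<comment> \<open>The factor \<mu> at \<open>z\<close> is compensated by 1 / \<mu> at the point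
      that splits off: e_k if the pair of f_k is omitted, and f_k if that of e_k is omitted.\<close>
    define d where "d l = (if l = z then \<mu> else if l = k then 1 / \<mu> else 1)" for l
    have "prod d UNIV = d z * (d k * prod d (UNIV - {z} - {k}))"
      using k(1) by (simp add: prod.remove [of UNIV z] prod.remove [of "UNIV - {z}" k])
    also have "prod d (UNIV - {z} - {k}) = 1" by (intro prod.neutral) (auto simp: d_def)
    finally have det_d: "prod d UNIV = 1" using \<mu>(1) k(1) by (simp add: d_def)
    show "\<exists>g\<in>R. \<forall>(x, y)\<in>Q - {q}. sends g x y"
    proof (cases "q = (?e k, ?e k)")
      case True
      define A where "A = diag d ** replace_row z (axis k ((1 - \<mu>) / \<mu>) + axis z 1)"
      have nth: "(A *v x) $ l = d l * (if l = z then (1 - \<mu>) / \<mu> * x $ k + x $ z else x $ l)" for x l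
        unfolding A_def using k(1) by (simp add: sum_axis2 flip: matrix_vector_mul_assoc)
      have "det A = 1" using k(1) by (simp add: A_def det_mul det_d) (simp add: axis_def)
      moreover have "sends (A, id) x y" if xy: "(x, y) \<in> Q - {q}" for x y
      proof -
        consider l where "l \<noteq> z" "l \<noteq> k" "x = ?e l" "y = ?e l" | l where "l \<noteq> z" "x = f 1 l" "y = f \<mu> l"
          using xy True by (auto simp: Q_def)
        then show ?thesis
        proof cases
          case (1 l)
          then show ?thesis using k \<mu> by (intro sendsI [of 1]) (auto simp: nth axis_def d_def)
        next
          case (2 l)
          then show ?thesis using k \<mu>
            by (intro sendsI [of "d l"]) (auto simp: nth f_nth d_def field_simps)
        qed
      qed
      ultimately show ?thesis using SL by blast
    next
      case False
      then have q: "q = (f 1 k, f \<mu> k)" using k by blast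
      have "sends (diag d, id) x y" if xy: "(x, y) \<in> Q - {q}" for x y
      proof -
        consider l where "l \<noteq> z" "x = ?e l" "y = ?e l" | l where "l \<noteq> z" "l \<noteq> k" "x = f 1 l" "y = f \<mu> l"
          using xy q by (auto simp: Q_def)
        then show ?thesis
        proof cases
          case (1 l)
          then show ?thesis using k \<mu> by (intro sendsI [of "d l"]) (auto simp: axis_def d_def)
        next
          case (2 l)
          then show ?thesis using k \<mu> by (intro sendsI [of 1]) (auto simp: f_nth d_def)
        qed
      qed
      moreover have "(diag d, id) \<in> R" using SL det_d by simp
      ultimately show ?thesis by blast
    qed
  next
    show "\<not> (\<exists>g\<in>R. \<forall>(x, y)\<in>Q. sends g x y)"
    proof
      assume "\<exists>g\<in>R. \<forall>(x, y)\<in>Q. sends g x y"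
      then obtain A \<sigma> where A: "(A, \<sigma>) \<in> R" "\<And>x y. (x, y) \<in> Q \<Longrightarrow> sends (A, \<sigma>) x y" by fast
      have \<sigma>: "\<sigma> \<in> frob_powers" using R_carrier A(1) by blast
      have "\<exists>c. c \<noteq> 0 \<and> A *v ?e k = c *s ?e k" if "k \<noteq> z" for k
        using A(2) [of "?e k" "?e k"] that \<sigma> by (auto simp: Q_def sends_def semilinear_map_eq)
      then obtain a where a: "\<And>k. k \<noteq> z \<Longrightarrow> a k \<noteq> 0" "\<And>k. k \<noteq> z \<Longrightarrow> A *v ?e k = a k *s ?e k" by metis
      have "\<exists>c. c \<noteq> 0 \<and> A *v f 1 k = c *s f \<mu> k" if "k \<noteq> z" for k
        using A(2) [of "f 1 k" "f \<mu> k"] that \<sigma> by (auto simp: Q_def sends_def semilinear_map_eq f_def)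
      then obtain c where c: "\<And>k. k \<noteq> z \<Longrightarrow> A *v f 1 k = c k *s f \<mu> k" by metis
      define g where "g = A *v ?e z"
      have g: "g $ l = c k * f \<mu> k $ l - a k * ?e k $ l" if "k \<noteq> z" for k l
      proof -
        have "g = A *v f 1 k - A *v ?e k" unfolding g_def f_def by (simp add: matrix_vector_right_distrib)
        then show ?thesis using a(2) [OF that] c [OF that] by simp
      qed
      \<comment> \<open>For every k \<noteq> z, \<open>g\<close> lies in the span of e_k and e_z;
        two such planes meet only in multiples of e_z.\<close>
      have gk: "g $ k = 0" if "k \<noteq> z" for k
      proof -
        obtain l where "l \<noteq> z" "l \<noteq> k"
          by (rule obtain_outside [of "{z, k}" "UNIV :: 'n set"]) (use n in \<open>auto simp: card_insert_if\<close>)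
        then show ?thesis using g [of l k] that by (simp add: f_nth axis_def)
      qed
      have ac: "a k = g $ z / \<mu>" if "k \<noteq> z" for k
        using g [OF that, of k] g [OF that, of z] gk [OF that] that \<mu>(1) by (simp add: f_nth axis_def)
      have g_eq: "g = axis z (g $ z)" using gk by (auto simp: vec_eq_iff axis_def)
      define b where "b k = (if k = z then g $ z else g $ z / \<mu>)" for k
      have "A *v ?e k = b k *s ?e k" for k
      proof (cases "k = z")
        case True
        then have "A *v ?e k = axis z (g $ z)" using g_eq by (simp only: g_def)
        then show ?thesis using True by (simp add: b_def vec_eq_iff axis_def)
      qed (simp add: a(2) ac b_def)
      then have "A *v x = diag b *v x" for x
        using mult_on_support [of UNIV A b x] by (simp add: vec_eq_iff)
      then have "A = diag b" by (simp add: matrix_eq)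
      moreover have "prod b UNIV = g $ z * (g $ z / \<mu>) ^ (CARD('n) - 1)"
        by (simp add: prod.remove [of UNIV z] b_def prod.If_cases card_Diff_singleton Compl_eq_Diff_UNIV)
      \<comment> \<open>All eigenvalues off \<open>z\<close> agree because each is determined by the
        same \<open>g\<close>; so the determinant is \<mu> times an n-th power.\<close>
      ultimately have "det A = (g $ z / \<mu>) ^ CARD('n) * \<mu>"
        using \<mu>(1) n by (cases "CARD('n)") simp_all
      then obtain t where t: "t \<noteq> 0" "(g $ z / \<mu>) ^ CARD('n) * \<mu> = t ^ CARD('n)" using dets A(1) by force
      then have "g $ z / \<mu> \<noteq> 0" using n by (auto simp: power_0_left)
      then have "\<mu> = (t / (g $ z / \<mu>)) ^ CARD('n)" using t(2) by (simp add: power_divide field_simps)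
      then show False using \<mu>(2) by blast
    qed
  qed (use n in simp)
  then show ?thesis using card_Q by simp
qed

end

section \<open>Five points of a projective plane and four points of a projective line\<close>

context semilinear_group
begin

text \<open>
  The frame together with the point \<open>(1, \<omega>, \<omega>\<^sup>2)\<close>. Any four of the five points are fixed by
  a semilinear map with matrix of determinant \<open>1\<close> inducing the Frobenius automorphism.
\<close>

lemma rc_ge_5_if_Frobenius_inverts_cubes:
  assumes n: "CARD('n) = 3" and frob2: "frob \<circ> frob = (id :: 'q \<Rightarrow> 'q)"
    and \<omega>: "1 + \<omega> + \<omega> * \<omega> = (0 :: 'q)" "frob \<omega> = \<omega> * \<omega>" "\<omega> * \<omega> \<noteq> \<omega>"
    and A0: "(A0, frob) \<in> R"
    and a: "a \<noteq> 0" "\<And>t. det A0 * frob a / a \<noteq> t ^ 3"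
    and cubes: "\<And>C. (C, id) \<in> R \<Longrightarrow> \<exists>t. det C = t ^ 3"
  shows "5 \<le> rc R"
proof -
  fix i :: 'n
  obtain j where j: "j \<noteq> i" by (rule obtain_outside [of "{i}" "UNIV :: 'n set"]) (use n in auto)
  obtain k where k: "k \<noteq> i" "k \<noteq> j"
    by (rule obtain_outside [of "{i, j}" "UNIV :: 'n set"]) (use n j in auto)
  have "card {i, j, k} = CARD('n)" using k j n by simp
  then have ijk: "UNIV = {i, j, k}" using card_seteq [of UNIV "{i, j, k}"] by simp
  have "\<omega> * \<omega> = (1 + \<omega> + \<omega> * \<omega>) - 1 - \<omega>" by simp
  then have \<omega>2: "\<omega> * \<omega> = - 1 - \<omega>" by (simp only: \<omega>(1) diff_0)
  have "\<omega> * \<omega> * \<omega> = - \<omega> - \<omega> * \<omega>" by (simp only: \<omega>2 left_diff_distrib mult_minus_left mult_1_left)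
  then have \<omega>3: "\<omega> * \<omega> * \<omega> = 1" by (simp add: \<omega>2)
  have \<omega>01: "\<omega> \<noteq> 0" "\<omega> \<noteq> 1" using \<omega>3 \<omega>(3) by auto
  define u :: "'q ^ 'n" where "u = (\<chi> l. 1)"
  define v :: "'q ^ 'n" where "v = (\<chi> l. if l = i then 1 else if l = j then \<omega> else \<omega> * \<omega>)"
  define X where "X = range (\<lambda>l. axis l 1) \<union> {u, v}"
  have v_nth: "v $ i = 1" "v $ j = \<omega>" "v $ k = \<omega> * \<omega>" using j k by (simp_all add: v_def)
  have X_eq: "X = {axis i 1, axis j 1, axis k 1, u, v}" by (auto simp: X_def ijk)
  have "u \<noteq> axis l 1" "v \<noteq> axis l 1" for l
  proof -
    obtain m where "m \<noteq> l" by (rule obtain_outside [of "{l}" "UNIV :: 'n set"]) (use n in auto)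
    then have "axis l 1 $ m = (0 :: 'q)" "u $ m \<noteq> 0" "v $ m \<noteq> 0"
      using \<omega>01 by (simp_all add: axis_def u_def v_def)
    then show "u \<noteq> axis l 1" "v \<noteq> axis l 1" by metis+
  qed
  moreover have "u \<noteq> v" using v_nth(2) \<omega>01 by (auto simp: u_def)
  ultimately have card_X: "card X = 5" using j k by (auto simp: X_eq axis_eq_axis card_insert_if)
  have omit: "\<exists>N. det N = 1 \<and> (\<forall>x\<in>X - {z}. sends (N, frob) x x)" if z: "z \<in> X" for z
  proof -
    \<comment> \<open>Rotating the coordinates of (1, \<omega>, \<omega>^2) multiplies it by a power
      of \<omega>, so one computation for cyclically ordered indices treats all three basis
      points.\<close>
    have omit_axis: ?thesis
      if z: "z = axis l 1" and lmo: "UNIV = {l, m, k'}" "l \<noteq> m" "l \<noteq> k'" "m \<noteq> k'"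
        and v: "v $ l \<noteq> 0" "v $ m = \<omega> * v $ l" "v $ k' = \<omega> * \<omega> * v $ l" for l m k'
    proof -
      \<comment> \<open>The factors -\<omega> and -\<omega>^2 have product 1, and e_l goes to e_l -
        \<omega>^2 e_m - \<omega> e_k'. Then \<open>u\<close> is fixed by 1 + \<omega> + \<omega>^2
        = 0.\<close>
      define d where "d r = (if r = m then - \<omega> else if r = k' then - (\<omega> * \<omega>) else 1)" for r
      define g where "g = (axis l 1 + axis m (- (\<omega> * \<omega>)) + axis k' (- \<omega>) :: 'q ^ 'n)"
      define N where "N = replace_col l g ** diag d"
      have g: "g $ l = 1" "g $ m = - (\<omega> * \<omega>)" "g $ k' = - \<omega>" using lmo by (simp_all add: g_def axis_def)
      have nth: "(N *v x) $ r = (if r = l then 0 else d r * x $ r) + g $ r * x $ l" for x r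
        using lmo unfolding N_def by (simp flip: matrix_vector_mul_assoc) (simp add: d_def)
      have d: "d l = 1" "d m = - \<omega>" "d k' = - (\<omega> * \<omega>)" using lmo by (simp_all add: d_def)
      have "prod d UNIV = 1" unfolding lmo(1) using lmo(2-) \<omega>3 by (simp add: d mult.assoc)
      then have "det N = 1" using g by (simp add: N_def det_mul)
      moreover have "sends (N, frob) x x" if x: "x \<in> X - {z}" for x
      proof -
        have sendsI': "sends (N, frob) x x"
          if "c \<noteq> 0" "(N *v aut_vec frob x) $ l = c * x $ l" "(N *v aut_vec frob x) $ m = c * x $ m"
            "(N *v aut_vec frob x) $ k' = c * x $ k'" for c
        proof (rule sendsI [OF that(1)])
          fix r have "r = l \<or> r = m \<or> r = k'" using lmo(1) by blast
          then show "(N *v aut_vec frob x) $ r = c * x $ r" using that by blast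
        qed
        have "x = axis m 1 \<or> x = axis k' 1 \<or> x = u \<or> x = v"
          using x z lmo(1) unfolding X_def by auto
        then show ?thesis
        proof (elim disjE)
          assume "x = axis m 1"
          then show ?thesis using lmo \<omega>01 frob_in_frob_powers
            by (intro sendsI' [of "- \<omega>"]) (simp_all add: nth d g axis_def)
        next
          assume "x = axis k' 1"
          then show ?thesis using lmo \<omega>01 frob_in_frob_powers
            by (intro sendsI' [of "- (\<omega> * \<omega>)"]) (simp_all add: nth d g axis_def)
        next
          assume "x = u"
          then show ?thesis using lmo \<omega>2 frob_in_frob_powers
            by (intro sendsI' [of 1]) (simp_all add: nth d g u_def)
        next
          assume xv: "x = v"
          have 1: "frob (v $ m) = \<omega> * \<omega> * frob (v $ l)" "frob (v $ k') = \<omega> * frob (v $ l)"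
            using v frob_in_frob_powers \<omega>(2) \<omega>3 by (simp_all add: mult.assoc)
          have "\<omega> * (\<omega> * \<omega>) = 1" using \<omega>3 by (simp only: mult.assoc)
          then have 2: "- \<omega> * (\<omega> * \<omega>) - \<omega> * \<omega> = \<omega>" "- (\<omega> * \<omega>) * \<omega> - \<omega> = \<omega> * \<omega>"
            by (simp_all only: mult_minus_left mult.assoc) (simp_all add: \<omega>2)
          define c where "c = frob (v $ l) / v $ l"
          have c: "c \<noteq> 0" "frob (v $ l) = c * v $ l" using v(1) frob_in_frob_powers by (simp_all add: c_def)
          show ?thesis
          proof (rule sendsI' [OF c(1)])
            show "(N *v aut_vec frob x) $ l = c * x $ l" using lmo c by (simp add: nth g xv)
            have "(N *v aut_vec frob x) $ m = (- \<omega> * (\<omega> * \<omega>) - \<omega> * \<omega>) * frob (v $ l)"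
              using lmo by (simp add: nth g d xv 1 algebra_simps)
            then show "(N *v aut_vec frob x) $ m = c * x $ m" unfolding 2 xv v c by (simp add: mult_ac)
            have "(N *v aut_vec frob x) $ k' = (- (\<omega> * \<omega>) * \<omega> - \<omega>) * frob (v $ l)"
              using lmo by (simp add: nth g d xv 1 algebra_simps)
            then show "(N *v aut_vec frob x) $ k' = c * x $ k'" unfolding 2 xv v c by (simp add: mult_ac)
          qed
        qed
      qed
      ultimately show ?thesis by blast
    qed
    consider "z = axis i 1" | "z = axis j 1" | "z = axis k 1" | "z = u" | "z = v"
      using z by (auto simp: X_eq)
    then show ?thesis
    proof cases
      case 1
      then show ?thesis using ijk j k by (intro omit_axis [of i j k]) (auto simp: v_nth)
    next
      case 2
      then show ?thesis using ijk j k \<omega>01 \<omega>3 by (intro omit_axis [of j k i]) (auto simp: v_nth)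
    next
      case 3
      then show ?thesis using ijk j k \<omega>01 \<omega>3
        by (intro omit_axis [of k i j]) (auto simp: v_nth mult.assoc [symmetric])
    next
      case 4
      \<comment> \<open>Frobenius turns (1, \<omega>, \<omega>^2) into (1, \<omega>^2, \<omega>);
        this diagonal matrix turns it back.\<close>
      define d where "d l = (if l = i then 1 else if l = j then \<omega> * \<omega> else \<omega>)" for l
      have "prod d UNIV = 1" unfolding ijk using j k \<omega>3 by (simp add: d_def)
      moreover have "sends (diag d, frob) x x" if x: "x \<in> X - {z}" for x
      proof -
        consider l where "x = axis l 1" | "x = v" using x 4 by (auto simp: X_def)
        then show ?thesis
        proof cases
          case (1 l)
          then show ?thesis using \<omega>01 frob_in_frob_powers
            by (intro sendsI [of "d l"]) (auto simp: axis_def d_def)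
        next
          case 2
          then show ?thesis using \<omega>3 frob_in_frob_powers \<omega>(2)
            by (intro sendsI [of 1]) (auto simp: v_def d_def mult.assoc)
        qed
      qed
      ultimately show ?thesis by (intro exI [of _ "diag d"]) simp
    next
      case 5
      have "sends (mat 1, frob) x x" if x: "x \<in> X - {z}" for x
        using x 5 frob_in_frob_powers by (intro sendsI [of 1]) (auto simp: X_def axis_def u_def)
      then show ?thesis by (intro exI [of _ "mat 1"]) simp
    qed
  qed
  \<comment> \<open>The sources are scaled by \<open>D a\<close> and the targets by
    \<open>D b\<close>. A match \<open>D b ** N ** D (1 / frob a)\<close> then has determinant b /
    frob a = \<open>det A0\<close>, as required together with Frobenius, while a linear match has
    determinant b / a times a cube, which is excluded by the choice of \<open>a\<close>.\<close>
  define b where "b = det A0 * frob a"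
  have det0: "det A0 \<noteq> 0" using R_carrier [OF A0] by (simp add: invertible_det_nz)
  have b: "b \<noteq> 0" using det0 a(1) frob_in_frob_powers by (simp add: b_def)
  define D where "D c = diag (\<lambda>l. if l = i then c else 1)" for c :: 'q
  have D_nth: "(D c *v x) $ l = (if l = i then c else 1) * x $ l" for c x l by (simp add: D_def)
  have det_D: "det (D c) = c" for c by (simp add: D_def)
  have D_eq_0: "D c *v x = 0 \<longleftrightarrow> x = 0" if "c \<noteq> 0" for c x
    using that by (intro invertible_mult_vec_eq_0_iff) (simp add: invertible_det_nz det_D)
  let ?p = "\<lambda>x. (D a *v x, D b *v x)"
  have "inj_on ?p X"
  proof (rule inj_onI)
    fix x y assume "?p x = ?p y"
    then have "D a *v (x - y) = 0" by (simp add: matrix_vector_mult_diff_distrib)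
    then show "x = y" using D_eq_0 a(1) by simp
  qed
  then have card_Q: "card (?p ` X) = 5" using card_X by (simp add: card_image)
  have X0: "x \<noteq> 0" if "x \<in> X" for x
  proof -
    have "u $ i \<noteq> 0" "v $ i \<noteq> 0" by (simp_all add: u_def v_nth)
    then have "u \<noteq> 0" "v \<noteq> 0" by auto
    then show ?thesis using that by (auto simp: X_def axis_eq_0_iff)
  qed
  have "card (?p ` X) \<le> rc R"
  proof (rule rc_ge_card)
    show "x \<noteq> 0 \<and> y \<noteq> 0" if "(x, y) \<in> ?p ` X" for x y
      using that X0 D_eq_0 a(1) b by auto
  next
    fix q assume "q \<in> ?p ` X"
    then obtain z where z: "z \<in> X" "q = ?p z" by blast
    obtain N where N: "det N = 1" "\<forall>x\<in>X - {z}. sends (N, frob) x x" using omit z(1) by blast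
    define B where "B = D b ** N ** D (1 / frob a)"
    have "det B = det A0" using frob_in_frob_powers a(1) by (simp add: B_def det_mul det_D N b_def)
    then have "(B, frob) \<in> R" using R_same_det [OF A0, of B 1] by simp
    moreover have "sends (B, frob) x y" if xy: "(x, y) \<in> ?p ` X - {q}" for x y
    proof -
      obtain w where w: "w \<in> X" "x = D a *v w" "y = D b *v w" "w \<noteq> z" using xy z(2) by auto
      then obtain c where c: "c \<noteq> 0" "N *v aut_vec frob w = c *s w"
        using N(2) unfolding sends_def semilinear_map_eq by blast
      have "D (1 / frob a) *v aut_vec frob (D a *v w) = aut_vec frob w"
        using frob_in_frob_powers a(1) by (auto simp: vec_eq_iff D_nth)
      then have "B *v aut_vec frob x = c *s y"
        using c(2) w by (simp add: B_def vector_scalar_commute flip: matrix_vector_mul_assoc)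
      then show ?thesis using c(1) unfolding sends_def semilinear_map_eq by blast
    qed
    ultimately show "\<exists>g\<in>R. \<forall>(x, y)\<in>?p ` X - {q}. sends g x y" by blast
  next
    show "\<not> (\<exists>g\<in>R. \<forall>(x, y)\<in>?p ` X. sends g x y)"
    proof
      assume "\<exists>g\<in>R. \<forall>(x, y)\<in>?p ` X. sends g x y"
      then obtain A \<sigma> where A: "(A, \<sigma>) \<in> R" "\<And>x. x \<in> X \<Longrightarrow> sends (A, \<sigma>) (D a *v x) (D b *v x)"
        by fast
      have \<sigma>: "\<sigma> \<in> frob_powers" using R_carrier A(1) by blast
      have Aeq: "\<exists>c. c \<noteq> 0 \<and> A *v aut_vec \<sigma> (D a *v x) = c *s (D b *v x)" if "x \<in> X" for x
        using A(2) [OF that] unfolding sends_def semilinear_map_eq .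
      have "\<exists>c. A *v axis l 1 = c *s axis l 1" for l
      proof -
        have "D c *v axis l 1 = (if l = i then c else 1) *s axis l 1" for c
          by (auto simp: vec_eq_iff D_nth axis_def)
        moreover have "axis l 1 \<in> X" by (auto simp: X_def)
        ultimately obtain c where "A *v (\<sigma> (if l = i then a else 1) *s axis l 1) =
            c *s ((if l = i then b else 1) *s axis l 1)"
          using Aeq [of "axis l 1"] \<sigma> by auto
        then have "\<sigma> (if l = i then a else 1) *s (A *v axis l 1) = (c * (if l = i then b else 1)) *s axis l 1"
          by (simp only: vector_scalar_commute vec.scale_scale)
        then have "A *v axis l 1 = (c * (if l = i then b else 1) / \<sigma> (if l = i then a else 1)) *s axis l 1"
          using a(1) \<sigma> by (auto simp: vec_eq_iff eq_divide_eq mult.commute split: if_splits)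
        then show ?thesis by blast
      qed
      then obtain \<alpha> where \<alpha>: "\<And>l. A *v axis l 1 = \<alpha> l *s axis l 1" by metis
      have A_nth: "(A *v x) $ l = \<alpha> l * x $ l" for x l
        by (rule mult_on_support [of UNIV]) (use \<alpha> in auto)
      obtain c where c: "c \<noteq> 0" "A *v aut_vec \<sigma> (D a *v u) = c *s (D b *v u)"
        using Aeq [of u] by (auto simp: X_def)
      obtain e where e: "A *v aut_vec \<sigma> (D a *v v) = e *s (D b *v v)"
        using Aeq [of v] by (auto simp: X_def)
      have cs: "\<alpha> i * \<sigma> a = c * b" "\<alpha> j = c" "\<alpha> k = c"
        using arg_cong [OF c(2), of "\<lambda>x. x $ i"] arg_cong [OF c(2), of "\<lambda>x. x $ j"]
          arg_cong [OF c(2), of "\<lambda>x. x $ k"] j k \<sigma>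
        by (simp_all add: A_nth D_nth u_def)
      have es: "\<alpha> i * \<sigma> a = e * b" "\<alpha> j * \<sigma> \<omega> = e * \<omega>"
        using arg_cong [OF e, of "\<lambda>x. x $ i"] arg_cong [OF e, of "\<lambda>x. x $ j"] j \<sigma>
        by (simp_all add: A_nth D_nth v_nth)
      have "e = c" using cs(1) es(1) b by simp
      \<comment> \<open>The frame makes A diagonal and \<open>v\<close> forces \<sigma> to fix
        \<omega>. As Frobenius moves \<omega>, only linear maps remain.\<close>
      then have fix\<omega>: "\<sigma> \<omega> = \<omega>" using es(2) cs(2) c(1) by simp
      obtain l where l: "\<sigma> = frob ^^ l" using \<sigma> by (rule frob_powersE)
      have even: "(frob ^^ (2 * t) :: 'q \<Rightarrow> 'q) = id" for t
        by (induction t) (simp_all add: frob2 comp_assoc [symmetric] flip: id_def)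
      have "\<sigma> = id \<or> \<sigma> = frob"
      proof (cases "even l")
        case True
        then show ?thesis using l even by (auto elim!: evenE)
      next
        case False
        then obtain t where "l = Suc (2 * t)" by (auto elim!: oddE)
        then show ?thesis using l even [of t] by simp
      qed
      then have "\<sigma> = id" using fix\<omega> \<omega>(2,3) by auto
      have "A = diag \<alpha>" unfolding matrix_eq by (simp add: vec_eq_iff A_nth)
      moreover have "prod \<alpha> UNIV = \<alpha> i * (\<alpha> j * \<alpha> k)" unfolding ijk using j k by simp
      ultimately have "det A = \<alpha> i * (\<alpha> j * \<alpha> k)" by simp
      moreover have "\<alpha> i = c * b / a" using cs(1) a(1) \<open>\<sigma> = id\<close> by (simp add: eq_divide_eq)
      ultimately have "det A = c ^ 3 * (b / a)" using cs by (simp add: power3_eq_cube)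
      moreover obtain t where "det A = t ^ 3" using cubes A(1) \<open>\<sigma> = id\<close> by blast
      ultimately have "b / a = (t / c) ^ 3" using c(1) by (simp add: power_divide field_simps)
      then show False using a(2) by (simp add: b_def)
    qed
  qed (use n X_eq in auto)
  then show ?thesis using card_Q by simp
qed

text \<open>With \<open>axis i 1\<close> at infinity, the tuples have affine coordinates (infinity,
  0, 1, s) and (infinity, 0, 1, t). A map fixing the first three points sends s to \<sigma> s
  \<noteq> t. If one of these three is omitted, the matrix is determined by \<tau> up to scalars,
  and modulo squares its determinant is one of the listed values for every \<tau>, since \<tau> y /
  y is a square.\<close>

lemma rc_ge_4_if_dim_2:
  assumes n: "CARD('n) = 2"
    and st: "s \<noteq> 0" "s \<noteq> 1" "t \<noteq> 0" "t \<noteq> (1 :: 'q)" and orbit: "\<And>\<sigma>. \<sigma> \<in> frob_powers \<Longrightarrow> \<sigma> s \<noteq> t"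
    and squares: "\<And>\<tau> y. \<tau> \<in> frob_powers \<Longrightarrow> y \<noteq> 0 \<Longrightarrow> \<exists>c. c \<noteq> 0 \<and> \<tau> y = c ^ 2 * (y :: 'q)"
    and R: "\<And>r. r \<in> {t / s, (t - 1) / (s - 1), (t / s) * ((t - 1) / (s - 1))} \<Longrightarrow>
      \<exists>\<tau>\<in>frob_powers. \<forall>B c. c \<noteq> 0 \<longrightarrow> det B = c ^ 2 * r \<longrightarrow> (B, \<tau>) \<in> R"
  shows "4 \<le> rc R"
proof -
  fix i :: 'n
  obtain j where j: "j \<noteq> i" by (rule obtain_outside [of "{i}" "UNIV :: 'n set"]) (use n in auto)
  have "card {i, j} = CARD('n)" using j n by simp
  then have ij: "UNIV = {i, j}" using card_seteq [of UNIV "{i, j}"] by simp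
  define x where "x r = axis i r + axis j 1" for r :: 'q
  have x_nth: "x r $ i = r" "x r $ j = 1" for r using j by (simp_all add: x_def axis_def)
  let ?i = "(axis i 1, axis i 1) :: ('q ^ 'n) \<times> ('q ^ 'n)"
    and ?j = "(axis j 1, axis j 1) :: ('q ^ 'n) \<times> ('q ^ 'n)"
  define Q where "Q = {?i, ?j, (x 1, x 1), (x s, x t)}"
  have ax: "x r \<noteq> axis i 1" "r \<noteq> 0 \<Longrightarrow> x r \<noteq> axis j 1" "x 1 \<noteq> x s" for r
    using x_nth j st by (auto simp: vec_eq_iff axis_def) metis+
  have card_Q: "card Q = 4"
  proof -
    have "axis i 1 \<noteq> x 1" "axis i 1 \<noteq> x s" "axis j 1 \<noteq> x 1" "axis j 1 \<noteq> x s"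
      using ax(1) [of 1] ax(1) [of s] ax(2) [of 1] ax(2) [of s] st(1) by (auto dest: sym)
    then show ?thesis using ax(3) j unfolding Q_def by (simp add: axis_eq_axis)
  qed
  have sendsI': "sends (B, \<tau>) y z"
    if "c \<noteq> 0" "(B *v aut_vec \<tau> y) $ i = c * z $ i" "(B *v aut_vec \<tau> y) $ j = c * z $ j" for B \<tau> c y z
  proof (rule sendsI [OF that(1)])
    fix r have "r = i \<or> r = j" using ij by blast
    then show "(B *v aut_vec \<tau> y) $ r = c * z $ r" using that by blast
  qed
  have "card Q \<le> rc R"
  proof (rule rc_ge_card)
    show "finite Q" "Q \<noteq> {}" by (simp_all add: Q_def)
    have "x r \<noteq> 0" for r using x_nth(2) [of r] by auto
    then show "y \<noteq> 0 \<and> z \<noteq> 0" if "(y, z) \<in> Q" for y z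
      using that by (auto simp: Q_def axis_eq_0_iff)
  next
    fix z assume "z \<in> Q"
    then consider "z = ?i" | "z = ?j" | "z = (x 1, x 1)" | "z = (x s, x t)" by (auto simp: Q_def)
    then show "\<exists>g\<in>R. \<forall>(y, y')\<in>Q - {z}. sends g y y'"
    proof cases
      case 1
      let ?r = "(t / s) * ((t - 1) / (s - 1))"
      \<comment> \<open>The determinant that arises contains s / t in place of t / s, which is the
        same modulo squares.\<close>
      have "\<exists>\<tau>\<in>frob_powers. \<forall>B c. c \<noteq> 0 \<longrightarrow> det B = c ^ 2 * ((s / t) * ((t - 1) / (s - 1))) \<longrightarrow> (B, \<tau>) \<in> R"
        using R [of ?r]
      proof
        fix \<tau> assume \<tau>: "\<tau> \<in> frob_powers" "\<forall>B c. c \<noteq> 0 \<longrightarrow> det B = c ^ 2 * ?r \<longrightarrow> (B, \<tau>) \<in> R"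
        have "c ^ 2 * ((s / t) * ((t - 1) / (s - 1))) = (c * s / t) ^ 2 * ?r" for c
          using st by (simp add: power2_eq_square field_simps)
        then show ?thesis using \<tau> st by (intro bexI [of _ \<tau>]) (auto, metis divide_eq_0_iff mult_eq_0_iff)
      qed simp
      then obtain \<tau> where \<tau>: "\<tau> \<in> frob_powers"
        "\<And>B c. c \<noteq> 0 \<Longrightarrow> det B = c ^ 2 * ((s / t) * ((t - 1) / (s - 1))) \<Longrightarrow> (B, \<tau>) \<in> R" by blast
      define \<beta> where "\<beta> = (\<tau> s / t) * ((t - 1) / (\<tau> s - 1))"
      obtain c1 where c1: "c1 \<noteq> 0" "\<tau> s = c1 ^ 2 * s" using squares \<tau>(1) st by blast
      obtain c2 where c2: "c2 \<noteq> 0" "\<tau> (s - 1) = c2 ^ 2 * (s - 1)" using squares [of \<tau> "s - 1"] \<tau>(1) st by auto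
      have s1: "\<tau> s - 1 = c2 ^ 2 * (s - 1)" "\<tau> s - 1 \<noteq> 0" "\<tau> s \<noteq> 0"
        using c2 c1 st \<tau>(1) by auto
      define B where "B = replace_row j (axis i (1 - \<beta>) + axis j \<beta>)"
      have nth: "(B *v y) $ i = y $ i" "(B *v y) $ j = (1 - \<beta>) * y $ i + \<beta> * y $ j" for y
        using j by (simp_all add: B_def sum_axis2)
      have "det B = \<beta>" using j by (simp add: B_def axis_def)
      also have "\<beta> = (\<tau> s / t) * ((t - 1) / (c2 ^ 2 * (s - 1)))"
        by (simp only: \<beta>_def s1(1))
      also have "\<dots> = (c1 / c2) ^ 2 * ((s / t) * ((t - 1) / (s - 1)))"
        by (simp add: c1(2) power_divide mult_ac)
      finally have "(B, \<tau>) \<in> R" using \<tau>(2) c1 c2 by (metis divide_eq_0_iff)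
      moreover have "sends (B, \<tau>) (axis j 1) (axis j 1)"
        using \<tau> j st s1 by (intro sendsI' [of \<beta>]) (auto simp: nth axis_def \<beta>_def)
      moreover have "sends (B, \<tau>) (x 1) (x 1)"
        using \<tau> by (intro sendsI' [of 1]) (auto simp: nth x_nth)
      moreover have "sends (B, \<tau>) (x s) (x t)"
      proof (rule sendsI')
        show "\<tau> s / t \<noteq> 0" using s1 st by simp
        have "\<beta> * (\<tau> s - 1) = \<tau> s - \<tau> s / t" using s1 st by (simp add: \<beta>_def field_simps)
        then show "(B *v aut_vec \<tau> (x s)) $ j = \<tau> s / t * x t $ j"
          using \<tau> by (simp add: nth x_nth algebra_simps)
      qed (use \<tau> st in \<open>simp add: nth x_nth\<close>)
      ultimately show ?thesis using 1 by (intro bexI [of _ "(B, \<tau>)"]) (auto simp: Q_def)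
    next
      case 2
      obtain \<tau> where \<tau>: "\<tau> \<in> frob_powers"
        "\<And>B c. c \<noteq> 0 \<Longrightarrow> det B = c ^ 2 * ((t - 1) / (s - 1)) \<Longrightarrow> (B, \<tau>) \<in> R"
        using R [of "(t - 1) / (s - 1)"] by auto
      define \<beta> where "\<beta> = (t - 1) / (\<tau> s - 1)"
      obtain c2 where c2: "c2 \<noteq> 0" "\<tau> (s - 1) = c2 ^ 2 * (s - 1)" using squares [of \<tau> "s - 1"] \<tau>(1) st by auto
      have s1: "\<tau> s - 1 = c2 ^ 2 * (s - 1)" "\<tau> s - 1 \<noteq> 0" using c2 st \<tau>(1) by auto
      define B where "B = replace_row i (axis i \<beta> + axis j (1 - \<beta>))"
      have nth: "(B *v y) $ j = y $ j" "(B *v y) $ i = \<beta> * y $ i + (1 - \<beta>) * y $ j" for y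
        using j by (simp_all add: B_def sum_axis2)
      have "det B = \<beta>" using j by (simp add: B_def axis_def)
      also have "\<beta> = (1 / c2) ^ 2 * ((t - 1) / (s - 1))"
        unfolding \<beta>_def s1(1) by (simp add: power_divide)
      finally have "(B, \<tau>) \<in> R" using \<tau>(2) [of "1 / c2"] c2 by simp
      moreover have "sends (B, \<tau>) (axis i 1) (axis i 1)"
        using \<tau> j st s1 by (intro sendsI' [of \<beta>]) (auto simp: nth axis_def \<beta>_def)
      moreover have "sends (B, \<tau>) (x 1) (x 1)"
        using \<tau> by (intro sendsI' [of 1]) (auto simp: nth x_nth)
      moreover have "sends (B, \<tau>) (x s) (x t)"
      proof (rule sendsI' [of 1])
        have "\<beta> * (\<tau> s - 1) = t - 1" using s1 by (simp add: \<beta>_def)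
        then show "(B *v aut_vec \<tau> (x s)) $ i = 1 * x t $ i"
          using \<tau> by (simp add: nth x_nth algebra_simps)
      qed (use \<tau> in \<open>simp_all add: nth x_nth\<close>)
      ultimately show ?thesis using 2 by (intro bexI [of _ "(B, \<tau>)"]) (auto simp: Q_def)
    next
      case 3
      obtain \<tau> where \<tau>: "\<tau> \<in> frob_powers"
        "\<And>B c. c \<noteq> 0 \<Longrightarrow> det B = c ^ 2 * (t / s) \<Longrightarrow> (B, \<tau>) \<in> R"
        using R [of "t / s"] by auto
      obtain c1 where c1: "c1 \<noteq> 0" "\<tau> s = c1 ^ 2 * s" using squares \<tau>(1) st by blast
      define B where "B = diag (\<lambda>l. if l = i then t / \<tau> s else 1)"
      have nth: "(B *v y) $ j = y $ j" "(B *v y) $ i = t / \<tau> s * y $ i" for y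
        using j by (simp_all add: B_def)
      have "det B = t / \<tau> s" by (simp add: B_def)
      also have "t / \<tau> s = (1 / c1) ^ 2 * (t / s)" by (simp add: c1 power_divide)
      finally have "(B, \<tau>) \<in> R" using \<tau>(2) [of "1 / c1"] c1 by simp
      moreover have "sends (B, \<tau>) (axis i 1) (axis i 1)"
        using \<tau> j st by (intro sendsI' [of "t / \<tau> s"]) (auto simp: nth axis_def)
      moreover have "sends (B, \<tau>) (axis j 1) (axis j 1)"
        using \<tau> j st by (intro sendsI' [of 1]) (auto simp: nth axis_def)
      moreover have "sends (B, \<tau>) (x s) (x t)"
        using \<tau> st by (intro sendsI' [of 1]) (auto simp: nth x_nth)
      ultimately show ?thesis using 3 by (intro bexI [of _ "(B, \<tau>)"]) (auto simp: Q_def)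
    next
      case 4
      have "sends (mat 1, id) y y'" if yy: "(y, y') \<in> Q - {z}" for y y'
        using yy 4 by (intro sendsI [of 1]) (auto simp: Q_def)
      then show ?thesis using R_one by blast
    qed
  next
    show "\<not> (\<exists>g\<in>R. \<forall>(y, z)\<in>Q. sends g y z)"
    proof
      assume "\<exists>g\<in>R. \<forall>(y, z)\<in>Q. sends g y z"
      then obtain A \<sigma> where A: "(A, \<sigma>) \<in> R" "\<And>y z. (y, z) \<in> Q \<Longrightarrow> sends (A, \<sigma>) y z" by fast
      have \<sigma>: "\<sigma> \<in> frob_powers" using R_carrier A(1) by blast
      have "\<exists>c. A *v axis l 1 = c *s axis l 1" for l
      proof -
        have "l = i \<or> l = j" using ij by blast
        then have "(axis l 1, axis l 1) \<in> Q" by (auto simp: Q_def)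
        then show ?thesis using A(2) [of "axis l 1" "axis l 1"] \<sigma>
          by (auto simp: sends_def semilinear_map_eq)
      qed
      then obtain \<alpha> where \<alpha>: "\<And>l. A *v axis l 1 = \<alpha> l *s axis l 1" by metis
      have A_nth: "(A *v y) $ l = \<alpha> l * y $ l" for y l
        by (rule mult_on_support [of UNIV]) (use \<alpha> in auto)
      obtain c where c: "c \<noteq> 0" "A *v aut_vec \<sigma> (x 1) = c *s x 1"
        using A(2) [of "x 1" "x 1"] by (auto simp: Q_def sends_def semilinear_map_eq)
      obtain e where e: "A *v aut_vec \<sigma> (x s) = e *s x t"
        using A(2) [of "x s" "x t"] by (auto simp: Q_def sends_def semilinear_map_eq)
      have "\<alpha> i = c" "\<alpha> j = c"
        using arg_cong [OF c(2), of "\<lambda>x. x $ i"] arg_cong [OF c(2), of "\<lambda>x. x $ j"] \<sigma>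
        by (simp_all add: A_nth x_nth)
      moreover have "\<alpha> i * \<sigma> s = e * t" "\<alpha> j = e"
        using arg_cong [OF e, of "\<lambda>x. x $ i"] arg_cong [OF e, of "\<lambda>x. x $ j"] \<sigma>
        by (simp_all add: A_nth x_nth)
      ultimately have "\<sigma> s = t" using c(1) by simp
      then show False using orbit \<sigma> by blast
    qed
  qed (use n in simp)
  then show ?thesis using card_Q by simp
qed

end

section \<open>The exceptional group\<close>

lemma power_generator_eq_1:
  fixes \<gamma> :: "'q::finite_field"
  assumes \<gamma>: "\<gamma> \<noteq> 0" "\<And>x. x \<noteq> 0 \<Longrightarrow> \<exists>k. x = \<gamma> ^ k" and d: "\<gamma> ^ d = 1" "d > 0"
  shows "CARD('q) \<le> d + 1"
proof -
  have "UNIV - {0} \<subseteq> (\<lambda>k. \<gamma> ^ k) ` {..<d}"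
  proof
    fix x :: 'q assume "x \<in> UNIV - {0}"
    then obtain k where "x = \<gamma> ^ k" using \<gamma>(2) by blast
    also have "\<gamma> ^ k = \<gamma> ^ (d * (k div d) + k mod d)" by simp
    also have "\<dots> = \<gamma> ^ (k mod d)" unfolding power_add power_mult d by simp
    finally show "x \<in> (\<lambda>k. \<gamma> ^ k) ` {..<d}" using d(2) by auto
  qed
  then have "card (UNIV - {0 :: 'q}) \<le> card {..<d}"
    by (meson card_image_le card_mono finite_imageI finite_lessThan order_trans)
  then show ?thesis by simp
qed

text \<open>Euler's criterion for 9 elements: if an odd power of a generator had fourth power 1, the
  generator itself would satisfy \<gamma>^4 = 1.\<close>

lemma square_if_fourth_power_1:
  fixes x :: "'q::finite_field"
  assumes q: "CARD('q) = 9" and x: "x ^ 4 = 1"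
  shows "\<exists>c. c \<noteq> 0 \<and> x = c ^ 2"
proof -
  obtain \<gamma> :: 'q where \<gamma>: "\<gamma> \<noteq> 0" "\<And>x. x \<noteq> 0 \<Longrightarrow> \<exists>k. x = \<gamma> ^ k" using finite_field_generator by blast
  have "x \<noteq> 0" using x by auto
  then obtain k where k: "x = \<gamma> ^ k" using \<gamma>(2) by blast
  have "even k"
  proof (rule ccontr)
    assume "odd k"
    then obtain m where m: "k = Suc (2 * m)" by (auto elim!: oddE)
    have "\<gamma> * \<gamma> ^ 8 = \<gamma> ^ CARD('q)" unfolding q by (simp flip: power_Suc)
    then have "\<gamma> ^ 8 = 1" using finite_field_power_card_eq_same [of \<gamma>] \<gamma>(1) by simp
    have "x ^ 4 = \<gamma> ^ (8 * m + 4)" unfolding k m power_mult [symmetric] by (simp add: algebra_simps)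
    then have "x ^ 4 = (\<gamma> ^ 8) ^ m * \<gamma> ^ 4" by (simp only: power_add power_mult)
    then have "\<gamma> ^ 4 = 1" using x \<open>\<gamma> ^ 8 = 1\<close> by simp
    then show False using power_generator_eq_1 [OF \<gamma>, of 4] q by simp
  qed
  then obtain m where "k = 2 * m" by blast
  then show ?thesis using \<gamma>(1) k by (intro exI [of _ "\<gamma> ^ m"]) (simp add: power_mult mult.commute flip: power_mult)
qed

lemma CHAR_if_card_9: "CARD('q::finite_field) = 9 \<Longrightarrow> CHAR('q) = 3"
proof -
  assume q: "CARD('q) = 9"
  obtain f where f: "CARD('q) = CHAR('q) ^ f" "f > 0" by (rule card_finite_field)
  have "CHAR('q) dvd CHAR('q) ^ f" using f(2) by (intro dvd_power disjI1)
  moreover have "CHAR('q) ^ f = 3 ^ 2" using f(1) q by simp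
  ultimately have "CHAR('q) dvd 3 ^ 2" by simp
  then have "CHAR('q) dvd 3" using prime_dvd_power CHAR_prime by blast
  moreover have "prime (3::nat)" by simp
  ultimately show "CHAR('q) = 3" using primes_dvd_imp_eq [of "CHAR('q)" 3] CHAR_prime by blast
qed

text \<open>Over the field with \<open>9\<close> elements, \<open>x ^ 4\<close> is the norm of \<open>x\<close> and \<open>x + x ^ 3\<close> its trace,
  so \<open>x ^ 4\<close> and \<open>(x - 1) ^ 4\<close> determine \<open>x\<close> up to conjugation.\<close>

lemma
  fixes x y z :: "'q::finite_field"
  assumes q: "CARD('q) = 9"
  shows eq_or_conjugate: "x ^ 4 = y ^ 4 \<Longrightarrow> (x - 1) ^ 4 = (y - 1) ^ 4 \<Longrightarrow> y = x \<or> y = x ^ 3"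
    and norm_diff_eq_conjugate: "(x - z) ^ 4 = (x - z ^ 3) ^ 4 \<Longrightarrow> x ^ 3 = x \<or> z ^ 3 = z"
proof -
  have fr: "frob x = x ^ 3" for x :: 'q using CHAR_if_card_9 [OF q] by (simp add: frob_def)
  have cube: "(x - y) ^ 3 = x ^ 3 - y ^ 3" for x y :: 'q
    using aut_diff [OF frob_in_frob_powers, of x y] by (simp only: fr)
  have fourth: "(x - y) ^ 4 = (x ^ 3 - y ^ 3) * (x - y)" for x y :: 'q
  proof -
    have "(x - y) ^ 4 = (x - y) ^ 3 * (x - y)" by (simp add: power_Suc numeral_eq_Suc)
    then show ?thesis by (simp only: cube)
  qed
  have p4: "x ^ 4 = x ^ 3 * x" for x :: 'q by (simp add: numeral_eq_Suc)
  show "y = x \<or> y = x ^ 3" if 1: "x ^ 4 = y ^ 4" and 2: "(x - 1) ^ 4 = (y - 1) ^ 4"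
  proof -
    have a: "x ^ 3 * x = y ^ 3 * y" using 1 by (simp only: p4)
    have "(x ^ 3 - 1) * (x - 1) = (y ^ 3 - 1) * (y - 1)" using 2 by (simp add: fourth)
    then have b: "x ^ 3 + x = y ^ 3 + y" using a by (simp add: algebra_simps)
    have "(y - x) * (y - x ^ 3) = y * y - (x ^ 3 + x) * y + x ^ 3 * x" by (simp add: algebra_simps)
    also have "\<dots> = 0" unfolding a b by (simp add: algebra_simps)
    finally show ?thesis by simp
  qed
  show "x ^ 3 = x \<or> z ^ 3 = z" if "(x - z) ^ 4 = (x - z ^ 3) ^ 4"
  proof -
    have z9: "(z ^ 3) ^ 3 = z" using finite_field_power_card_eq_same [of z] q by (simp flip: power_mult)
    have "(x ^ 3 - z ^ 3) * (x - z) = (x ^ 3 - z) * (x - z ^ 3)"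
      using that by (simp only: fourth z9)
    then have "(x - x ^ 3) * (z ^ 3 - z) = 0" by (simp add: algebra_simps)
    then show ?thesis by auto
  qed
qed

section \<open>Brackets of vectors in the plane\<close>

lemma det_two:
  fixes A :: "'q::comm_ring_1 ^ 'n ^ 'n"
  assumes ij: "UNIV = {i, j :: 'n}" "i \<noteq> j"
  shows "det A = A $ i $ i * A $ j $ j - A $ i $ j * A $ j $ i"
proof -
  have f: "finite {j}" "i \<notin> {j}" using ij by auto
  show ?thesis
    unfolding det_def ij(1) sum_over_permutations_insert [OF f] permutes_sing
    using ij(2) by (simp add: sign_swap_id sign_id swap_id_eq)
qed

locale plane =
  fixes i j :: "'n::finite" and field_type :: "'q::finite_field itself"
  assumes ij: "UNIV = {i, j}" "i \<noteq> j"
begin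

definition bracket :: "'q ^ 'n \<Rightarrow> 'q ^ 'n \<Rightarrow> 'q" where
  "bracket v w = v $ i * w $ j - v $ j * w $ i"

lemma mult_nth: "(A *v v) $ r = A $ r $ i * v $ i + A $ r $ j * (v :: 'q ^ 'n) $ j"
  using ij(2) unfolding matrix_vector_mult_def ij(1) by simp

lemma bracket_mult: "bracket (A *v v) (A *v w) = det A * bracket v w"
  unfolding bracket_def mult_nth det_two [OF ij] by (simp add: algebra_simps)

lemma bracket_scale: "bracket (c *s v) (d *s w) = c * d * bracket v w"
  by (simp add: bracket_def algebra_simps)

lemma bracket_aut: "\<sigma> \<in> frob_powers \<Longrightarrow> bracket (aut_vec \<sigma> v) (aut_vec \<sigma> w) = \<sigma> (bracket v w)"
  by (simp add: bracket_def)

lemma plane_eq_iff: "v = w \<longleftrightarrow> v $ i = w $ i \<and> v $ j = (w :: 'q ^ 'n) $ j"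
proof -
  have "r = i \<or> r = j" for r using ij(1) by blast
  then show ?thesis unfolding vec_eq_iff by metis
qed

lemma bracket_eq_0D:
  assumes "bracket v w = 0" "v \<noteq> 0" "w \<noteq> 0"
  shows "\<exists>c. c \<noteq> 0 \<and> v = c *s w"
proof (cases "w $ i = 0")
  case True
  then have "w $ j \<noteq> 0" "v $ i = 0" using assms by (auto simp: plane_eq_iff bracket_def)
  then show ?thesis using assms True
    by (intro exI [of _ "v $ j / w $ j"]) (auto simp: plane_eq_iff)
next
  case False
  then have "v $ i \<noteq> 0" using assms by (auto simp: plane_eq_iff bracket_def)
  then show ?thesis using assms False
    by (intro exI [of _ "v $ i / w $ i"]) (auto simp: plane_eq_iff bracket_def field_simps)
qed

lemma bracket_self [simp]: "bracket v v = 0"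
  by (simp add: bracket_def)

lemma bracket_swap: "bracket v w = - bracket w v"
  by (simp add: bracket_def)

text \<open>Each vector occurs in two brackets, so rescaling changes the product by a square only.
  Over 9 elements its fourth power is therefore an invariant of three points.\<close>

definition triple :: "'q ^ 'n \<Rightarrow> 'q ^ 'n \<Rightarrow> 'q ^ 'n \<Rightarrow> 'q" where
  "triple u v w = bracket u v * bracket v w * bracket w u"

lemma triple_mult: "triple (A *v u) (A *v v) (A *v w) = det A ^ 3 * triple u v w"
  by (simp add: triple_def bracket_mult power3_eq_cube)

lemma triple_scale: "triple (a *s u) (b *s v) (c *s w) = (a * b * c) ^ 2 * triple u v w"
  by (simp add: triple_def bracket_scale power2_eq_square)

lemma triple_aut: "\<sigma> \<in> frob_powers \<Longrightarrow> triple (aut_vec \<sigma> u) (aut_vec \<sigma> v) (aut_vec \<sigma> w) = \<sigma> (triple u v w)"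
  by (simp add: triple_def bracket_aut)

text \<open>The new coordinates of v are \<open>bracket a c * bracket b v\<close> and
  \<open>bracket b c * bracket a v\<close>, which place a, b, c at infinity, 0 and 1.\<close>

lemma exists_coordinates:
  assumes "bracket a b \<noteq> 0" "bracket b c \<noteq> 0" "bracket c a \<noteq> 0"
  obtains M where "invertible M" "(M *v a) $ j = 0" "(M *v b) $ i = 0"
    "(M *v c) $ i = (M *v c) $ j"
proof -
  let ?p = "bracket a c" and ?q = "bracket b c"
  define M :: "'q ^ 'n ^ 'n" where "M = (\<chi> r s. if r = i then (if s = i then - ?p * b $ j else ?p * b $ i)
      else (if s = i then - ?q * a $ j else ?q * a $ i))"
  have nth: "(M *v v) $ i = ?p * bracket b v" "(M *v v) $ j = ?q * bracket a v" for v
    using ij(2) unfolding mult_nth by (simp_all add: M_def bracket_def algebra_simps)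
  have "det M = ?p * ?q * bracket b a"
    unfolding det_two [OF ij] using ij(2) by (simp add: M_def bracket_def algebra_simps)
  then have "invertible M"
    using assms bracket_swap [of a b] bracket_swap [of a c] by (simp add: invertible_det_nz)
  then show thesis using that [of M] by (simp add: nth mult.commute)
qed

end

text \<open>Fourth powers of triples are the three-point data. They yield the norms of all
  differences of affine coordinates; the norms of s and s - 1 fix each coordinate up to conjugation,
  and the mutual differences force one conjugation for all points.\<close>

lemma (in semilinear_group) rc_exceptional:
  assumes n: "CARD('n) = 2" and q: "CARD('q) = 9"
    and R: "\<And>A \<sigma>. (A, \<sigma>) \<in> R \<longleftrightarrow> \<sigma> \<in> frob_powers \<and> (\<exists>c. c \<noteq> 0 \<and> det A = c ^ 2)"
  shows "rc R = 3"
proof (rule antisym)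
  fix i :: 'n
  obtain j where j: "j \<noteq> i" by (rule obtain_outside [of "{i}" "UNIV :: 'n set"]) (use n in auto)
  have "card {i, j} = CARD('n)" using j n by simp
  then have ij: "UNIV = {i, j}" using card_seteq [of UNIV "{i, j}"] by simp
  interpret plane i j "TYPE('q)" by unfold_locales (use ij j in auto)
  have nth_pow: "x ^ 8 = 1" if "x \<noteq> 0" for x :: 'q
  proof -
    have "x * x ^ 8 = x ^ CARD('q)" unfolding q by (simp flip: power_Suc)
    then show ?thesis using finite_field_power_card_eq_same [of x] that by simp
  qed
  have sq_pow: "(c ^ 2) ^ 4 = 1" if "c \<noteq> 0" for c :: 'q
    using nth_pow [OF that] by (simp flip: power_mult)
  show "3 \<le> rc R"
  proof -
    have p3: "CHAR('q) = 3" using q by (rule CHAR_if_card_9)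
    then have "(1 :: 'q) \<noteq> - 1" by (intro one_neq_minus_one) simp
    then have "\<not> inj (\<lambda>x :: 'q. x ^ 2)" by (metis injD power2_minus)
    then have "\<not> surj (\<lambda>x :: 'q. x ^ 2)" using finite_UNIV_surj_inj finite by blast
    then obtain \<nu> :: 'q where \<nu>: "\<And>c. \<nu> \<noteq> c ^ 2" by (metis surj_def)
    have \<nu>0: "\<nu> \<noteq> 0" using \<nu> [of 0] by simp
    define x where "x r = axis i r + axis j 1" for r :: 'q
    have x_nth: "x r $ i = r" "x r $ j = 1" for r using j by (simp_all add: x_def axis_def)
    let ?i = "axis i 1 :: 'q ^ 'n" and ?j = "axis j 1 :: 'q ^ 'n"
    \<comment> \<open>A match would be diagonal with determinant c^2 \<nu>, a nonsquare.\<close>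
    define Q where "Q = {(?i, ?i), (?j, ?j), (x 1, x \<nu>)}"
    have ax: "?i $ j = 0" "?i $ i = 1" "?j $ i = 0" "?j $ j = 1" using j by (simp_all add: axis_def)
    have "x 1 \<noteq> ?i" "x 1 \<noteq> ?j" "?i \<noteq> ?j" using ax by (auto simp: plane_eq_iff x_nth)
    then have card_Q: "card Q = 3" unfolding Q_def by (simp add: eq_commute [of _ "x 1"])
    have sendsI': "sends (B, \<tau>) y z"
      if "c \<noteq> 0" "(B *v aut_vec \<tau> y) $ i = c * z $ i" "(B *v aut_vec \<tau> y) $ j = c * z $ j"
      for B :: "'q ^ 'n ^ 'n" and \<tau> c y z
      unfolding sends_def semilinear_map_eq using that by (intro exI [of _ c]) (simp add: plane_eq_iff)
    have "card Q \<le> rc R"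
    proof (rule rc_ge_card)
      have "x r \<noteq> 0" for r using x_nth(2) [of r] by auto
      then show "y \<noteq> 0 \<and> z \<noteq> 0" if "(y, z) \<in> Q" for y z
        using that by (auto simp: Q_def axis_eq_0_iff)
    next
      fix z assume "z \<in> Q"
      then consider "z = (?i, ?i)" | "z = (?j, ?j)" | "z = (x 1, x \<nu>)" by (auto simp: Q_def)
      then show "\<exists>g\<in>R. \<forall>(y, y')\<in>Q - {z}. sends g y y'"
      proof cases
        case 1
        define B where "B = diag (\<lambda>l. if l = i then \<nu> else 1) ** replace_row j (axis i (1 - 1 / \<nu>) + axis j (1 / \<nu>))"
        have nth: "(B *v y) $ i = \<nu> * y $ i" "(B *v y) $ j = (1 - 1 / \<nu>) * y $ i + 1 / \<nu> * y $ j" for y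
          using j unfolding B_def by (simp_all add: sum_axis2 flip: matrix_vector_mul_assoc)
        have "det B = 1" using j \<nu>0 by (simp add: B_def det_mul axis_def)
        then have "(B, id) \<in> R" by (rule R_SL)
        moreover have "sends (B, id) ?j ?j" using \<nu>0 ax by (intro sendsI' [of "1 / \<nu>"]) (simp_all add: nth)
        moreover have "sends (B, id) (x 1) (x \<nu>)" by (intro sendsI' [of 1]) (simp_all add: nth x_nth)
        ultimately show ?thesis using 1 by (intro bexI [of _ "(B, id)"]) (auto simp: Q_def)
      next
        case 2
        define B where "B = replace_row i (axis i 1 + axis j (\<nu> - 1))"
        have nth: "(B *v y) $ j = y $ j" "(B *v y) $ i = y $ i + (\<nu> - 1) * y $ j" for y
          using j unfolding B_def by (simp_all add: sum_axis2)
        have "det B = 1" using j by (simp add: B_def axis_def)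
        then have "(B, id) \<in> R" by (rule R_SL)
        moreover have "sends (B, id) ?i ?i" using ax by (intro sendsI' [of 1]) (simp_all add: nth)
        moreover have "sends (B, id) (x 1) (x \<nu>)" by (intro sendsI' [of 1]) (simp_all add: nth x_nth)
        ultimately show ?thesis using 2 by (intro bexI [of _ "(B, id)"]) (auto simp: Q_def)
      next
        case 3
        have "sends (mat 1, id) y y" for y :: "'q ^ 'n" by (intro sendsI [of 1]) simp_all
        then show ?thesis using 3 R_one by (intro bexI [of _ "(mat 1, id)"]) (auto simp: Q_def)
      qed
    next
      show "\<not> (\<exists>g\<in>R. \<forall>(y, z)\<in>Q. sends g y z)"
      proof
        assume "\<exists>g\<in>R. \<forall>(y, z)\<in>Q. sends g y z"
        then obtain A \<sigma> where A: "(A, \<sigma>) \<in> R" "\<And>y z. (y, z) \<in> Q \<Longrightarrow> sends (A, \<sigma>) y z" by fast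
        have \<sigma>: "\<sigma> \<in> frob_powers" using R_carrier A(1) by blast
        obtain a where a: "A *v ?i = a *s ?i"
          using A(2) [of ?i ?i] \<sigma> by (auto simp: Q_def sends_def semilinear_map_eq)
        obtain b where b: "A *v ?j = b *s ?j"
          using A(2) [of ?j ?j] \<sigma> by (auto simp: Q_def sends_def semilinear_map_eq)
        obtain c where c: "c \<noteq> 0" "A *v aut_vec \<sigma> (x 1) = c *s x \<nu>"
          using A(2) [of "x 1" "x \<nu>"] by (auto simp: Q_def sends_def semilinear_map_eq)
        have entries: "A $ i $ i = a" "A $ j $ i = 0" "A $ i $ j = 0" "A $ j $ j = b"
          using a b ax by (simp_all add: plane_eq_iff mult_nth)
        have "a = c * \<nu>" "b = c" using c(2) \<sigma> by (simp_all add: plane_eq_iff mult_nth entries x_nth)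
        then have "det A = c ^ 2 * \<nu>" by (simp add: det_two [OF ij] entries power2_eq_square)
        moreover obtain d where "det A = d ^ 2" using R A(1) by blast
        ultimately have "\<nu> = (d / c) ^ 2" using c(1) by (simp add: power_divide)
        then show False using \<nu> by blast
      qed
    qed (use n in \<open>auto simp: Q_def\<close>)
    then show ?thesis by (simp add: card_Q)
  qed
  show "rc R \<le> 3"
  proof -
    have "determines_orbits R 3"
      unfolding determines_orbits_def
    proof (intro allI impI, elim conjE)
      fix k and x y :: "nat \<Rightarrow> 'q ^ 'n"
      assume k: "k \<ge> 3" and nz: "\<forall>l<k. x l \<noteq> 0 \<and> y l \<noteq> 0"
        and eq: "\<forall>I\<subseteq>{..<k}. card I = 3 \<longrightarrow> (\<exists>g\<in>R. \<forall>l\<in>I. sends g (x l) (y l))"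
      have eq3: "\<exists>g\<in>R. sends g (x a) (y a) \<and> sends g (x b) (y b) \<and> sends g (x c) (y c)"
        if abc: "a < k" "b < k" "c < k" for a b c
      proof -
        have "card {a, b, c} \<le> 3" by (simp add: card_insert_if)
        moreover have "{a, b, c} \<subseteq> {..<k}" using abc by auto
        ultimately obtain I where I: "{a, b, c} \<subseteq> I" "I \<subseteq> {..<k}" "card I = 3"
          using exists_subset_between [of "{a, b, c}" 3 "{..<k}"] k by auto
        then obtain g where "g \<in> R" "\<forall>l\<in>I. sends g (x l) (y l)" using eq by blast
        then show ?thesis using I(1) by blast
      qed
      \<comment> \<open>Nonzero squares have fourth power 1, which removes \<open>det A\<close> and
        all rescalings; and t^4 is 0, 1 or -1, so \<sigma> does not change it.\<close>
      have triple4: "triple u v w ^ 4 = triple u' v' w' ^ 4"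
        if g: "(A, \<sigma>) \<in> R" "sends (A, \<sigma>) u u'" "sends (A, \<sigma>) v v'" "sends (A, \<sigma>) w w'"
        for A :: "'q ^ 'n ^ 'n" and \<sigma> u v w u' v' w'
      proof -
        have \<sigma>: "\<sigma> \<in> frob_powers" using g(1) R by blast
        obtain d where d: "d \<noteq> 0" "det A = d ^ 2" using g(1) R by blast
        obtain a b c where abc: "a \<noteq> 0" "b \<noteq> 0" "c \<noteq> 0" "A *v aut_vec \<sigma> u = a *s u'"
          "A *v aut_vec \<sigma> v = b *s v'" "A *v aut_vec \<sigma> w = c *s w'"
          using g(2-) unfolding sends_def semilinear_map_eq by blast
        have "(d ^ 2) ^ 3 * \<sigma> (triple u v w) = (a * b * c) ^ 2 * triple u' v' w'"
          using triple_mult [of A "aut_vec \<sigma> u" "aut_vec \<sigma> v" "aut_vec \<sigma> w"] \<sigma> d abc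
          by (simp add: triple_aut triple_scale)
        then have "((d ^ 2) ^ 3 * \<sigma> (triple u v w)) ^ 4 = ((a * b * c) ^ 2 * triple u' v' w') ^ 4" by simp
        moreover have "((d ^ 2) ^ 3) ^ 4 = ((d ^ 2) ^ 4) ^ 3" by (simp flip: power_mult)
        then have "((d ^ 2) ^ 3) ^ 4 = 1" by (simp only: sq_pow [OF d(1)] power_one)
        moreover have "((a * b * c) ^ 2) ^ 4 = 1" using abc by (intro sq_pow) simp
        ultimately have "\<sigma> (triple u v w) ^ 4 = triple u' v' w' ^ 4"
          by (simp only: power_mult_distrib [of _ _ 4] mult_1_left)
        moreover have "\<sigma> (t ^ 4) = t ^ 4" for t
        proof (cases "t = 0")
          case False
          have "(t ^ 4 - 1) * (t ^ 4 + 1) = t ^ 8 - 1" by (simp add: algebra_simps flip: power_add)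
          then have "t ^ 4 = 1 \<or> t ^ 4 = - 1" using nth_pow [OF False] by (simp add: eq_neg_iff_add_eq_0)
          then show ?thesis using \<sigma> by (auto simp del: aut_power)
        qed (use \<sigma> in simp)
        ultimately show ?thesis using \<sigma> by simp
      qed
      have triple_xy: "triple (x a) (x b) (x c) ^ 4 = triple (y a) (y b) (y c) ^ 4"
        if abc: "a < k" "b < k" "c < k" for a b c
      proof -
        obtain A \<sigma> where "(A, \<sigma>) \<in> R" "sends (A, \<sigma>) (x a) (y a)" "sends (A, \<sigma>) (x b) (y b)"
          "sends (A, \<sigma>) (x c) (y c)" using eq3 [OF abc] by (metis surj_pair)
        then show ?thesis by (rule triple4)
      qed
      have zero_iff: "bracket (x a) (x b) = 0 \<longleftrightarrow> bracket (y a) (y b) = 0" if ab: "a < k" "b < k" for a b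
      proof -
        obtain A \<sigma> where A: "(A, \<sigma>) \<in> R" "sends (A, \<sigma>) (x a) (y a)" "sends (A, \<sigma>) (x b) (y b)"
          using eq3 [OF ab ab(2)] by (metis surj_pair)
        obtain c d where cd: "c \<noteq> 0" "d \<noteq> 0" "A *v aut_vec \<sigma> (x a) = c *s y a" "A *v aut_vec \<sigma> (x b) = d *s y b"
          using A(2-) unfolding sends_def semilinear_map_eq by blast
        have \<sigma>: "\<sigma> \<in> frob_powers" "det A \<noteq> 0" using A(1) R by auto
        have "det A * \<sigma> (bracket (x a) (x b)) = c * d * bracket (y a) (y b)"
          using bracket_mult [of A "aut_vec \<sigma> (x a)" "aut_vec \<sigma> (x b)"] cd \<sigma>
          by (simp add: bracket_aut bracket_scale)
        then show ?thesis using cd \<sigma> by (metis aut_eq_0_iff mult_eq_0_iff)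
      qed
      have parallel: "sends g (x b) (y b)"
        if g: "g \<in> R" "sends g (x a) (y a)" and ab: "a < k" "b < k" "bracket (x b) (x a) = 0" for g a b
      proof -
        obtain A \<sigma> where A: "g = (A, \<sigma>)" by (metis surj_pair)
        have \<sigma>: "\<sigma> \<in> frob_powers" using g A R by blast
        have yba: "bracket (y b) (y a) = 0" using zero_iff [OF ab(2,1)] ab(3) by simp
        have "\<exists>c. c \<noteq> 0 \<and> x b = c *s x a" using nz ab by (intro bracket_eq_0D) auto
        moreover have "\<exists>d. d \<noteq> 0 \<and> y b = d *s y a" using nz ab yba by (intro bracket_eq_0D) auto
        ultimately obtain c d where cd: "c \<noteq> 0" "x b = c *s x a" "d \<noteq> 0" "y b = d *s y a" by blast
        obtain e where "e \<noteq> 0" "semilinear_map g (x a) = e *s y a" using g(2) unfolding sends_def by blast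
        then have "semilinear_map g (x b) = (\<sigma> c * e / d) *s y b"
          using cd \<sigma> by (simp add: A semilinear_map_scale)
        then show ?thesis using cd \<sigma> \<open>e \<noteq> 0\<close> unfolding sends_def
          by (intro exI [of _ "\<sigma> c * e / d"]) simp
      qed
      show "\<exists>g\<in>R. \<forall>l<k. sends g (x l) (y l)"
      proof (cases "\<exists>a<k. \<exists>b<k. \<exists>c<k. bracket (x a) (x b) \<noteq> 0 \<and> bracket (x b) (x c) \<noteq> 0 \<and> bracket (x c) (x a) \<noteq> 0")
        case False
        \<comment> \<open>At most two distinct points occur, those with indices 0 and
          \<open>b\<close>. Three-point equivalence matches them, and \<open>parallel\<close>
          extends the match to repetitions.\<close>
        have "\<exists>b<k. \<forall>l<k. bracket (x l) (x 0) = 0 \<or> bracket (x l) (x b) = 0"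
        proof (cases "\<forall>l<k. bracket (x l) (x 0) = 0")
          case True
          then show ?thesis using k by (intro exI [of _ 0]) auto
        next
          case F: False
          then obtain b where b: "b < k" "bracket (x b) (x 0) \<noteq> 0" by blast
          have "bracket (x l) (x 0) = 0 \<or> bracket (x l) (x b) = 0" if l: "l < k" for l
          proof -
            have "0 < k" using k by simp
            then have "bracket (x 0) (x b) = 0 \<or> bracket (x b) (x l) = 0 \<or> bracket (x l) (x 0) = 0"
              using False b(1) l by blast
            then show ?thesis using b(2) bracket_swap [of "x 0" "x b"] bracket_swap [of "x b" "x l"] by auto
          qed
          then show ?thesis using b by blast
        qed
        then obtain b where b: "b < k" "\<And>l. l < k \<Longrightarrow> bracket (x l) (x 0) = 0 \<or> bracket (x l) (x b) = 0" by blast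
        obtain g where g: "g \<in> R" "sends g (x 0) (y 0)" "sends g (x b) (y b)"
          using eq3 [of 0 b b] b k by auto
        have "sends g (x l) (y l)" if l: "l < k" for l
          using b(2) [OF l] parallel [OF g(1,2) _ l] parallel [OF g(1,3) b(1) l] k by auto
        then show ?thesis using g(1) by blast
      next
        case True
        then obtain a b c where abc: "a < k" "b < k" "c < k"
          and xabc: "bracket (x a) (x b) \<noteq> 0" "bracket (x b) (x c) \<noteq> 0" "bracket (x c) (x a) \<noteq> 0" by blast
        have yabc: "bracket (y a) (y b) \<noteq> 0" "bracket (y b) (y c) \<noteq> 0" "bracket (y c) (y a) \<noteq> 0"
          using xabc zero_iff abc by auto
        \<comment> \<open>Both tuples are normalised so that a, b, c become infinity, 0 and 1. By
          \<open>det4\<close>, the normalising determinants lie in the same square class.\<close>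
        obtain M where M: "invertible M" "(M *v x a) $ j = 0" "(M *v x b) $ i = 0" "(M *v x c) $ i = (M *v x c) $ j"
          using exists_coordinates [OF xabc] .
        obtain M' where M': "invertible M'" "(M' *v y a) $ j = 0" "(M' *v y b) $ i = 0" "(M' *v y c) $ i = (M' *v y c) $ j"
          using exists_coordinates [OF yabc] .
        define X where "X l = M *v x l" for l
        define Y where "Y l = M' *v y l" for l
        have X0: "X l \<noteq> 0" "Y l \<noteq> 0" if "l < k" for l
          using M(1) M'(1) nz that by (simp_all add: X_def Y_def invertible_mult_vec_eq_0_iff)
        have det0: "det M \<noteq> 0" "det M' \<noteq> 0" using M(1) M'(1) by (simp_all add: invertible_det_nz)
        have normal4: "triple (v a) (v b) (v c) ^ 4 = 1"
          if v: "v a $ j = 0" "v b $ i = 0" "v c $ i = v c $ j"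
            "v a \<noteq> 0" "v b \<noteq> 0" "v c \<noteq> 0" for v :: "nat \<Rightarrow> 'q ^ 'n"
        proof -
          have 1: "v a $ i \<noteq> 0" "v b $ j \<noteq> 0" "v c $ j \<noteq> 0" using v by (auto simp: plane_eq_iff)
          have "triple (v a) (v b) (v c) = (v a $ i * v b $ j * v c $ j) ^ 2"
            using v by (simp add: triple_def bracket_def power2_eq_square)
          then show ?thesis using sq_pow 1 by simp
        qed
        have 1: "(det M ^ 3) ^ 4 * triple (x a) (x b) (x c) ^ 4 = 1"
          using normal4 [of X] M X0 abc by (simp add: X_def triple_mult power_mult_distrib)
        have 2: "(det M' ^ 3) ^ 4 * triple (x a) (x b) (x c) ^ 4 = 1"
          using normal4 [of Y] M' X0 abc triple_xy [OF abc]
          by (simp add: Y_def triple_mult power_mult_distrib)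
        have "triple (x a) (x b) (x c) ^ 4 \<noteq> 0" using 1 by auto
        then have det12: "(det M ^ 3) ^ 4 = (det M' ^ 3) ^ 4" using 1 2 by (simp flip: nonzero_eq_divide_eq)
        have "(d ^ 3) ^ 4 = d ^ 4" if "d \<noteq> 0" for d :: 'q
        proof -
          have "(d ^ 3) ^ 4 = d ^ 8 * d ^ 4" by (simp flip: power_mult power_add)
          then show ?thesis using nth_pow [OF that] by simp
        qed
        then have det4: "det M ^ 4 = det M' ^ 4" using det12 det0 by metis
        have tripleXY: "triple (X l) (X m) (X r) ^ 4 = triple (Y l) (Y m) (Y r) ^ 4"
          if "l < k" "m < k" "r < k" for l m r
          unfolding X_def Y_def triple_mult power_mult_distrib [of _ _ 4] det12 triple_xy [OF that] ..
        have at_infinity: "X l $ j = 0 \<longleftrightarrow> Y l $ j = 0" if l: "l < k" for l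
        proof -
          have Xa: "X a $ i \<noteq> 0" "X a $ j = 0" "Y a $ i \<noteq> 0" "Y a $ j = 0"
            using X0 [OF abc(1)] M M' by (auto simp: plane_eq_iff X_def Y_def)
          have "X l $ j = 0 \<longleftrightarrow> bracket (X a) (X l) = 0" using Xa by (simp add: bracket_def)
          also have "\<dots> \<longleftrightarrow> bracket (x a) (x l) = 0" using det0 by (simp add: X_def bracket_mult)
          also have "\<dots> \<longleftrightarrow> bracket (Y a) (Y l) = 0"
            using zero_iff [OF abc(1) l] det0 by (simp add: Y_def bracket_mult)
          also have "\<dots> \<longleftrightarrow> Y l $ j = 0" using Xa by (simp add: bracket_def)
          finally show ?thesis .
        qed
        define L where "L = {l. l < k \<and> X l $ j \<noteq> 0}"
        define s where "s l = X l $ i / X l $ j" for l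
        define z where "z l = Y l $ i / Y l $ j" for l
        \<comment> \<open>A triple containing the point at infinity is, up to sign, a square times a
          difference of affine coordinates.\<close>
        have diff4: "(s l - s m) ^ 4 = (z l - z m) ^ 4" if lm: "l \<in> L" "m \<in> L" for l m
        proof -
          have *: "triple (v a) (v l) (v m) ^ 4 = (v l $ i / v l $ j - v m $ i / v m $ j) ^ 4"
            if v: "v a $ j = 0" "v a $ i \<noteq> 0" "v l $ j \<noteq> 0" "v m $ j \<noteq> 0" for v :: "nat \<Rightarrow> 'q ^ 'n"
          proof -
            have "triple (v a) (v l) (v m) = - ((v a $ i * v l $ j * v m $ j) ^ 2 * (v l $ i / v l $ j - v m $ i / v m $ j))"
              using v by (simp add: triple_def bracket_def power2_eq_square field_simps)
            then have "triple (v a) (v l) (v m) ^ 4 =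
                ((v a $ i * v l $ j * v m $ j) ^ 2) ^ 4 * (v l $ i / v l $ j - v m $ i / v m $ j) ^ 4"
              by (simp only: power_minus_even [of 4] power_mult_distrib even_numeral)
            then show ?thesis using sq_pow v by simp
          qed
          have "X a $ j = 0" "X a $ i \<noteq> 0" "Y a $ j = 0" "Y a $ i \<noteq> 0"
            using X0 [OF abc(1)] M M' by (auto simp: plane_eq_iff X_def Y_def)
          moreover have lm': "l < k" "m < k" "X l $ j \<noteq> 0" "X m $ j \<noteq> 0" using lm by (simp_all add: L_def)
          moreover have "Y l $ j \<noteq> 0" "Y m $ j \<noteq> 0" using lm' at_infinity by blast+
          ultimately show ?thesis
            using tripleXY [OF abc(1) lm'(1,2)] * [of X] * [of Y] unfolding s_def z_def by metis
        qed
        have "X b $ j \<noteq> 0" "X c $ j \<noteq> 0" "Y c $ j \<noteq> 0"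
          using X0 [OF abc(2)] X0 [OF abc(3)] M M' by (auto simp: plane_eq_iff X_def Y_def)
        then have bc: "b \<in> L" "c \<in> L" "s b = 0" "z b = 0" "s c = 1" "z c = 1"
          using abc M M' by (auto simp: L_def s_def z_def X_def Y_def)
        have zs: "z l = s l \<or> z l = s l ^ 3" if "l \<in> L" for l
          using diff4 [OF that bc(1)] diff4 [OF that bc(2)] bc by (intro eq_or_conjugate [OF q]) auto
        \<comment> \<open>If \<open>l\<close> needed conjugation and \<open>m\<close> forbade it,
          the norms of s_m - s_l and s_m - s_l^3 would agree although neither coordinate lies in the
          prime field.\<close>
        have "(\<forall>l\<in>L. z l = s l) \<or> (\<forall>l\<in>L. z l = s l ^ 3)"
        proof (rule ccontr)
          assume "\<not> ?thesis"
          then obtain l m where lm: "l \<in> L" "m \<in> L" "z l \<noteq> s l" "z m \<noteq> s m ^ 3" by blast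
          then have "z l = s l ^ 3" "z m = s m" using zs by blast+
          then show False using lm diff4 [OF lm(2,1)] norm_diff_eq_conjugate [OF q, of "s m" "s l"] by auto
        qed
        moreover have fr: "frob t = t ^ 3" for t :: 'q using CHAR_if_card_9 [OF q] by (simp add: frob_def)
        moreover have "(frob :: 'q \<Rightarrow> 'q) \<in> frob_powers" by simp
        ultimately obtain \<sigma> :: "'q \<Rightarrow> 'q" where \<sigma>: "\<sigma> \<in> frob_powers" "\<And>l. l \<in> L \<Longrightarrow> z l = \<sigma> (s l)"
          by (metis frob_powers_id id_apply)
        have XY: "\<exists>d. d \<noteq> 0 \<and> aut_vec \<sigma> (X l) = d *s Y l" if l: "l < k" for l
        proof (cases "l \<in> L")
          case True
          then have 1: "X l $ j \<noteq> 0" "Y l $ j \<noteq> 0" using at_infinity l by (auto simp: L_def)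
          have "Y l $ i / Y l $ j = \<sigma> (X l $ i) / \<sigma> (X l $ j)"
            using \<sigma>(2) [OF True] \<sigma>(1) by (simp add: s_def z_def)
          then show ?thesis using 1 \<sigma>(1)
            by (intro exI [of _ "\<sigma> (X l $ j) / Y l $ j"]) (auto simp: plane_eq_iff field_simps)
        next
          case False
          then have 1: "X l $ j = 0" "Y l $ j = 0" using at_infinity l by (auto simp: L_def)
          then have "X l $ i \<noteq> 0" "Y l $ i \<noteq> 0" using X0 [OF l] by (auto simp: plane_eq_iff)
          then show ?thesis using 1 \<sigma>(1)
            by (intro exI [of _ "\<sigma> (X l $ i) / Y l $ i"]) (auto simp: plane_eq_iff)
        qed
        obtain N where N: "N ** M' = mat 1" using M'(1) unfolding invertible_def by blast
        then have "det N * det M' = 1" by (metis det_mul det_I)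
        \<comment> \<open>In normalised coordinates \<sigma> alone carries one tuple to the other.
          Undoing the normalisations gives a matrix whose determinant has fourth power 1, hence is a
          square.\<close>
        define A where "A = N ** map_matrix \<sigma> M"
        have "det A ^ 4 = det N ^ 4 * \<sigma> (det M ^ 4)"
          using \<sigma>(1) by (simp add: A_def det_mul det_map_matrix power_mult_distrib)
        also have "\<sigma> (det M ^ 4) = det M ^ 4"
        proof -
          have "(det M ^ 4 - 1) * (det M ^ 4 + 1) = det M ^ 8 - 1" by (simp add: algebra_simps flip: power_add)
          then have "det M ^ 4 = 1 \<or> det M ^ 4 = - 1"
            using nth_pow [OF det0(1)] by (simp add: eq_neg_iff_add_eq_0)
          then show ?thesis using \<sigma>(1) by (auto simp del: aut_power)
        qed
        also have "det N ^ 4 * det M ^ 4 = 1"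
          unfolding det4 using \<open>det N * det M' = 1\<close> by (simp flip: power_mult_distrib)
        finally have "(A, \<sigma>) \<in> R" using R \<sigma>(1) square_if_fourth_power_1 [OF q] by blast
        moreover have "sends (A, \<sigma>) (x l) (y l)" if l: "l < k" for l
        proof -
          obtain d where d: "d \<noteq> 0" "aut_vec \<sigma> (X l) = d *s Y l" using XY [OF l] by blast
          have "A *v aut_vec \<sigma> (x l) = N *v aut_vec \<sigma> (X l)"
            using \<sigma>(1) by (simp add: A_def X_def aut_vec_mult flip: matrix_vector_mul_assoc)
          also have "\<dots> = d *s (N *v (M' *v y l))" unfolding d(2) Y_def by (rule vector_scalar_commute)
          also have "N *v (M' *v y l) = y l" using N by (simp add: matrix_vector_mul_assoc)
          finally show ?thesis using d(1) unfolding sends_def semilinear_map_eq by blast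
        qed
        ultimately show ?thesis by blast
      qed
    qed
    then show ?thesis unfolding rc_def by (intro Least_le) simp
  qed
qed

section \<open>Arithmetic in the field\<close>

lemma card_frob_powers_le:
  assumes f: "CARD('q::finite_field) = CHAR('q) ^ f" "f > 0"
  shows "card (frob_powers :: ('q \<Rightarrow> 'q) set) \<le> f"
proof -
  have "frob_powers \<subseteq> (\<lambda>k. (frob ^^ k :: 'q \<Rightarrow> 'q)) ` {..<f}"
  proof
    fix \<sigma> :: "'q \<Rightarrow> 'q" assume "\<sigma> \<in> frob_powers"
    then obtain k where k: "\<sigma> = frob ^^ k" unfolding frob_powers_def by blast
    note frob_funpow_eq_id [OF f(1), of "k div f"]
    then have "\<sigma> = frob ^^ (k mod f)"
      unfolding k by (subst mult_div_mod_eq [of f k, symmetric]) (simp only: funpow_add id_comp)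
    then show "\<sigma> \<in> (\<lambda>k. (frob ^^ k :: 'q \<Rightarrow> 'q)) ` {..<f}" using f(2) by auto
  qed
  then have "card (frob_powers :: ('q \<Rightarrow> 'q) set) \<le> card ((\<lambda>k. (frob ^^ k :: 'q \<Rightarrow> 'q)) ` {..<f})"
    by (intro card_mono) simp_all
  also have "\<dots> \<le> card {..<f}" by (intro card_image_le) simp
  finally show ?thesis by simp
qed

lemma frob_neq_id_if_aut_neq_id:
  assumes "\<psi> \<in> frob_powers" "\<psi> \<noteq> (id :: 'q::finite_field \<Rightarrow> 'q)"
  shows "frob \<noteq> (id :: 'q \<Rightarrow> 'q)"
proof
  assume "frob = (id :: 'q \<Rightarrow> 'q)"
  then have "(frob ^^ k :: 'q \<Rightarrow> 'q) = id" for k by (induction k) simp_all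
  then show False using assms unfolding frob_powers_def by auto
qed

lemma exponent_ge_2:
  assumes "CARD('q::finite_field) = CHAR('q) ^ f" "f > 0" "frob \<noteq> (id :: 'q \<Rightarrow> 'q)"
  shows "f \<ge> 2"
proof (rule ccontr)
  assume "\<not> f \<ge> 2"
  then have "f = 1" using assms(2) by simp
  then have "frob x = x" for x :: 'q
    using finite_field_power_card_eq_same [of x] assms(1) by (simp add: frob_def)
  then show False using assms(3) by auto
qed

section \<open>Square classes and Frobenius orbits\<close>

lemma square_if_CHAR_2:
  fixes x :: "'q::finite_field"
  assumes "CHAR('q) = 2"
  shows "\<exists>c. x = c ^ 2"
proof -
  obtain f where f: "CARD('q) = CHAR('q) ^ f" "f > 0" by (rule card_finite_field)
  obtain k where "f = Suc k" using f(2) by (cases f) auto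
  then have "(x ^ (2 ^ k)) ^ 2 = x ^ CARD('q)" using f(1) assms by (simp add: mult.commute flip: power_mult)
  then have "x = (x ^ (2 ^ k)) ^ 2" by (simp only: finite_field_power_card_eq_same)
  then show ?thesis by blast
qed

text \<open>Two nonsquares are odd powers of a generator, so their product, and with it their
  quotient, is a square.\<close>

lemma quotient_square:
  fixes x y :: "'q::finite_field"
  assumes "x \<noteq> 0" "y \<noteq> 0" "(\<exists>c. x = c ^ 2) \<longleftrightarrow> (\<exists>c. y = c ^ 2)"
  shows "\<exists>c. c \<noteq> 0 \<and> y / x = c ^ 2"
proof -
  obtain \<gamma> :: 'q where \<gamma>: "\<gamma> \<noteq> 0" "\<And>x. x \<noteq> 0 \<Longrightarrow> \<exists>k. x = \<gamma> ^ k" using finite_field_generator by blast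
  have "\<exists>d. y * x = d ^ 2"
  proof (cases "\<exists>c. x = c ^ 2")
    case True
    then obtain c d where "x = c ^ 2" "y = d ^ 2" using assms(3) by blast
    then show ?thesis by (intro exI [of _ "d * c"]) (simp add: power_mult_distrib)
  next
    case False
    obtain k l where k: "x = \<gamma> ^ k" and l: "y = \<gamma> ^ l" using \<gamma>(2) assms by metis
    have "odd k"
    proof
      assume "even k"
      then obtain m where "k = 2 * m" by blast
      then have "x = (\<gamma> ^ m) ^ 2" using k by (simp add: mult.commute flip: power_mult)
      then show False using False by blast
    qed
    moreover have "odd l"
    proof
      assume "even l"
      then obtain m where "l = 2 * m" by blast
      then have "y = (\<gamma> ^ m) ^ 2" using l by (simp add: mult.commute flip: power_mult)
      then show False using False assms(3) by blast
    qed
    ultimately have "even (l + k)" by simp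
    then obtain m where "l + k = 2 * m" by blast
    then have "y * x = (\<gamma> ^ m) ^ 2" unfolding k l power_add [symmetric] by (simp only: power_even_eq)
    then show ?thesis by blast
  qed
  then obtain d where d: "y * x = d ^ 2" by blast
  then have "y / x = (d / x) ^ 2" using assms(1) by (simp add: power2_eq_square field_simps)
  moreover have "d / x \<noteq> 0" using d assms by auto
  ultimately show ?thesis by blast
qed

text \<open>In odd characteristic \<tau> raises to an odd power 2 m + 1, so \<tau> y = (y^m)^2 y; in
  characteristic 2 every element is a square.\<close>

lemma aut_eq_square_times:
  fixes y :: "'q::finite_field"
  assumes "\<tau> \<in> frob_powers" "y \<noteq> 0"
  shows "\<exists>c. c \<noteq> 0 \<and> \<tau> y = c ^ 2 * y"
proof -
  have "(\<exists>c. y = c ^ 2) \<longleftrightarrow> (\<exists>c. \<tau> y = c ^ 2)"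
  proof (cases "CHAR('q) = 2")
    case True
    then show ?thesis using square_if_CHAR_2 by blast
  next
    case False
    then have odd: "odd (CHAR('q))" using primes_dvd_imp_eq [OF two_is_prime_nat CHAR_prime] by auto
    obtain k where k: "\<And>x. \<tau> x = x ^ (CHAR('q) ^ k)" using assms(1) by (rule frob_powersE) blast
    have "odd (CHAR('q) ^ k)" using odd by simp
    then obtain m where "CHAR('q) ^ k = 2 * m + 1" by (rule oddE)
    then have m: "CHAR('q) ^ k = Suc (2 * m)" by simp
    have eq: "\<tau> y = (y ^ m) ^ 2 * y" unfolding k m by (simp add: mult.commute flip: power_mult)
    show ?thesis
    proof
      assume "\<exists>c. y = c ^ 2"
      then obtain c where "y = c ^ 2" by blast
      then have "\<tau> y = (y ^ m * c) ^ 2" using eq by (simp only: power_mult_distrib)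
      then show "\<exists>c. \<tau> y = c ^ 2" by blast
    next
      assume "\<exists>c. \<tau> y = c ^ 2"
      then obtain c where "(y ^ m) ^ 2 * y = c ^ 2" using eq by auto
      then have "y = (c / y ^ m) ^ 2" using assms(2) by (simp add: power_divide field_simps)
      then show "\<exists>c. y = c ^ 2" by blast
    qed
  qed
  then obtain c where "c \<noteq> 0" "\<tau> y / y = c ^ 2"
    using quotient_square [of y "\<tau> y"] assms by auto
  then show ?thesis using assms(2) by (intro exI [of _ c]) (auto simp: divide_eq_eq)
qed

text \<open>The numerical input of the pigeonhole count below: 1 or 4 square classes, orbits of
  length at most f, and the two excluded elements 0 and 1. For 9 it would read 10 < 9.\<close>

lemma prime_power_bound:
  assumes "prime p" "f \<ge> 2" "p ^ f \<noteq> 9" "p ^ f \<ge> (8::nat)"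
  shows "(if p = 2 then 1 else 4) * f + 2 < p ^ f"
proof (cases "p = 2")
  case True
  have "f \<ge> 3"
  proof (rule ccontr)
    assume "\<not> f \<ge> 3"
    then have "f = 2" using assms(2) by simp
    then show False using assms(4) True by simp
  qed
  then have "f + 2 < 2 ^ f" by (induction rule: dec_induct) auto
  then show ?thesis using True by simp
next
  case False
  then have p3: "p \<ge> 3" using prime_ge_2_nat [OF assms(1)] by simp
  have "4 * f + 2 < p ^ f"
  proof (cases "f = 2")
    case True
    then have "p \<noteq> 3" using assms(3) by auto
    then have "4 ^ 2 \<le> p ^ 2" using p3 by (intro power_mono) auto
    then show ?thesis using True by simp
  next
    case False
    then have "f \<ge> 3" using assms(2) by simp
    then have "4 * f + 2 < 3 ^ f" by (induction rule: dec_induct) auto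
    also have "3 ^ f \<le> p ^ f" using p3 by (rule power_mono) simp
    finally show ?thesis .
  qed
  then show ?thesis using False by simp
qed

text \<open>Sort the elements other than 0 and 1 by whether x and x - 1 are squares. If every class
  lay in a single Frobenius orbit, there would be too few elements by
  \<open>prime_power_bound\<close>.\<close>

lemma exists_nonconjugate_pair:
  assumes q: "CARD('q::finite_field) \<ge> 8" "CARD('q) \<noteq> 9" and frob: "frob \<noteq> (id :: 'q \<Rightarrow> 'q)"
  obtains s t :: "'q::finite_field" where "s \<noteq> 0" "s \<noteq> 1" "t \<noteq> 0" "t \<noteq> 1" "\<forall>\<sigma>\<in>frob_powers. \<sigma> s \<noteq> t"
    "(\<exists>c. s = c ^ 2) \<longleftrightarrow> (\<exists>c. t = c ^ 2)" "(\<exists>c. s - 1 = c ^ 2) \<longleftrightarrow> (\<exists>c. t - 1 = c ^ 2)"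
proof -
  obtain f where f: "CARD('q) = CHAR('q) ^ f" "f > 0" by (rule card_finite_field)
  define \<kappa> where "\<kappa> x = (\<exists>c. x = c ^ 2, \<exists>c. x - 1 = c ^ 2)" for x :: 'q
  let ?F = "UNIV - {0, 1 :: 'q}"
  let ?m = "if CHAR('q) = 2 then 1 else 4 :: nat"
  have "\<exists>s\<in>?F. \<exists>t\<in>?F. \<kappa> s = \<kappa> t \<and> (\<forall>\<sigma>\<in>frob_powers. \<sigma> s \<noteq> t)"
  proof (rule ccontr)
    assume contra: "\<not> ?thesis"
    have fib: "card {x \<in> ?F. \<kappa> x = v} \<le> f" if "v \<in> \<kappa> ` ?F" for v
    proof -
      obtain s where s: "s \<in> ?F" "\<kappa> s = v" using \<open>v \<in> \<kappa> ` ?F\<close> by auto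
      have "{x \<in> ?F. \<kappa> x = v} \<subseteq> (\<lambda>\<sigma>. \<sigma> s) ` frob_powers"
      proof
        fix x assume x: "x \<in> {x \<in> ?F. \<kappa> x = v}"
        then obtain \<sigma> where "\<sigma> \<in> frob_powers" "\<sigma> s = x" using contra s by blast
        then show "x \<in> (\<lambda>\<sigma>. \<sigma> s) ` frob_powers" by blast
      qed
      then have "card {x \<in> ?F. \<kappa> x = v} \<le> card ((\<lambda>\<sigma>. \<sigma> s) ` (frob_powers :: ('q \<Rightarrow> 'q) set))"
        by (intro card_mono) simp_all
      also have "\<dots> \<le> card (frob_powers :: ('q \<Rightarrow> 'q) set)" by (intro card_image_le) simp
      also have "\<dots> \<le> f" using f by (rule card_frob_powers_le)
      finally show ?thesis .
    qed
    have "?F \<subseteq> (\<Union>v\<in>\<kappa> ` ?F. {x \<in> ?F. \<kappa> x = v})" by blast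
    then have "card ?F \<le> card (\<Union>v\<in>\<kappa> ` ?F. {x \<in> ?F. \<kappa> x = v})" by (intro card_mono) simp_all
    also have "\<dots> \<le> (\<Sum>v\<in>\<kappa> ` ?F. card {x \<in> ?F. \<kappa> x = v})" by (intro card_UN_le) simp
    also have "\<dots> \<le> (\<Sum>v\<in>\<kappa> ` ?F. f)" using fib by (rule sum_mono)
    also have "\<dots> = card (\<kappa> ` ?F) * f" by simp
    also have "card (\<kappa> ` ?F) \<le> ?m"
    proof (cases "CHAR('q) = 2")
      case True
      then have "\<kappa> ` ?F \<subseteq> {(True, True)}" using square_if_CHAR_2 by (auto simp: \<kappa>_def)
      then have "card (\<kappa> ` ?F) \<le> card {(True, True)}" by (intro card_mono) auto
      then show ?thesis using True by simp
    next
      case False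
      have "card (\<kappa> ` ?F) \<le> card (UNIV :: (bool \<times> bool) set)" by (intro card_mono) auto
      then show ?thesis using False by (simp add: card_UNIV_bool)
    qed
    finally have "card ?F \<le> ?m * f" by simp
    moreover have "card ?F = CARD('q) - 2" by (subst card_Diff_subset) auto
    moreover have "?m * f + 2 < CHAR('q) ^ f"
      using q f exponent_ge_2 [OF f frob] by (intro prime_power_bound) auto
    ultimately show False using f by linarith
  qed
  then obtain s t where "s \<in> ?F" "t \<in> ?F" "\<kappa> s = \<kappa> t" "\<forall>\<sigma>\<in>frob_powers. \<sigma> s \<noteq> t" by blast
  then show thesis using that [of s t] by (simp add: \<kappa>_def)
qed

section \<open>Frobenius modulo cubes\<close>

lemma aut_in_id_frob:
  assumes "frob \<circ> frob = (id :: 'q::finite_field \<Rightarrow> 'q)" "\<sigma> \<in> frob_powers"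
  shows "\<sigma> = id \<or> \<sigma> = (frob :: 'q \<Rightarrow> 'q)"
proof -
  obtain l where l: "\<sigma> = frob ^^ l" using assms(2) unfolding frob_powers_def by blast
  have "(frob ^^ l :: 'q \<Rightarrow> 'q) = id \<or> frob ^^ l = (frob :: 'q \<Rightarrow> 'q)"
  proof (induction l)
    case (Suc l)
    then show ?case using assms(1) by (simp only: funpow.simps) (elim disjE, simp_all)
  qed simp
  then show ?thesis using l by blast
qed

text \<open>In the first case \<open>\<psi>\<close> is the Frobenius automorphism or its square; in the second case
  \<open>q = p\<^sup>2\<close> with \<open>p\<close> congruent to 2 modulo 3.\<close>

lemma mod_cubes_cases:
  assumes frob: "frob \<noteq> (id :: 'q::finite_field \<Rightarrow> 'q)"
  obtains (trivial) \<psi> :: "'q::finite_field \<Rightarrow> 'q" where "\<psi> \<in> frob_powers" "\<psi> \<noteq> id"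
      "\<And>x. x \<noteq> 0 \<Longrightarrow> \<exists>t. t \<noteq> 0 \<and> \<psi> x = t ^ 3 * x"
  | (inverting) \<omega> a :: "'q::finite_field" where "frob \<circ> frob = (id :: 'q \<Rightarrow> 'q)"
      "1 + \<omega> + \<omega> * \<omega> = 0" "frob \<omega> = \<omega> * \<omega>" "\<omega> * \<omega> \<noteq> \<omega>"
      "a \<noteq> 0" "\<And>t. t \<noteq> 0 \<Longrightarrow> frob a \<noteq> t ^ 3 * a"
proof (cases "\<forall>x :: 'q. x \<noteq> 0 \<longrightarrow> (\<exists>t. t \<noteq> 0 \<and> frob x = t ^ 3 * x)")
  case True
  then show ?thesis using trivial [of frob] frob by simp
next
  case False
  then obtain a :: 'q where a: "a \<noteq> 0" "\<And>t. t \<noteq> 0 \<Longrightarrow> frob a \<noteq> t ^ 3 * a" by blast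
  let ?p = "CHAR('q)"
  have "?p \<noteq> 0" by simp
  \<comment> \<open>In characteristic 3 every element is a cube.\<close>
  have p3: "?p \<noteq> 3"
  proof
    assume p: "?p = 3"
    have "inj (frob :: 'q \<Rightarrow> 'q)" by (rule injI) simp
    then have "surj (frob :: 'q \<Rightarrow> 'q)" by (rule finite_UNIV_inj_surj [OF finite])
    then obtain t where "frob t = frob a / a" by (metis surjD)
    then have "t ^ 3 = frob a / a" using p by (simp add: frob_def)
    then have "frob a = t ^ 3 * a" "t \<noteq> 0" using a(1) by auto
    then show False using a(2) by blast
  qed
  have not1: "?p mod 3 \<noteq> 1"
  proof
    assume "?p mod 3 = 1"
    then have "?p = 3 * (?p div 3) + 1" by (metis mult_div_mod_eq)
    then have "frob a = (a ^ (?p div 3)) ^ 3 * a"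
      by (metis frob_def mult.commute power_add power_mult power_one_right)
    then show False using a by simp
  qed
  have not0: "?p mod 3 \<noteq> 0"
  proof
    assume "?p mod 3 = 0"
    then have "3 dvd ?p" by auto
    then show False using p3 primes_dvd_imp_eq [of 3 ?p] CHAR_prime by auto
  qed
  define m where "m = ?p div 3"
  have p: "?p = 3 * m + 2"
    using not0 not1 mult_div_mod_eq [of 3 ?p] mod_less_divisor [of 3 ?p] unfolding m_def by linarith
  \<comment> \<open>This is (p^2 - 1) / 3, so the square of Frobenius maps x to (x^d)^3 x and is
    trivial modulo cubes.\<close>
  define d where "d = 3 * m * m + 4 * m + 1"
  have d: "d > 0" and p2: "?p ^ 2 = 3 * d + 1"
    unfolding p d_def by (simp_all add: power2_eq_square algebra_simps)
  show ?thesis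
  proof (cases "frob \<circ> frob = (id :: 'q \<Rightarrow> 'q)")
    case False
    have "\<exists>t. t \<noteq> 0 \<and> (frob \<circ> frob) x = t ^ 3 * x" if x: "x \<noteq> 0" for x :: 'q
    proof -
      have "(frob \<circ> frob) x = x ^ (?p ^ 2)"
        by (simp add: frob_def power2_eq_square flip: power_mult)
      also have "\<dots> = (x ^ d) ^ 3 * x"
        unfolding p2 by (simp only: power_add power_mult power_one_right mult.commute [of 3])
      finally show ?thesis using x by (intro exI [of _ "x ^ d"]) simp
    qed
    then show ?thesis using trivial [of "frob \<circ> frob"] False by (simp add: frob_powers_comp)
  next
    case True
    obtain f where f: "CARD('q) = ?p ^ f" "f > 0" by (rule card_finite_field)
    have "f \<ge> 2" using exponent_ge_2 [OF f frob] .
    obtain \<gamma> :: 'q where \<gamma>: "\<gamma> \<noteq> 0" "\<And>x. x \<noteq> 0 \<Longrightarrow> \<exists>k. x = \<gamma> ^ k" using finite_field_generator by blast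
    have "\<gamma> ^ (?p ^ 2) = \<gamma>"
      using fun_cong [OF True, of \<gamma>] by (simp add: frob_def power2_eq_square flip: power_mult)
    then have "\<gamma> ^ (3 * d) * \<gamma> = \<gamma>" unfolding p2 by (simp only: power_add power_one_right)
    then have "\<gamma> ^ (3 * d) = 1" using \<gamma>(1) by (simp only: mult_cancel_right2 simp_thms)
    \<comment> \<open>If Frobenius has order 2, then \<gamma>^(3 d) = 1 and \<gamma>^d is a
      primitive cube root of unity, inverted by Frobenius since p is 2 modulo 3.\<close>
    define \<omega> where "\<omega> = \<gamma> ^ d"
    have \<omega>3: "\<omega> ^ 3 = 1" using \<open>\<gamma> ^ (3 * d) = 1\<close> unfolding \<omega>_def by (simp only: power_mult [symmetric] mult.commute)
    have "?p ^ 2 \<le> CARD('q)" using f(1) power_increasing [OF \<open>f \<ge> 2\<close>, of ?p] \<open>?p \<noteq> 0\<close> by simp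
    have \<omega>1: "\<omega> \<noteq> 1"
    proof
      assume "\<omega> = 1"
      then have "CARD('q) \<le> d + 1" using power_generator_eq_1 [OF \<gamma>, of d] d by (simp add: \<omega>_def)
      then show False using \<open>?p ^ 2 \<le> CARD('q)\<close> p2 d by linarith
    qed
    have \<omega>0: "\<omega> \<noteq> 0" using \<gamma>(1) by (simp add: \<omega>_def)
    show ?thesis
    proof (rule inverting [OF True _ _ _ a])
      have "(\<omega> - 1) * (1 + \<omega> + \<omega> * \<omega>) = \<omega> ^ 3 - 1" by (simp add: algebra_simps power3_eq_cube)
      then show "1 + \<omega> + \<omega> * \<omega> = 0" using \<omega>3 \<omega>1 by simp
      have "frob \<omega> = (\<omega> ^ 3) ^ m * (\<omega> * \<omega>)" unfolding frob_def p by (simp add: power_add power_mult power2_eq_square)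
      then show "frob \<omega> = \<omega> * \<omega>" by (simp add: \<omega>3)
      show "\<omega> * \<omega> \<noteq> \<omega>" using \<omega>0 \<omega>1 by simp
    qed
  qed
qed

text \<open>The multiplicative group modulo cubes is cyclic of order at most 3, so a noncube
  generates it; on exponents this is arithmetic modulo 3.\<close>

lemma cube_coset_cases:
  fixes \<delta> x :: "'q::finite_field"
  assumes \<delta>: "\<delta> \<noteq> 0" "\<And>t. \<delta> \<noteq> t ^ 3" and x: "x \<noteq> 0"
  shows "\<exists>t. t \<noteq> 0 \<and> (x = t ^ 3 \<or> x = t ^ 3 * \<delta> \<or> x = t ^ 3 * (\<delta> * \<delta>))"
proof -
  obtain \<gamma> :: 'q where \<gamma>: "\<gamma> \<noteq> 0" "\<And>x. x \<noteq> 0 \<Longrightarrow> \<exists>k. x = \<gamma> ^ k" using finite_field_generator by blast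
  obtain k l where k: "x = \<gamma> ^ k" and l: "\<delta> = \<gamma> ^ l" using \<gamma>(2) \<delta>(1) x by metis
  have "\<not> 3 dvd l"
  proof
    assume "3 dvd l"
    then obtain r where "l = 3 * r" by blast
    then show False using \<delta>(2) [of "\<gamma> ^ r"] l by (simp add: mult.commute flip: power_mult)
  qed
  then have "3 dvd k \<or> 3 dvd k + 2 * l \<or> 3 dvd k + l" by presburger
  then show ?thesis
  proof (elim disjE)
    assume "3 dvd k"
    then obtain r where "k = 3 * r" by blast
    then have "x = (\<gamma> ^ r) ^ 3" using k by (simp add: mult.commute flip: power_mult)
    then show ?thesis using \<gamma>(1) by (intro exI [of _ "\<gamma> ^ r"]) simp
  next
    assume "3 dvd k + 2 * l"
    then obtain r where "k + 2 * l = 3 * r" by blast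
    then have "\<gamma> ^ (k + 2 * l) = (\<gamma> ^ r) ^ 3" by (simp only: mult.commute [of 3] power_mult)
    then have "x * (\<delta> * \<delta>) = (\<gamma> ^ r) ^ 3" by (simp only: k l power_add mult_2)
    then have "x = (\<gamma> ^ r / \<delta>) ^ 3 * \<delta>" using \<delta>(1) by (simp add: power_divide power3_eq_cube field_simps)
    then show ?thesis using \<gamma>(1) \<delta>(1) by (intro exI [of _ "\<gamma> ^ r / \<delta>"]) simp
  next
    assume "3 dvd k + l"
    then obtain r where "k + l = 3 * r" by blast
    then have "\<gamma> ^ (k + l) = (\<gamma> ^ r) ^ 3" by (simp only: mult.commute [of 3] power_mult)
    then have "x * \<delta> = (\<gamma> ^ r) ^ 3" by (simp only: k l power_add)
    then have "x = (\<gamma> ^ r / \<delta>) ^ 3 * (\<delta> * \<delta>)" using \<delta>(1) by (simp add: power_divide power3_eq_cube field_simps)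
    then show ?thesis using \<gamma>(1) \<delta>(1) by (intro exI [of _ "\<gamma> ^ r / \<delta>"]) simp
  qed
qed

section \<open>The theorem\<close>

context semilinear_group
begin

text \<open>If some nontrivial automorphism is trivial modulo cubes, the linear matches of the two
  flats suffice. Otherwise \<psi> is Frobenius, of order 2. A noncube determinant in the linear part
  then gives all of GL and the bound 6; if there is none, the five-point configuration
  applies.\<close>

lemma rc_ge_5_if_dim_3:
  assumes n: "CARD('n) = 3" and \<psi>: "(A0, \<psi>) \<in> R" "\<psi> \<noteq> id"
  shows "5 \<le> rc R"
proof -
  have \<psi>_aut: "\<psi> \<in> frob_powers" using R_carrier \<psi>(1) by blast
  show ?thesis
  proof (rule mod_cubes_cases [OF frob_neq_id_if_aut_neq_id [OF \<psi>_aut \<psi>(2)]])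
    fix \<tau> :: "'q \<Rightarrow> 'q"
    assume "\<tau> \<in> frob_powers" "\<tau> \<noteq> id" "\<And>x. x \<noteq> 0 \<Longrightarrow> \<exists>t. t \<noteq> 0 \<and> \<tau> x = t ^ 3 * x"
    then show ?thesis by (rule rc_ge_5_if_trivial_mod_cubes [OF n])
  next
    fix \<omega> a :: 'q
    assume frob2: "frob \<circ> frob = (id :: 'q \<Rightarrow> 'q)"
      and \<omega>: "1 + \<omega> + \<omega> * \<omega> = 0" "frob \<omega> = \<omega> * \<omega>" "\<omega> * \<omega> \<noteq> \<omega>"
      and a: "a \<noteq> 0" "\<And>t. t \<noteq> 0 \<Longrightarrow> frob a \<noteq> t ^ 3 * a"
    have \<psi>_eq: "\<psi> = frob" using aut_in_id_frob [OF frob2 \<psi>_aut] \<psi>(2) by blast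
    show ?thesis
    proof (cases "\<forall>C. (C, id) \<in> R \<longrightarrow> (\<exists>t. det C = t ^ 3)")
      case False
      then obtain C where C: "(C, id) \<in> R" "\<And>t. det C \<noteq> t ^ 3" by blast
      have det_C: "det C \<noteq> 0" using R_carrier [OF C(1)] by (simp add: invertible_det_nz)
      have CC: "(C ** C, id) \<in> R" using R_mult [OF C(1) C(1)] by simp
      have "(A, id) \<in> R" if A: "invertible A" for A
      proof -
        have "det A \<noteq> 0" using A by (simp add: invertible_det_nz)
        then obtain t where "t \<noteq> 0"
          "det A = t ^ 3 \<or> det A = t ^ 3 * det C \<or> det A = t ^ 3 * (det C * det C)"
          using cube_coset_cases [OF det_C C(2)] by blast
        then show ?thesis
          using R_nth_power_det [of A t] R_same_det [OF C(1), of A t] R_same_det [OF CC, of A t] n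
          by (auto simp: det_mul)
      qed
      then have "CARD('n) + 3 \<le> rc R" using n \<psi> by (intro rc_ge_if_general_linear) auto
      then show ?thesis using n by simp
    next
      case True
      have A0: "(A0, frob) \<in> R" using \<psi>(1) \<psi>_eq by simp
      have det0: "det A0 \<noteq> 0" using R_carrier [OF A0] by (simp add: invertible_det_nz)
      \<comment> \<open>Take b = 1 if \<open>det A0\<close> is not a cube, and otherwise b = a, for
        which frob a / a is not a cube.\<close>
      have "\<exists>b. b \<noteq> 0 \<and> (\<forall>t. det A0 * frob b / b \<noteq> t ^ 3)"
      proof (cases "\<exists>c. det A0 = c ^ 3")
        case False
        then show ?thesis by (intro exI [of _ 1]) simp
      next
        case c: True
        then obtain c where c: "det A0 = c ^ 3" by blast
        have "det A0 * frob a / a \<noteq> t ^ 3" for t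
        proof
          assume t: "det A0 * frob a / a = t ^ 3"
          have "c \<noteq> 0" using c det0 by auto
          then have "frob a = (t / c) ^ 3 * a" using t a(1) c by (simp add: power_divide field_simps)
          moreover have "frob a \<noteq> 0" using a(1) by simp
          ultimately show False using a(2) [of "t / c"] by auto
        qed
        then show ?thesis using a(1) by blast
      qed
      then obtain b where "b \<noteq> 0" "\<And>t. det A0 * frob b / b \<noteq> t ^ 3" by blast
      then show ?thesis
        using rc_ge_5_if_Frobenius_inverts_cubes [OF n frob2 \<omega> A0] True by blast
    qed
  qed
qed

text \<open>s and t have the same square class, and so have s - 1 and t - 1. All three required
  values are thus squares, and linear maps from SL and the scalars give the local matches.\<close>

lemma rc_ge_4_if_not_9:
  assumes n: "CARD('n) = 2" and q: "CARD('q) \<ge> 8" "CARD('q) \<noteq> 9" and \<psi>: "(A0, \<psi>) \<in> R" "\<psi> \<noteq> id"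
  shows "4 \<le> rc R"
proof -
  have \<psi>_aut: "\<psi> \<in> frob_powers" using R_carrier \<psi>(1) by blast
  obtain s t :: 'q where st: "s \<noteq> 0" "s \<noteq> 1" "t \<noteq> 0" "t \<noteq> 1" "\<forall>\<sigma>\<in>frob_powers. \<sigma> s \<noteq> t"
    "(\<exists>c. s = c ^ 2) \<longleftrightarrow> (\<exists>c. t = c ^ 2)" "(\<exists>c. s - 1 = c ^ 2) \<longleftrightarrow> (\<exists>c. t - 1 = c ^ 2)"
    using exists_nonconjugate_pair [OF q frob_neq_id_if_aut_neq_id [OF \<psi>_aut \<psi>(2)]] .
  obtain c where c: "c \<noteq> 0" "t / s = c ^ 2" using quotient_square [OF st(1,3,6)] by blast
  have st1: "s - 1 \<noteq> 0" "t - 1 \<noteq> 0" using st(2,4) by simp_all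
  obtain d where d: "d \<noteq> 0" "(t - 1) / (s - 1) = d ^ 2" using quotient_square [OF st1 st(7)] by blast
  have sq: "\<exists>e. e \<noteq> 0 \<and> r = e ^ 2"
    if r: "r \<in> {t / s, (t - 1) / (s - 1), (t / s) * ((t - 1) / (s - 1))}" for r
  proof -
    have "r = c ^ 2 \<or> r = d ^ 2 \<or> r = (c * d) ^ 2" using r unfolding c(2) d(2) by (auto simp: power_mult_distrib)
    then show ?thesis using c(1) d(1) by (auto intro: exI [of _ c] exI [of _ d] exI [of _ "c * d"])
  qed
  show ?thesis
  proof (rule rc_ge_4_if_dim_2 [OF n st(1-4)])
    show "\<sigma> s \<noteq> t" if "\<sigma> \<in> frob_powers" for \<sigma> using st(5) that by blast
    show "\<exists>c. c \<noteq> 0 \<and> \<tau> y = c ^ 2 * y" if "\<tau> \<in> frob_powers" "y \<noteq> 0" for \<tau> and y :: 'q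
      using aut_eq_square_times [OF that] .
  next
    fix r assume r: "r \<in> {t / s, (t - 1) / (s - 1), (t / s) * ((t - 1) / (s - 1))}"
    obtain e where e: "e \<noteq> 0" "r = e ^ 2" using sq [OF r] by blast
    have "(B, id) \<in> R" if "a \<noteq> 0" "det B = a ^ 2 * r" for B a
      using R_nth_power_det [of B "a * e"] that e n by (simp add: power_mult_distrib)
    then show "\<exists>\<tau>\<in>frob_powers. \<forall>B c. c \<noteq> 0 \<longrightarrow> det B = c ^ 2 * r \<longrightarrow> (B, \<tau>) \<in> R"
      by (intro bexI [of _ id]) auto
  qed
qed

text \<open>Every automorphism fixes -1, so any other t is non-conjugate to s = -1. Square values
  are matched linearly and nonsquare ones with the automorphism of \<open>A1\<close>, since
  nonsquares form a single class. This serves q = 9, where the pigeonhole count fails.\<close>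

lemma rc_ge_4_if_det_nonsquare:
  assumes n: "CARD('n) = 2" and q: "CARD('q) \<ge> 4" "CHAR('q) \<noteq> 2"
    and A1: "(A1, \<tau>1) \<in> R" "\<And>c. det A1 \<noteq> c ^ 2"
  shows "4 \<le> rc R"
proof -
  have det1: "det A1 \<noteq> 0" using A1(2) [of 0] by simp
  note neg1 = one_neq_minus_one [OF q(2)]
  obtain t :: 'q where t: "t \<notin> {0, 1, -1}"
    by (rule obtain_outside [of "{0, 1, -1 :: 'q}" UNIV]) (use q(1) in \<open>auto simp: card_insert_if\<close>)
  show ?thesis
  proof (rule rc_ge_4_if_dim_2 [OF n, of "- 1" t])
    show "\<sigma> (- 1) \<noteq> t" if "\<sigma> \<in> frob_powers" for \<sigma> using that t by auto
  next
    fix r assume "r \<in> {t / - 1, (t - 1) / (- 1 - 1), t / - 1 * ((t - 1) / (- 1 - 1))}"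
    moreover have "(- 1 :: 'q) - 1 \<noteq> 0" using neg1 by (metis right_minus_eq)
    ultimately have r0: "r \<noteq> 0" using t by auto
    show "\<exists>\<tau>\<in>frob_powers. \<forall>B c. c \<noteq> 0 \<longrightarrow> det B = c ^ 2 * r \<longrightarrow> (B, \<tau>) \<in> R"
    proof (cases "\<exists>e. r = e ^ 2")
      case True
      then obtain e where e: "r = e ^ 2" "e \<noteq> 0" using r0 by auto
      have "(B, id) \<in> R" if "a \<noteq> 0" "det B = a ^ 2 * r" for B a
        using R_nth_power_det [of B "a * e"] that e n by (simp add: power_mult_distrib)
      then show ?thesis by (intro bexI [of _ id]) auto
    next
      case False
      then obtain e where e: "e \<noteq> 0" "r / det A1 = e ^ 2"
        using quotient_square [of "det A1" r] det1 r0 A1(2) by auto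
      have r: "r = e ^ 2 * det A1" using e(2) det1 by (simp add: divide_eq_eq)
      have "(B, \<tau>1) \<in> R" if "a \<noteq> 0" "det B = a ^ 2 * r" for B a
        using R_same_det [OF A1(1), of B "a * e"] that e(1) n r by (simp add: power_mult_distrib)
      moreover have "\<tau>1 \<in> frob_powers" using R_carrier A1(1) by blast
      ultimately show ?thesis by (intro bexI [of _ \<tau>1]) auto
    qed
  qed (use t neg1 aut_eq_square_times in auto)
qed

end

theorem theorem2:
  fixes H :: "(('q::finite_field ^ 'n::finite ^ 'n) \<times> ('q \<Rightarrow> 'q)) set set"
    and q n e :: nat
  assumes q_def: "q = CARD('q)"
    and n_def: "n = CARD('n)"
    and n_ge_2: "n \<ge> 2"
    and H_subgroup: "subgroup H PGammaL"
    and PSL_le_H: "PSL \<subseteq> H"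
    and e_def: "e = index_in PGammaL H (H \<inter> PGL)"
    and e_gt_1: "e > 1"
  shows
    "(n = 2 \<and> q \<ge> 8 \<longrightarrow>
        (if q = 9 \<and> H = PSigmaL
         then rel_complexity H proj_act points = 3
         else 4 + omega e \<ge> rel_complexity H proj_act points \<and>
              rel_complexity H proj_act points \<ge> 4)) \<and>
     (n \<ge> 3 \<longrightarrow>
        2 * n - 1 + omega e \<ge> rel_complexity H proj_act points \<and>
        rel_complexity H proj_act points \<ge> n + 2 \<and>
        (PGL \<subset> H \<longrightarrow> rel_complexity H proj_act points \<ge> n + 3) \<and>
        (H \<subseteq> PSigmaL \<and> PSigmaL \<noteq> carrier (PGammaL :: (('q ^ 'n ^ 'n) \<times> ('q \<Rightarrow> 'q)) set monoid) \<longrightarrow>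
           rel_complexity H proj_act points \<ge> 2 * n - 2))"
proof -
  interpret semilinear_group "reps H" using H_subgroup PSL_le_H by (rule semilinear_group_reps)
  interpret H: subgroup H PGammaL by (rule H_subgroup)
  let ?R = "reps H"
  have rc: "rel_complexity H proj_act points = rc ?R"
    unfolding rc_def by (rule rel_complexity_eq [OF H.subset])
  have e: "e = card auts"
    unfolding e_def auts_def by (rule index_in_eq_card [OF H_subgroup PSL_le_H])
  have "auts \<noteq> {id}" using e e_gt_1 by auto
  moreover have "id \<in> auts" using R_one by (force simp: auts_def)
  ultimately obtain \<psi> where "\<psi> \<in> auts" "\<psi> \<noteq> id" by blast
  then obtain A0 where \<psi>: "(A0, \<psi>) \<in> ?R" "\<psi> \<noteq> id" by (auto simp: auts_def)
  have n2: "CARD('n) \<ge> 2" using n_ge_2 n_def by simp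
  have upper: "rc ?R \<le> max (2 * n - 2) (n + 1) + 1 + omega e"
    using rc_determines(3) [OF n2] by (simp add: n_def e)
  have dim2: "if q = 9 \<and> H = PSigmaL then rc ?R = 3 else rc ?R \<ge> 4" if n: "n = 2" and q: "q \<ge> 8"
  proof (cases "q = 9")
    case False
    then show ?thesis using rc_ge_4_if_not_9 [OF _ _ _ \<psi>] n q by (simp add: n_def q_def)
  next
    case True
    then have q9: "CARD('q) = 9" by (simp add: q_def)
    have n': "CARD('n) = 2" using n n_def by simp
    have p3: "CHAR('q) = 3" using q9 by (rule CHAR_if_card_9)
    have "(frob (frob x) :: 'q) = x" for x
      using finite_field_power_card_eq_same [of x] by (simp add: frob_def p3 q9 flip: power_mult)
    then have "frob \<circ> frob = (id :: 'q \<Rightarrow> 'q)" by auto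
    then have auts2: "\<sigma> = id \<or> \<sigma> = \<psi>" if "\<sigma> \<in> frob_powers" for \<sigma>
      using that aut_in_id_frob \<psi> R_carrier by metis
    \<comment> \<open>For q = 9 the determinants decide: since the only nontrivial automorphism
      occurs in \<open>H\<close>, all of them are squares exactly when \<open>H\<close> is
      \<open>PSigmaL\<close>.\<close>
    show ?thesis
    proof (cases "\<forall>A \<sigma>. (A, \<sigma>) \<in> ?R \<longrightarrow> (\<exists>c. det A = c ^ 2)")
      case False
      then obtain A1 \<tau>1 where A1: "(A1, \<tau>1) \<in> ?R" "\<And>c. det A1 \<noteq> c ^ 2" by blast
      then have "H \<noteq> PSigmaL" using det_reps_if_subset_PSigmaL [of H A1 \<tau>1] n' by auto
      moreover have "4 \<le> rc ?R" using rc_ge_4_if_det_nonsquare [OF n' _ _ A1] q9 p3 by simp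
      ultimately show ?thesis by simp
    next
      case dets: True
      have R: "(A, \<sigma>) \<in> ?R \<longleftrightarrow> \<sigma> \<in> frob_powers \<and> (\<exists>c. c \<noteq> 0 \<and> det A = c ^ 2)" for A \<sigma>
      proof
        assume A: "(A, \<sigma>) \<in> ?R"
        then obtain c where "det A = c ^ 2" using dets by blast
        moreover have "det A \<noteq> 0" "\<sigma> \<in> frob_powers" using R_carrier [OF A] by (simp_all add: invertible_det_nz)
        ultimately show "\<sigma> \<in> frob_powers \<and> (\<exists>c. c \<noteq> 0 \<and> det A = c ^ 2)" by auto
      next
        assume A: "\<sigma> \<in> frob_powers \<and> (\<exists>c. c \<noteq> 0 \<and> det A = c ^ 2)"
        then obtain c where c: "c \<noteq> 0" "det A = c ^ 2" by blast
        obtain d where d: "det A0 = d ^ 2" using dets \<psi>(1) by blast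
        have "d \<noteq> 0" using d R_carrier [OF \<psi>(1)] by (auto simp: invertible_det_nz)
        have "(A, id) \<in> ?R" using c n' by (intro R_nth_power_det) auto
        moreover have "(A, \<psi>) \<in> ?R"
          using c d \<open>d \<noteq> 0\<close> n' by (intro R_same_det [OF \<psi>(1), of A "c / d"]) (simp_all add: power_divide)
        ultimately show "(A, \<sigma>) \<in> ?R" using A auts2 by blast
      qed
      have "H = PSigmaL"
      proof
        show "H \<subseteq> PSigmaL"
        proof
          fix C assume C: "C \<in> H"
          then obtain A \<sigma> where A: "C = scalars #>\<^bsub>GammaL\<^esub> (A, \<sigma>)" "(A, \<sigma>) \<in> ?R"
            using H.subset by (force simp: PGammaL_def carrier_FactGroup reps_def)
          then obtain c where "c \<noteq> 0" "det A = c ^ 2" "\<sigma> \<in> frob_powers" using R by blast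
          then show "C \<in> PSigmaL" using coset_in_PSigmaL [of A c \<sigma>] A(1) n' by simp
        qed
        show "PSigmaL \<subseteq> H"
        proof
          fix C :: "(('q ^ 'n ^ 'n) \<times> ('q \<Rightarrow> 'q)) set" assume "C \<in> PSigmaL"
          then obtain A \<sigma> where A: "C = scalars #>\<^bsub>GammaL\<^esub> (A, \<sigma>)" "det A = 1" "\<sigma> \<in> frob_powers"
            unfolding PSigmaL_def mod_scalars_def SL_def by blast
          then have "(A, \<sigma>) \<in> ?R" using R [of A \<sigma>] by (auto intro: exI [of _ 1])
          then show "C \<in> H" using A(1) by (simp add: reps_def)
        qed
      qed
      then show ?thesis using rc_exceptional [OF n' q9 R] True by simp
    qed
  qed
  have dim3: "rc ?R \<ge> n + 2" if "n \<ge> 3"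
  proof (cases "n = 3")
    case True
    then show ?thesis using rc_ge_5_if_dim_3 [OF _ \<psi>] by (simp add: n_def)
  next
    case False
    then show ?thesis using rc_ge_if_dim_ge_4 [OF _ \<psi>] that by (simp add: n_def)
  qed
  have GL: "rc ?R \<ge> n + 3" if "n \<ge> 3" "PGL \<subset> H"
    using rc_ge_if_general_linear [OF _ _ \<psi>] reps_if_PGL_subset that by (auto simp: n_def)
  have SL: "rc ?R \<ge> 2 * n - 2"
    if n3: "n \<ge> 3" and H: "H \<subseteq> PSigmaL" and neq: "PSigmaL \<noteq> carrier (PGammaL :: (('q ^ 'n ^ 'n) \<times> ('q \<Rightarrow> 'q)) set monoid)"
  proof -
    obtain \<mu> :: 'q where \<mu>: "\<mu> \<noteq> 0" "\<forall>c. \<mu> \<noteq> c ^ CARD('n)" using nonpower_if_PSigmaL_neq [OF neq] .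
    have "2 * CARD('n) - 2 \<le> rc ?R"
    proof (rule rc_ge_if_dets_powers)
      show "CARD('n) \<ge> 3" using n3 n_def by simp
      show "\<exists>t. t \<noteq> 0 \<and> det A = t ^ CARD('n)" if "(A, \<sigma>) \<in> ?R" for A \<sigma>
        using det_reps_if_subset_PSigmaL [OF H that] .
    qed (use \<mu> in blast)+
    then show ?thesis by (simp add: n_def)
  qed
  have "2 * n - 1 + omega e \<ge> rc ?R" if "n \<ge> 3"
  proof -
    \<comment> \<open>From n = 3 on the maximum is 2 n - 2 and the one additional point gives 2 n -
      1; for n = 2 it is 3, which gives 4.\<close>
    have "max (2 * n - 2) (n + 1) = 2 * n - 2" using that by simp
    then show ?thesis using upper that by simp
  qed
  moreover have "4 + omega e \<ge> rc ?R" if "n = 2" using upper that by simp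
  ultimately show ?thesis
    unfolding rc using dim2 dim3 GL SL by presburger
qed

end
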